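(* Let $\mathfrak X=\mathrm{Spf}\,R[[S_1,\dots,S_n,Z]]$, let $f\in R[[S_1,\dots,S_n,Z]]$ be a $Z$-distinguished power series, let $r\in\mathbb N$, and let $\mathfrak X'$ be the affine open part of the admissible formal blowup of $\mathfrak X$ in the ideal $(\pi^{r+1},S_1,\dots,S_n)$ where the pullback of this ideal is generated by $\pi^{r+1}$. Let $\mathfrak X_\pi$ and $(\mathfrak X')_\pi$ denote the envelopes of $\mathfrak X$ and $\mathfrak X'$, and let $\mathfrak X_{\pi,f}\subseteq\mathfrak X_\pi$ and $(\mathfrak X')_{\pi,f}\subseteq(\mathfrak X')_\pi$ be the non-vanishing loci of $f$. Let $g$ and $h$ be global functions on $\mathfrak{X}_{\pi,f}$ and $(\mathfrak{X}')_\pi$ respectively whose pullbacks to $(\mathfrak{X}')_{\pi,f}$ coincide. Then $g$ and $h$ are the pullbacks of a unique global function on $\mathfrak{X}_\pi$.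
   Context: $R$ is a complete discrete valuation ring with residue field $k$, fraction field $K$ and uniformizer $\pi$. A power series $f\in R[[S_1,\dots,S_n,Z]]$ is $Z$-distinguished if its image in $k[[Z]]$ (reduction modulo $\pi,S_1,\dots,S_n$) is a nonzero non-unit. For an affine formal $R$-scheme $\mathrm{Spf}\,A$ whose topological ring $A$ is a quotient of some $R[[S]]\langle T\rangle$ in finitely many variables (an $R$-algebra of formally finite type, with the topology induced by the $(\pi,S)$-adic one), the envelope $(\mathrm{Spf}\,A)_\pi$ is $\mathrm{Spf}\,A^\pi$, where $A^\pi$ is the ring $A$ equipped with its $\pi$-adic topology; the non-vanishing locus of $f\in A$ on it is the open formal subscheme given by the $\pi$-adically completed localization of $A$ at $f$. With $A=R[[S_1,\dots,S_n,Z]]$, the scheme $\mathfrak X'$ is $\mathrm{Spf}$ of $A'=A\langle T_1,\dots,T_n\rangle/(\pi^{r+1}T_i-S_i)_i/(\pi\text{-torsion})$, and the morphism $\mathfrak X'\to\mathfrak X$ corresponds to $A\to A'$, inducing $(\mathfrak X')_\pi\to\mathfrak X_\pi$ and $(\mathfrak X')_{\pi,f}\to\mathfrak X_{\pi,f}$ (where $f$ also denotes its image in $A'$). *)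

theory Defs
  imports "HOL-Algebra.Algebra"
begin

section \<open>Power series\<close>

text \<open>As in \<^theory>\<open>HOL-Algebra.Indexed_Polynomials\<close>, a monomial is a finite multiset of variables
  and a series is the function sending a monomial to its coefficient.\<close>

definition power_series :: "('a, 'm) ring_scheme \<Rightarrow> 'v set \<Rightarrow> ('v multiset \<Rightarrow> 'a) ring" where
  "power_series R V =
    \<lparr> carrier = {F. ring.carrier_coeff R F \<and> (\<forall>m. \<not> set_mset m \<subseteq> V \<longrightarrow> F m = \<zero>\<^bsub>R\<^esub>)},
      monoid.mult = (\<lambda>F G m. \<Oplus>\<^bsub>R\<^esub>a\<in>{a. a \<subseteq># m}. F a \<otimes>\<^bsub>R\<^esub> G (m - a)),
      one = ring.indexed_const R \<one>\<^bsub>R\<^esub>,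
      ring.zero = ring.indexed_const R \<zero>\<^bsub>R\<^esub>,
      ring.add = ring.indexed_padd R \<rparr>"

abbreviation ideal_pow :: "('a, 'm) ring_scheme \<Rightarrow> 'a set \<Rightarrow> nat \<Rightarrow> 'a set" where
  "ideal_pow R I k \<equiv> I [^]\<^bsub>ideals_set R\<^esub> k"

text \<open>For a ring \<open>A\<close> complete in its \<open>I\<close>-adic topology this is \<open>A\<langle>V\<rangle>\<close>:
  the power series whose coefficients converge to zero.\<close>

definition restricted_series ::
    "('a, 'm) ring_scheme \<Rightarrow> 'a set \<Rightarrow> 'v set \<Rightarrow> ('v multiset \<Rightarrow> 'a) ring" where
  "restricted_series A I V = (power_series A V)
    \<lparr> carrier := {F \<in> carrier (power_series A V). \<forall>k. finite {m. F m \<notin> ideal_pow A I k}} \<rparr>"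


section \<open>Localization\<close>

text \<open>The fraction \<open>a/s\<close> is the class of all pairs equivalent to \<open>(a, s)\<close>.  As for
  \<^const>\<open>rcoset_mult\<close>, operations on classes are unions over all representatives;
  all members of these unions coincide.\<close>

definition fraction :: "('a, 'm) ring_scheme \<Rightarrow> 'a set \<Rightarrow> 'a \<Rightarrow> 'a \<Rightarrow> ('a \<times> 'a) set" where
  "fraction R S a s = {(b, t). b \<in> carrier R \<and> t \<in> S \<and>
     (\<exists>u\<in>S. u \<otimes>\<^bsub>R\<^esub> (a \<otimes>\<^bsub>R\<^esub> t) = u \<otimes>\<^bsub>R\<^esub> (b \<otimes>\<^bsub>R\<^esub> s))}"

definition fraction_ring :: "('a, 'm) ring_scheme \<Rightarrow> 'a set \<Rightarrow> ('a \<times> 'a) set ring" where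
  "fraction_ring R S =
    \<lparr> carrier = {fraction R S a s | a s. a \<in> carrier R \<and> s \<in> S},
      monoid.mult = (\<lambda>x y. \<Union>(a, s)\<in>x. \<Union>(b, t)\<in>y. fraction R S (a \<otimes>\<^bsub>R\<^esub> b) (s \<otimes>\<^bsub>R\<^esub> t)),
      one = fraction R S \<one>\<^bsub>R\<^esub> \<one>\<^bsub>R\<^esub>,
      ring.zero = fraction R S \<zero>\<^bsub>R\<^esub> \<one>\<^bsub>R\<^esub>,
      ring.add = (\<lambda>x y. \<Union>(a, s)\<in>x. \<Union>(b, t)\<in>y.
               fraction R S ((a \<otimes>\<^bsub>R\<^esub> t) \<oplus>\<^bsub>R\<^esub> (b \<otimes>\<^bsub>R\<^esub> s)) (s \<otimes>\<^bsub>R\<^esub> t)) \<rparr>"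

text \<open>The map \<open>a/s \<mapsto> \<phi>(a)/\<phi>(s)\<close> into fractions over \<open>R'\<close> with denominators in \<open>S'\<close>,
  for a ring homomorphism \<open>\<phi>\<close> into \<open>R'\<close> that sends the denominators into \<open>S'\<close>.\<close>

definition fraction_map ::
    "('b, 'm) ring_scheme \<Rightarrow> 'b set \<Rightarrow> ('a \<Rightarrow> 'b) \<Rightarrow> ('a \<times> 'a) set \<Rightarrow> ('b \<times> 'b) set" where
  "fraction_map R' S' \<phi> x = (\<Union>(a, s)\<in>x. fraction R' S' (\<phi> a) (\<phi> s))"

definition powers :: "('a, 'm) ring_scheme \<Rightarrow> 'a \<Rightarrow> 'a set" where
  "powers R f = range (\<lambda>k::nat. f [^]\<^bsub>R\<^esub> k)"

abbreviation localization :: "('a, 'm) ring_scheme \<Rightarrow> 'a \<Rightarrow> ('a \<times> 'a) set ring" where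
  "localization R f \<equiv> fraction_ring R (powers R f)"


section \<open>Completion\<close>

text \<open>The limit of the rings \<open>B/I\<^sup>n\<close>.  The transition maps send a coset of \<open>I\<^sup>n\<^sup>+\<^sup>1\<close> to the coset
  of \<open>I\<^sup>n\<close> containing it, so compatible families are decreasing sequences of cosets.\<close>

definition completion :: "('a, 'm) ring_scheme \<Rightarrow> 'a set \<Rightarrow> (nat \<Rightarrow> 'a set) ring" where
  "completion B I =
    \<lparr> carrier = {x. \<forall>n. x n \<in> carrier (B Quot ideal_pow B I n) \<and> x (Suc n) \<subseteq> x n},
      monoid.mult = (\<lambda>x y n. x n \<otimes>\<^bsub>B Quot ideal_pow B I n\<^esub> y n),
      one = (\<lambda>n. \<one>\<^bsub>B Quot ideal_pow B I n\<^esub>),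
      ring.zero = (\<lambda>n. \<zero>\<^bsub>B Quot ideal_pow B I n\<^esub>),
      ring.add = (\<lambda>x y n. x n \<oplus>\<^bsub>B Quot ideal_pow B I n\<^esub> y n) \<rparr>"

definition to_completion :: "('a, 'm) ring_scheme \<Rightarrow> 'a set \<Rightarrow> 'a \<Rightarrow> nat \<Rightarrow> 'a set" where
  "to_completion B I b = (\<lambda>n. ideal_pow B I n +>\<^bsub>B\<^esub> b)"

text \<open>The map into the \<open>J\<close>-adic completion of \<open>C\<close> induced by a ring homomorphism \<open>\<phi>\<close> into \<open>C\<close>
  that sends the ideal of definition of the source into \<open>J\<close>.\<close>

definition completion_map ::
    "('b, 'm) ring_scheme \<Rightarrow> 'b set \<Rightarrow> ('a \<Rightarrow> 'b) \<Rightarrow> (nat \<Rightarrow> 'a set) \<Rightarrow> nat \<Rightarrow> 'b set" where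
  "completion_map C J \<phi> x = (\<lambda>n. \<Union>b\<in>x n. ideal_pow C J n +>\<^bsub>C\<^esub> \<phi> b)"


section \<open>Complete discrete valuation rings\<close>

locale complete_dvr = principal_domain R for R (structure) +
  fixes \<pi>
  assumes uniformizer_closed: "\<pi> \<in> carrier R"
    and uniformizer_nonzero: "\<pi> \<noteq> \<zero>"
    and uniformizer_maximal: "maximalideal (PIdl \<pi>) R"
    and local_ring: "maximalideal M R \<Longrightarrow> M = PIdl \<pi>"
    and complete: "bij_betw (to_completion R (PIdl \<pi>)) (carrier R) (carrier (completion R (PIdl \<pi>)))"


section \<open>Functions on the envelope of an affine formal scheme\<close>

text \<open>The structure sheaf of \<open>Spf A\<^sup>\<pi>\<close> assigns to the non-vanishing locus \<open>D(f)\<close>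
  the \<open>\<pi>\<close>-adic completion of \<open>A\<^sub>f\<close>; global functions on \<open>Spf A\<^sup>\<pi>\<close> are the sections over
  \<open>D(1)\<close>.  Here \<open>p\<close> is the image of \<open>\<pi>\<close> in \<open>A\<close>.\<close>

definition adic_ideal :: "('a, 'm) ring_scheme \<Rightarrow> 'a \<Rightarrow> 'a \<Rightarrow> ('a \<times> 'a) set set" where
  "adic_ideal A p f = PIdl\<^bsub>localization A f\<^esub> (fraction A (powers A f) p \<one>\<^bsub>A\<^esub>)"

definition envelope_functions ::
    "('a, 'm) ring_scheme \<Rightarrow> 'a \<Rightarrow> 'a \<Rightarrow> (nat \<Rightarrow> ('a \<times> 'a) set set) ring" where
  "envelope_functions A p f = completion (localization A f) (adic_ideal A p f)"

text \<open>For a homomorphism \<open>\<phi>\<close> from \<open>A\<close> to \<open>C\<close>, pullback of functions along the induced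
  morphism from the locus \<open>D(e)\<close> of \<open>Spf C\<^sup>\<pi>\<close> to a locus \<open>D(f)\<close> of \<open>Spf A\<^sup>\<pi>\<close>, provided
  \<open>\<phi>\<close> maps the powers of \<open>f\<close> to powers of \<open>e\<close>.  The cases used are \<open>e = \<phi> f\<close>, and
  the restriction from \<open>D(1)\<close> to \<open>D(e)\<close>, where \<open>f = 1\<close> and \<open>\<phi>\<close> is the identity.\<close>

definition envelope_pullback ::
    "('b, 'm) ring_scheme \<Rightarrow> 'b \<Rightarrow> 'b \<Rightarrow> ('a \<Rightarrow> 'b) \<Rightarrow>
      (nat \<Rightarrow> ('a \<times> 'a) set set) \<Rightarrow> nat \<Rightarrow> ('b \<times> 'b) set set" where
  "envelope_pullback C q e \<phi> =
    completion_map (localization C e) (adic_ideal C q e) (fraction_map C (powers C e) \<phi>)"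

abbreviation envelope_restrict ::
    "('b, 'm) ring_scheme \<Rightarrow> 'b \<Rightarrow> 'b \<Rightarrow>
      (nat \<Rightarrow> ('b \<times> 'b) set set) \<Rightarrow> nat \<Rightarrow> ('b \<times> 'b) set set" where
  "envelope_restrict C q e \<equiv> envelope_pullback C q e id"


section \<open>The formal scheme and the blowup chart\<close>

datatype coord = S_coord nat | Z_coord

definition coords :: "nat \<Rightarrow> coord set" where
  "coords n = insert Z_coord (S_coord ` {1..n})"

type_synonym 'a series = "coord multiset \<Rightarrow> 'a"

abbreviation base_ring :: "('a, 'm) ring_scheme \<Rightarrow> nat \<Rightarrow> 'a series ring" where
  "base_ring R n \<equiv> power_series R (coords n)"

abbreviation base_const :: "('a, 'm) ring_scheme \<Rightarrow> 'a \<Rightarrow> 'a series" where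
  "base_const R c \<equiv> ring.indexed_const R c"

definition Z_distinguished :: "('a, 'm) ring_scheme \<Rightarrow> 'a \<Rightarrow> 'a series \<Rightarrow> bool" where
  "Z_distinguished R \<pi> f \<longleftrightarrow>
    (let k = R Quot (PIdl\<^bsub>R\<^esub> \<pi>);
         kZ = power_series k {Z_coord};
         f0 = (\<lambda>m. if set_mset m \<subseteq> {Z_coord} then PIdl\<^bsub>R\<^esub> \<pi> +>\<^bsub>R\<^esub> f m else \<zero>\<^bsub>k\<^esub>)
     in f0 \<noteq> \<zero>\<^bsub>kZ\<^esub> \<and> f0 \<notin> Units kZ)"

text \<open>The ideal of definition \<open>(\<pi>, S\<^sub>1, \<dots>, S\<^sub>n, Z)\<close> of \<open>R[[S\<^sub>1, \<dots>, S\<^sub>n, Z]]\<close>.\<close>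

definition base_ideal :: "('a, 'm) ring_scheme \<Rightarrow> 'a \<Rightarrow> nat \<Rightarrow> 'a series set" where
  "base_ideal R \<pi> n =
    Idl\<^bsub>base_ring R n\<^esub> (insert (base_const R \<pi>) (ring.indexed_var R ` coords n))"

text \<open>\<open>A\<langle>T\<^sub>1, \<dots>, T\<^sub>n\<rangle>\<close> for \<open>A = R[[S\<^sub>1, \<dots>, S\<^sub>n, Z]]\<close>.  Coefficients converge to zero in the
  \<open>(\<pi>, S, Z)\<close>-adic topology of \<open>A\<close>, not in the \<open>\<pi>\<close>-adic one; the \<open>\<pi>\<close>-adic topology enters
  only when passing to the envelope.\<close>

definition chart_cover ::
    "('a, 'm) ring_scheme \<Rightarrow> 'a \<Rightarrow> nat \<Rightarrow> (nat multiset \<Rightarrow> 'a series) ring" where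
  "chart_cover R \<pi> n = restricted_series (base_ring R n) (base_ideal R \<pi> n) {1..n}"

abbreviation cover_const ::
    "('a, 'm) ring_scheme \<Rightarrow> nat \<Rightarrow> 'a series \<Rightarrow> nat multiset \<Rightarrow> 'a series" where
  "cover_const R n a \<equiv> ring.indexed_const (base_ring R n) a"

text \<open>The ideal generated by the \<open>\<pi>\<^sup>r\<^sup>+\<^sup>1 T\<^sub>i - S\<^sub>i\<close>.\<close>

definition chart_relations ::
    "('a, 'm) ring_scheme \<Rightarrow> 'a \<Rightarrow> nat \<Rightarrow> nat \<Rightarrow> (nat multiset \<Rightarrow> 'a series) set" where
  "chart_relations R \<pi> n r =
    (let B = chart_cover R \<pi> n in
     Idl\<^bsub>B\<^esub> ((\<lambda>i. (cover_const R n (base_const R (\<pi> [^]\<^bsub>R\<^esub> (r + 1)))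
                    \<otimes>\<^bsub>B\<^esub> ring.indexed_var (base_ring R n) i)
                \<ominus>\<^bsub>B\<^esub> cover_const R n (ring.indexed_var R (S_coord i))) ` {1..n}))"

text \<open>The elements killed by some power of \<open>p\<close>.\<close>

definition torsion :: "('a, 'm) ring_scheme \<Rightarrow> 'a \<Rightarrow> 'a set" where
  "torsion C p = {c \<in> carrier C. \<exists>k::nat. p [^]\<^bsub>C\<^esub> k \<otimes>\<^bsub>C\<^esub> c = \<zero>\<^bsub>C\<^esub>}"

definition chart_torsion ::
    "('a, 'm) ring_scheme \<Rightarrow> 'a \<Rightarrow> nat \<Rightarrow> nat \<Rightarrow> (nat multiset \<Rightarrow> 'a series) set set" where
  "chart_torsion R \<pi> n r =
    torsion (chart_cover R \<pi> n Quot chart_relations R \<pi> n r)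
      (chart_relations R \<pi> n r +>\<^bsub>chart_cover R \<pi> n\<^esub> cover_const R n (base_const R \<pi>))"

text \<open>The coordinate ring of the chart where the pullback of \<open>(\<pi>\<^sup>r\<^sup>+\<^sup>1, S\<^sub>1, \<dots>, S\<^sub>n)\<close> is generated
  by \<open>\<pi>\<^sup>r\<^sup>+\<^sup>1\<close>, with \<open>T\<^sub>i = S\<^sub>i / \<pi>\<^sup>r\<^sup>+\<^sup>1\<close>.\<close>

definition chart_ring ::
    "('a, 'm) ring_scheme \<Rightarrow> 'a \<Rightarrow> nat \<Rightarrow> nat \<Rightarrow> (nat multiset \<Rightarrow> 'a series) set set ring" where
  "chart_ring R \<pi> n r =
    (chart_cover R \<pi> n Quot chart_relations R \<pi> n r) Quot chart_torsion R \<pi> n r"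

definition chart_map ::
    "('a, 'm) ring_scheme \<Rightarrow> 'a \<Rightarrow> nat \<Rightarrow> nat \<Rightarrow>
      'a series \<Rightarrow> (nat multiset \<Rightarrow> 'a series) set set" where
  "chart_map R \<pi> n r a =
    chart_torsion R \<pi> n r +>\<^bsub>chart_cover R \<pi> n Quot chart_relations R \<pi> n r\<^esub>
      (chart_relations R \<pi> n r +>\<^bsub>chart_cover R \<pi> n\<^esub> cover_const R n a)"

end

theory Submission
  imports Defs
begin

text \<open>Write \<open>A = R[[S, Z]]\<close>.  On the chart, \<open>S\<^sub>i = \<pi>\<^sup>r\<^sup>+\<^sup>1 T\<^sub>i\<close>, so a function there is a series in \<open>T\<close>
  and \<open>Z\<close>.  Writing \<open>S\<^sub>i\<close> again for \<open>T\<^sub>i\<close>, the map from \<open>A\<close> to the coordinate ring \<open>A'\<close> of the chart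
  becomes the rescaling \<open>\<sigma>\<close> (\<open>rescale\<close>), which replaces \<open>F(S, Z)\<close> by \<open>F(\<pi>\<^sup>r\<^sup>+\<^sup>1 S, Z)\<close>.  More precisely, evaluation at
  \<open>S\<^sub>i = \<pi>\<^sup>r\<^sup>+\<^sup>1 T\<^sub>i\<close> identifies \<open>A'\<close> modulo \<open>\<pi>\<^sup>N\<close> with a subring of \<open>A\<close> modulo \<open>\<pi>\<^sup>N\<close>, for every \<open>N\<close>
  (\<open>chart_quot_divisible_iff\<close>), and \<open>A'\<close> enters the argument only through this.

  The function \<open>g\<close> is a family of fractions \<open>a\<^sub>N / f\<^sup>k\<close> with \<open>k = k\<^sub>N\<close>, compatible modulo powers of \<open>\<pi>\<close>.
  Its agreement with \<open>h\<close> says that \<open>\<sigma>(a\<^sub>N)\<close> is divisible by the \<open>k\<^sub>N\<close>-th power of \<open>\<sigma>(f)\<close> modulo \<open>\<pi>\<^sup>N\<close>, with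
  a quotient in \<open>A'\<close>, and the claim is that \<open>a\<^sub>M\<close> is divisible by the \<open>k\<^sub>M\<close>-th power of \<open>f\<close> modulo \<open>\<pi>\<^sup>M\<close>
  in \<open>A\<close>, for every \<open>M\<close>.  Once the quotients \<open>c\<^sub>M\<close> exist, they form the function \<open>u\<close>; they are unique
  modulo \<open>\<pi>\<^sup>M\<close> and agree with \<open>h\<close>, because \<open>f\<close> is a nonzerodivisor modulo every power of \<open>\<pi>\<close> on both \<open>A\<close>
  and \<open>A'\<close>.  This formal part is \<open>envelope_patching\<close>.

  The difficulty is that \<open>\<sigma>\<close> is injective but loses precision: \<open>\<sigma>(a)\<close> modulo \<open>\<pi>\<^sup>N\<close> determines the
  coefficients of \<open>a\<close> in \<open>S\<close>-degree \<open>j\<close> only modulo \<open>\<pi>\<close> to the power \<open>N - (r + 1) j\<close>.  Hence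
  divisibility of \<open>\<sigma>(a\<^sub>N)\<close> descends to divisibility of \<open>a\<^sub>N\<close> with an error of this kind
  (\<open>rescale_divides\<close>).  Below a fixed \<open>S\<close>-degree, the error vanishes modulo \<open>\<pi>\<^sup>M\<close> as soon as \<open>N\<close> is large;
  comparing \<open>a\<^sub>N\<close> with \<open>a\<^sub>M\<close> shows that \<open>a\<^sub>M\<close> is divisible modulo \<open>\<pi>\<^sup>M\<close> up to terms of arbitrarily high
  \<open>S\<close>-degree, and the quotients converge \<open>S\<close>-adically (\<open>divisible_closed\<close>, \<open>glue_over_rescaling\<close>).

  Each of these steps cancels \<open>f\<close> or \<open>\<sigma>(f)\<close> modulo some subgroup of \<open>A\<close>: modulo \<open>\<pi>\<^sup>N\<close>, modulo \<open>\<pi>\<^sup>M\<close> and high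
  \<open>S\<close>-degree, or modulo \<open>\<sigma>(A) + \<pi>\<^sup>N A\<close>.  All of them consist of the series whose coefficient at a monomial
  \<open>m\<close> is divisible by \<open>\<pi>\<close> to the power \<open>e(m)\<close>, for a weight \<open>e\<close> that does not see \<open>Z\<close>.  Since \<open>f\<close> is \<open>Z\<^sup>d\<close>
  times a unit modulo \<open>\<pi>\<close> and the \<open>S\<^sub>i\<close>, one lemma, \<open>weighted_regular\<close>, justifies every cancellation.\<close>

section \<open>Convolution of power series\<close>

lemma finite_submultisets [simp]: "finite {a. a \<subseteq># (m :: 'v multiset)}"
proof (rule finite_subset)
  show "{a. a \<subseteq># m} \<subseteq> (\<Union>k\<le>size m. {a. set_mset a \<subseteq> set_mset m \<and> size a = k})"
    using size_mset_mono set_mset_mono by fastforce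
  show "finite (\<Union>k\<le>size m. {a. set_mset a \<subseteq> set_mset m \<and> size a = k})"
    by (intro finite_UN_I) (auto simp flip: multisets_of_size_def)
qed

context abelian_monoid
begin

lemma finsum_Sigma:
  assumes "finite I" "\<And>i. i \<in> I \<Longrightarrow> finite (B i)"
    and "\<And>i j. i \<in> I \<Longrightarrow> j \<in> B i \<Longrightarrow> h i j \<in> carrier G"
  shows "finsum G (\<lambda>i. finsum G (h i) (B i)) I = finsum G (\<lambda>(i, j). h i j) (Sigma I B)"
  using assms
proof (induction I rule: finite_induct)
  case empty
  then show ?case by simp
next
  case (insert x I)
  have *: "finsum G (\<lambda>(i, j). h i j) ({x} \<times> B x) = finsum G (h x) (B x)"
  proof -
    have "{x} \<times> B x = Pair x ` B x" by auto
    moreover have "finsum G (\<lambda>(i, j). h i j) (Pair x ` B x) = finsum G (\<lambda>j. case (x, j) of (i, j) \<Rightarrow> h i j) (B x)"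
      by (rule finsum_reindex) (use insert in \<open>auto simp: inj_on_def\<close>)
    ultimately show ?thesis by simp
  qed
  have "Sigma (insert x I) B = {x} \<times> B x \<union> Sigma I B" by auto
  moreover have "finsum G (\<lambda>(i, j). h i j) ({x} \<times> B x \<union> Sigma I B) =
      finsum G (\<lambda>(i, j). h i j) ({x} \<times> B x) \<oplus> finsum G (\<lambda>(i, j). h i j) (Sigma I B)"
    by (rule finsum_Un_disjoint) (use insert in auto)
  ultimately show ?case
    using insert * by (simp add: Pi_def)
qed

text \<open>Either way of nesting the sums runs over the decompositions of \<open>m\<close> into three parts.  With a general
  summand this gives associativity of convolution and also the linearity of the evaluation map below.\<close>

lemma finsum_triples:
  assumes "\<And>a b c. h a b c \<in> carrier G"
  shows "finsum G (\<lambda>a. finsum G (\<lambda>b. h a b (m - a - b)) {b. b \<subseteq># m - a}) {a. a \<subseteq># m} =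
    finsum G (\<lambda>(a, b, c). h a b c) {(a, b, c). a + b + c = m}" (is ?A)
    and "finsum G (\<lambda>x. finsum G (\<lambda>a. h a (x - a) (m - x)) {a. a \<subseteq># x}) {x. x \<subseteq># m} =
    finsum G (\<lambda>(a, b, c). h a b c) {(a, b, c). a + b + c = m}" (is ?B)
proof -
  have 1: "{(a, b, c). a + b + c = m} = (\<lambda>(a, b). (a, b, m - a - b)) ` (SIGMA a:{a. a \<subseteq># m}. {b. b \<subseteq># m - a})"
  proof (safe)
    fix a b c :: "'c multiset" assume "m = a + b + c"
    then show "(a, b, c) \<in> (\<lambda>(x, y). (x, y, a + b + c - x - y)) ` (SIGMA x:{x. x \<subseteq># a + b + c}. {y. y \<subseteq># a + b + c - x})"
      by (intro image_eqI[of _ _ "(a, b)"]) (auto simp: add.assoc)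
  next
    fix a b assume "a \<subseteq># m" "b \<subseteq># m - a"
    then show "a + b + (m - a - b) = m"
      by (metis add.assoc subset_mset.add_diff_inverse)
  qed
  show ?A
    unfolding 1
    by (subst finsum_Sigma, simp_all add: assms, subst finsum_reindex)
      (auto simp: inj_on_def assms case_prod_unfold)
  have 2: "{(a, b, c). a + b + c = m} = (\<lambda>(x, a). (a, x - a, m - x)) ` (SIGMA x:{x. x \<subseteq># m}. {a. a \<subseteq># x})"
  proof (intro subset_antisym subsetI)
    fix t assume "t \<in> {(a, b, c). a + b + c = m}"
    then obtain a b c where t: "t = (a, b, c)" "m = a + b + c"
      by (cases t) auto
    show "t \<in> (\<lambda>(x, a). (a, x - a, m - x)) ` (SIGMA x:{x. x \<subseteq># m}. {a. a \<subseteq># x})"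
      by (rule image_eqI[of _ _ "(a + b, a)"]) (auto simp: t)
  qed auto
  have "inj_on (\<lambda>(x, a). (a, x - a, m - x)) (SIGMA x:{x. x \<subseteq># m}. {a. a \<subseteq># x})"
    by (rule inj_on_inverseI[of _ "\<lambda>(a, b, c). (a + b, a)"]) auto
  then show ?B
    unfolding 2
    by (subst finsum_Sigma, simp_all add: assms, subst finsum_reindex)
      (simp_all add: assms case_prod_unfold)
qed

lemma finsum_triples_swap:
  assumes "\<And>a b c. h a b c \<in> carrier G"
  shows "finsum G (\<lambda>a. finsum G (\<lambda>b. h a b (m - a - b)) {b. b \<subseteq># m - a}) {a. a \<subseteq># m} =
    finsum G (\<lambda>b. finsum G (\<lambda>a. h a b (m - b - a)) {a. a \<subseteq># m - b}) {b. b \<subseteq># m}"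
proof -
  have 1: "{(a, b, c). a + b + c = m} = (\<lambda>(a, b, c). (b, a, c)) ` {(a, b, c). a + b + c = m}"
    by (force simp: image_iff ac_simps)
  have "finsum G (\<lambda>(a, b, c). h a b c) {(a, b, c). a + b + c = m} =
    finsum G (\<lambda>(b, a, c). h a b c) {(b, a, c). b + a + c = m}"
    by (subst 1, subst finsum_reindex) (auto simp: inj_on_def assms case_prod_unfold)
  then show ?thesis
    using finsum_triples(1)[of h m] finsum_triples(1)[of "\<lambda>b a c. h a b c" m] assms by simp
qed

end

section \<open>The ring of power series\<close>

context cring
begin

abbreviation conv where
  "conv F G m \<equiv> finsum R (\<lambda>a. F a \<otimes> G (m - a)) {a. a \<subseteq># m}"

lemma conv_closed [simp]:
  assumes "\<And>m. F m \<in> carrier R" "\<And>m. G m \<in> carrier R"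
  shows "conv F G m \<in> carrier R"
  using assms by (auto intro!: finsum_closed)

lemma conv_comm:
  assumes [simp]: "\<And>m. F m \<in> carrier R" "\<And>m. G m \<in> carrier R"
  shows "conv F G m = conv G F m"
proof -
  have 1: "{a. a \<subseteq># m} = (\<lambda>a. m - a) ` {a. a \<subseteq># m}"
  proof (safe)
    fix a assume "a \<subseteq># m"
    then show "a \<in> (\<lambda>a. m - a) ` {a. a \<subseteq># m}"
      by (intro image_eqI[of _ _ "m - a"]) (auto simp: subset_mset.diff_diff_right)
  qed auto
  have inj: "inj_on (\<lambda>a. m - a) {a. a \<subseteq># m}"
    by (rule inj_on_inverseI[of _ "\<lambda>a. m - a"]) (auto simp: subset_mset.diff_diff_right)
  have "conv F G m = finsum R (\<lambda>a. F a \<otimes> G (m - a)) ((\<lambda>a. m - a) ` {a. a \<subseteq># m})"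
    using 1 by simp
  also have "\<dots> = finsum R (\<lambda>a. F (m - a) \<otimes> G (m - (m - a))) {a. a \<subseteq># m}"
    by (rule finsum_reindex) (auto simp: inj)
  also have "\<dots> = conv G F m"
    by (rule finsum_cong') (auto simp: m_comm multiset_diff_union_assoc subset_mset.diff_diff_right)
  finally show ?thesis .
qed

lemma conv_assoc:
  assumes [simp]: "\<And>m. F m \<in> carrier R" "\<And>m. G m \<in> carrier R" "\<And>m. H m \<in> carrier R"
  shows "conv (conv F G) H m = conv F (conv G H) m"
proof -
  have "conv (conv F G) H m =
      finsum R (\<lambda>x. finsum R (\<lambda>a. F a \<otimes> G (x - a) \<otimes> H (m - x)) {a. a \<subseteq># x}) {x. x \<subseteq># m}"
    by (rule finsum_cong') (auto intro!: finsum_closed finsum_ldistr)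
  also have "\<dots> = finsum R (\<lambda>a. finsum R (\<lambda>b. F a \<otimes> G b \<otimes> H (m - a - b)) {b. b \<subseteq># m - a}) {a. a \<subseteq># m}"
    using finsum_triples[of "\<lambda>a b c. F a \<otimes> G b \<otimes> H c" m] by simp
  also have "\<dots> = conv F (conv G H) m"
  proof (rule finsum_cong')
    fix a
    have "F a \<otimes> conv G H (m - a) = finsum R (\<lambda>b. F a \<otimes> (G b \<otimes> H (m - a - b))) {b. b \<subseteq># m - a}"
      by (rule finsum_rdistr) auto
    then show "finsum R (\<lambda>b. F a \<otimes> G b \<otimes> H (m - a - b)) {b. b \<subseteq># m - a} = F a \<otimes> conv G H (m - a)"
      by (simp add: m_assoc)
  qed auto
  finally show ?thesis .
qed

lemma conv_single:
  assumes [simp]: "\<And>m. G m \<in> carrier R" "c \<in> carrier R"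
  shows "conv (\<lambda>m. if m = x then c else \<zero>) G m = (if x \<subseteq># m then c \<otimes> G (m - x) else \<zero>)"
proof (cases "x \<subseteq># m")
  case True
  have "conv (\<lambda>m. if m = x then c else \<zero>) G m =
      finsum R (\<lambda>a. if x = a then c \<otimes> G (m - a) else \<zero>) {a. a \<subseteq># m}"
    by (rule finsum_cong') auto
  also have "\<dots> = c \<otimes> G (m - x)"
    by (rule finsum_singleton) (use True in auto)
  finally show ?thesis using True by simp
next
  case False
  then show ?thesis by (auto intro!: add.finprod_one_eqI)
qed

lemma conv_distrib:
  assumes [simp]: "\<And>m. F m \<in> carrier R" "\<And>m. G m \<in> carrier R" "\<And>m. H m \<in> carrier R"
  shows "conv (\<lambda>m. F m \<oplus> G m) H m = conv F H m \<oplus> conv G H m"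
  by (subst finsum_addf[symmetric]) (auto intro!: finsum_cong' simp: l_distr)

lemma power_series_simps:
  shows power_series_mult: "F \<otimes>\<^bsub>power_series R V\<^esub> G = conv F G"
    and power_series_add: "F \<oplus>\<^bsub>power_series R V\<^esub> G = (\<lambda>m. F m \<oplus> G m)"
    and power_series_zero: "\<zero>\<^bsub>power_series R V\<^esub> = (\<lambda>m. \<zero>)"
    and power_series_one: "\<one>\<^bsub>power_series R V\<^esub> = (\<lambda>m. if m = {#} then \<one> else \<zero>)"
  by (auto simp: power_series_def fun_eq_iff indexed_padd_def indexed_const_def)

lemma power_series_carrier:
  "F \<in> carrier (power_series R V) \<longleftrightarrow>
    (\<forall>m. F m \<in> carrier R) \<and> (\<forall>m. \<not> set_mset m \<subseteq> V \<longrightarrow> F m = \<zero>)"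
  by (simp add: power_series_def carrier_coeff_def)

lemma power_series_closed: "F \<in> carrier (power_series R V) \<Longrightarrow> F m \<in> carrier R"
  by (simp add: power_series_carrier)

lemma power_series_support: "F \<in> carrier (power_series R V) \<Longrightarrow> x \<in># m \<Longrightarrow> x \<notin> V \<Longrightarrow> F m = \<zero>"
  by (auto simp: power_series_carrier)

lemma conv_support:
  assumes "F \<in> carrier (power_series R V)" "G \<in> carrier (power_series R V)" "\<not> set_mset m \<subseteq> V"
  shows "conv F G m = \<zero>"
proof (rule add.finprod_one_eqI)
  fix a assume "a \<in> {a. a \<subseteq># m}"
  then have "set_mset m = set_mset a \<union> set_mset (m - a)"
    by (metis mem_Collect_eq set_mset_union subset_mset.add_diff_inverse)
  then have "\<not> set_mset a \<subseteq> V \<or> \<not> set_mset (m - a) \<subseteq> V"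
    using assms(3) by auto
  then show "F a \<otimes> G (m - a) = \<zero>"
    using assms by (auto simp: power_series_carrier)
qed

lemma power_series_cring: "cring (power_series R V)"
proof (rule cringI)
  show "abelian_group (power_series R V)"
  proof (rule abelian_groupI)
    fix F assume F: "F \<in> carrier (power_series R V)"
    then show "\<exists>G\<in>carrier (power_series R V). G \<oplus>\<^bsub>power_series R V\<^esub> F = \<zero>\<^bsub>power_series R V\<^esub>"
      by (intro bexI[of _ "\<lambda>m. \<ominus> F m"]) (auto simp: power_series_simps power_series_carrier l_neg fun_eq_iff)
  qed (auto simp: power_series_simps power_series_carrier a_ac fun_eq_iff)
  show "comm_monoid (power_series R V)"
  proof (rule comm_monoidI)
    fix F G assume "F \<in> carrier (power_series R V)" "G \<in> carrier (power_series R V)"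
    then show "F \<otimes>\<^bsub>power_series R V\<^esub> G \<in> carrier (power_series R V)"
      using conv_support[of F V G] conv_closed[of F G]
      by (simp add: power_series_mult) (simp add: power_series_carrier)
  next
    fix F assume "F \<in> carrier (power_series R V)"
    then show "\<one>\<^bsub>power_series R V\<^esub> \<otimes>\<^bsub>power_series R V\<^esub> F = F"
      using conv_single[of F \<one> "{#}"] by (auto simp: power_series_simps power_series_carrier fun_eq_iff)
  qed (auto simp: power_series_simps power_series_carrier conv_assoc conv_comm fun_eq_iff)
qed (auto simp: power_series_simps power_series_carrier conv_distrib fun_eq_iff)

lemma power_series_minus:
  assumes "F \<in> carrier (power_series R V)" "G \<in> carrier (power_series R V)"
  shows "F \<ominus>\<^bsub>power_series R V\<^esub> G = (\<lambda>m. F m \<ominus> G m)"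
proof -
  interpret A: cring "power_series R V" by (rule power_series_cring)
  have "\<ominus>\<^bsub>power_series R V\<^esub> G = (\<lambda>m. \<ominus> G m)"
    by (rule A.minus_equality)
      (use assms in \<open>auto simp: power_series_simps power_series_carrier l_neg fun_eq_iff\<close>)
  then show ?thesis
    by (simp add: A.minus_eq minus_eq power_series_add)
qed

lemma indexed_const_carrier: "c \<in> carrier R \<Longrightarrow> indexed_const c \<in> carrier (power_series R V)"
  by (auto simp: power_series_carrier indexed_const_def)

lemma indexed_const_mult:
  assumes "c \<in> carrier R" "F \<in> carrier (power_series R V)"
  shows "indexed_const c \<otimes>\<^bsub>power_series R V\<^esub> F = (\<lambda>m. c \<otimes> F m)"
  using assms conv_single[of F c "{#}"]
  by (auto simp: power_series_mult indexed_const_def power_series_carrier)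

lemma indexed_const_pow:
  assumes "c \<in> carrier R"
  shows "indexed_const c [^]\<^bsub>power_series R V\<^esub> n = indexed_const (c [^] (n::nat))"
proof -
  interpret A: cring "power_series R V" by (rule power_series_cring)
  show ?thesis
  proof (induction n)
    case 0
    then show ?case by (simp add: power_series_one indexed_const_def)
  next
    case (Suc n)
    have "indexed_const c [^]\<^bsub>power_series R V\<^esub> Suc n = indexed_const (c [^] n) \<otimes>\<^bsub>power_series R V\<^esub> indexed_const c"
      by (simp add: Suc.IH)
    also have "\<dots> = indexed_const (c [^] Suc n)"
      using assms by (subst indexed_const_mult[OF _ indexed_const_carrier]) (auto simp: indexed_const_def fun_eq_iff)
    finally show ?case .
  qed
qed

lemma PIdl_indexed_const:
  assumes "c \<in> carrier R"
  shows "PIdl\<^bsub>power_series R V\<^esub> (indexed_const c) = {F \<in> carrier (power_series R V). \<forall>m. F m \<in> PIdl c}"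
    (is "?L = ?R")
proof (intro subset_antisym subsetI)
  interpret A: cring "power_series R V" by (rule power_series_cring)
  fix F assume "F \<in> ?L"
  then obtain G where G: "G \<in> carrier (power_series R V)" "F = G \<otimes>\<^bsub>power_series R V\<^esub> indexed_const c"
    by (auto simp: cgenideal_def)
  then have "F = (\<lambda>m. c \<otimes> G m)"
    using assms A.m_comm[of G "indexed_const c"] by (simp add: indexed_const_carrier indexed_const_mult)
  moreover have "F \<in> carrier (power_series R V)"
    using G assms by (simp add: indexed_const_carrier)
  ultimately have "F = (\<lambda>m. c \<otimes> G m)" "F \<in> carrier (power_series R V)"
    by blast+
  then show "F \<in> ?R"
    using G(1) assms unfolding cgenideal_def using m_comm[OF assms power_series_closed[OF G(1)]] power_series_closed[OF G(1)] by auto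
next
  interpret A: cring "power_series R V" by (rule power_series_cring)
  fix F assume F: "F \<in> ?R"
  then have "\<exists>b\<in>carrier R. F m = b \<otimes> c" for m
    by (auto simp: cgenideal_def)
  then obtain b where b: "\<And>m. b m \<in> carrier R" "\<And>m. F m = b m \<otimes> c"
    by metis
  \<comment> \<open>The coefficient is zero, not \<open>b m\<close>, where \<open>F\<close> vanishes, so that \<open>G\<close> has the support of \<open>F\<close>.\<close>
  define G where "G m = (if F m = \<zero> then \<zero> else b m)" for m
  have G: "G \<in> carrier (power_series R V)"
    using F b by (auto simp: power_series_carrier G_def)
  have "F = indexed_const c \<otimes>\<^bsub>power_series R V\<^esub> G"
    using G assms b by (subst indexed_const_mult) (auto simp: G_def fun_eq_iff m_comm)
  also have "\<dots> = G \<otimes>\<^bsub>power_series R V\<^esub> indexed_const c"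
    using G assms A.m_comm by (simp add: indexed_const_carrier)
  finally show "F \<in> ?L"
    using G by (auto simp: cgenideal_def)
qed

lemma indexed_var_eq: "indexed_var v = (\<lambda>m. if m = {#v#} then \<one> else \<zero>)"
proof
  fix m :: "'c multiset"
  have "v \<in># m \<and> m - {#v#} = {#} \<longleftrightarrow> m = {#v#}"
    by (metis add_mset_remove_trivial add_mset_remove_trivial_eq insert_DiffM union_single_eq_member)
  then show "indexed_var v m = (if m = {#v#} then \<one> else \<zero>)"
    by (auto simp: indexed_var_def indexed_pmult_def indexed_const_def)
qed

lemma indexed_var_carrier: "v \<in> V \<Longrightarrow> indexed_var v \<in> carrier (power_series R V)"
  by (auto simp: power_series_carrier indexed_var_eq)

lemma indexed_var_mult:
  assumes "F \<in> carrier (power_series R V)"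
  shows "indexed_var v \<otimes>\<^bsub>power_series R V\<^esub> F = (\<lambda>m. if v \<in># m then F (m - {#v#}) else \<zero>)"
  using assms conv_single[of F \<one> "{#v#}"]
  by (auto simp: power_series_mult indexed_var_eq power_series_carrier)

end

section \<open>Ideals in commutative rings\<close>

context cring
begin

lemma ideal_pow_principal:
  assumes "x \<in> carrier R"
  shows "ideal_pow R (PIdl x) n = PIdl (x [^] n)"
proof (induction n)
  case 0
  then show ?case
    by (force simp: ideals_set_def cgenideal_def)
next
  case (Suc n)
  have "ideal_pow R (PIdl x) (Suc n) = (PIdl (x [^] n)) \<cdot> (PIdl x)"
    by (simp add: Suc.IH) (simp add: ideals_set_def)
  also have "\<dots> = Idl (PIdl (x [^] n \<otimes> x))"
    using assms by (simp add: ideal_prod_eq_genideal cgenideal_ideal cgenideal_prod)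
  also have "\<dots> = PIdl (x [^] Suc n)"
  proof -
    have J: "ideal (PIdl (x [^] n \<otimes> x)) R"
      using assms by (simp add: cgenideal_ideal)
    show ?thesis
      using genideal_minimal[OF J order_refl] genideal_self[OF additive_subgroup.a_subset[OF ideal.axioms(1)[OF J]]]
      by simp
  qed
  finally show ?case .
qed

lemma PIdl_pow_mono:
  assumes "x \<in> carrier R" "m \<le> n" "a \<in> PIdl (x [^] n)" shows "a \<in> PIdl (x [^] (m::nat))"
proof -
  obtain c where "c \<in> carrier R" "a = c \<otimes> x [^] n"
    using assms(3) by (auto simp: cgenideal_def)
  moreover have "x [^] n = x [^] (n - m) \<otimes> x [^] m"
    using assms by (simp add: nat_pow_mult)
  ultimately show ?thesis
    using assms(1) by (auto simp: cgenideal_def m_assoc intro!: exI[of _ "c \<otimes> x [^] (n - m)"])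
qed

end

lemma (in ideal) coset_eq_iff:
  assumes "x \<in> carrier R" "y \<in> carrier R"
  shows "I +> x = I +> y \<longleftrightarrow> x \<ominus> y \<in> I"
  by (metis a_rcos_module_minus a_repr_independence' a_repr_independenceD a_rcos_self assms ring_axioms)

lemma (in ideal) finsum_mem:
  assumes "finite D" "\<And>x. x \<in> D \<Longrightarrow> h x \<in> I"
  shows "finsum R h D \<in> I"
  using assms
proof (induction D rule: finite_induct)
  case (insert x D)
  then have "finsum R h (insert x D) = h x \<oplus> finsum R h D"
    using Icarr by (intro finsum_insert) auto
  then show ?case
    using insert by simp
qed simp

lemma (in cring) torsion_ideal:
  assumes p [simp]: "p \<in> carrier R"
  shows "ideal (torsion R p) R"
proof -
  have mult: "x \<otimes> c \<in> torsion R p" if c: "c \<in> torsion R p" and x: "x \<in> carrier R" for c x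
  proof -
    obtain k :: nat where k: "c \<in> carrier R" "p [^] k \<otimes> c = \<zero>"
      using c by (auto simp: torsion_def)
    have "p [^] k \<otimes> (x \<otimes> c) = x \<otimes> (p [^] k \<otimes> c)"
      using k(1) x by (simp add: m_ac)
    then have "p [^] k \<otimes> (x \<otimes> c) = \<zero>"
      using x by (simp only: k(2) r_null)
    then show ?thesis
      using k(1) x unfolding torsion_def by blast
  qed
  show ?thesis
  proof (rule idealI[OF ring_axioms])
    show "subgroup (torsion R p) (add_monoid R)"
    proof (rule add.subgroupI)
      show "torsion R p \<subseteq> carrier R"
        by (auto simp: torsion_def)
      have "p [^] (0::nat) \<otimes> \<zero> = \<zero>"
        by simp
      then show "torsion R p \<noteq> {}"
        unfolding torsion_def by blast
      fix a assume a: "a \<in> torsion R p"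
      then have "\<ominus> \<one> \<otimes> a \<in> torsion R p"
        by (rule mult) simp
      then show "\<ominus> a \<in> torsion R p"
        using a by (auto simp: torsion_def l_minus)
      fix b assume b: "b \<in> torsion R p"
      obtain j k :: nat where jk: "a \<in> carrier R" "p [^] j \<otimes> a = \<zero>" "b \<in> carrier R" "p [^] k \<otimes> b = \<zero>"
        using a b by (auto simp: torsion_def)
      have "p [^] (j + k) \<otimes> (a \<oplus> b) = p [^] k \<otimes> (p [^] j \<otimes> a) \<oplus> p [^] j \<otimes> (p [^] k \<otimes> b)"
        using jk(1,3) by (simp add: r_distr m_ac flip: nat_pow_mult)
      also have "\<dots> = \<zero>"
        by (simp add: jk(2,4))
      finally show "a \<oplus> b \<in> torsion R p"
        using jk(1,3) unfolding torsion_def by blast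
    qed
    fix a x assume "a \<in> torsion R p" "x \<in> carrier R"
    then show "x \<otimes> a \<in> torsion R p" "a \<otimes> x \<in> torsion R p"
      using mult[of a x] m_comm[of a x] by (auto simp: torsion_def)
  qed
qed

section \<open>Rings of fractions\<close>

locale fractions = cring A for A (structure) +
  fixes S
  assumes denom_subset: "S \<subseteq> carrier A"
    and denom_one [simp]: "\<one> \<in> S"
    and denom_mult [simp]: "s \<in> S \<Longrightarrow> t \<in> S \<Longrightarrow> s \<otimes> t \<in> S"
begin

lemma denom_closed [simp]: "s \<in> S \<Longrightarrow> s \<in> carrier A"
  using denom_subset by auto

abbreviation Loc where "Loc \<equiv> fraction_ring A S"
abbreviation frac where "frac \<equiv> fraction A S"

lemma fraction_eqI:
  assumes "a \<in> carrier A" "b \<in> carrier A" "s \<in> S" "t \<in> S" "u \<in> S" "u \<otimes> (a \<otimes> t) = u \<otimes> (b \<otimes> s)"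
  shows "frac a s = frac b t"
proof -
  have main: "frac a s \<subseteq> frac b t"
    if *: "a \<in> carrier A" "b \<in> carrier A" "s \<in> S" "t \<in> S" "u \<in> S" "u \<otimes> (a \<otimes> t) = u \<otimes> (b \<otimes> s)" for a b s t u
  proof (clarsimp simp: fraction_def)
    fix c w v assume c: "c \<in> carrier A" "w \<in> S" "v \<in> S" "v \<otimes> (a \<otimes> w) = v \<otimes> (c \<otimes> s)"
    have "u \<otimes> v \<otimes> s \<otimes> (b \<otimes> w) = v \<otimes> w \<otimes> (u \<otimes> (b \<otimes> s))"
      using *(1-5) c(1-3) by (simp add: m_ac)
    also have "\<dots> = v \<otimes> w \<otimes> (u \<otimes> (a \<otimes> t))"
      by (simp only: *(6))
    also have "\<dots> = u \<otimes> t \<otimes> (v \<otimes> (a \<otimes> w))"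
      using *(1-5) c(1-3) by (simp add: m_ac)
    also have "\<dots> = u \<otimes> t \<otimes> (v \<otimes> (c \<otimes> s))"
      by (simp only: c(4))
    also have "\<dots> = u \<otimes> v \<otimes> s \<otimes> (c \<otimes> t)"
      using *(1-5) c(1-3) by (simp add: m_ac)
    finally show "\<exists>u\<in>S. u \<otimes> (b \<otimes> w) = u \<otimes> (c \<otimes> t)"
      by (rule bexI) (use *(1-5) c(1-3) in simp)
  qed
  show ?thesis
    using main[OF assms] main[OF assms(2,1,4,3,5) assms(6)[symmetric]] by blast
qed

lemma fraction_self: "a \<in> carrier A \<Longrightarrow> s \<in> S \<Longrightarrow> (a, s) \<in> frac a s"
  by (auto simp: fraction_def)

lemma fraction_eq_iff:
  assumes "a \<in> carrier A" "b \<in> carrier A" "s \<in> S" "t \<in> S"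
  shows "frac a s = frac b t \<longleftrightarrow> (\<exists>u\<in>S. u \<otimes> (a \<otimes> t) = u \<otimes> (b \<otimes> s))"
proof
  assume "frac a s = frac b t"
  then have "(b, t) \<in> frac a s"
    using fraction_self[OF assms(2,4)] by simp
  then show "\<exists>u\<in>S. u \<otimes> (a \<otimes> t) = u \<otimes> (b \<otimes> s)"
    by (simp add: fraction_def)
next
  assume "\<exists>u\<in>S. u \<otimes> (a \<otimes> t) = u \<otimes> (b \<otimes> s)"
  then obtain u where "u \<in> S" "u \<otimes> (a \<otimes> t) = u \<otimes> (b \<otimes> s)"
    by blast
  then show "frac a s = frac b t"
    by (intro fraction_eqI[OF assms])
qed

lemma fraction_memD:
  assumes "(b, t) \<in> frac a s" "a \<in> carrier A" "s \<in> S"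
  shows "b \<in> carrier A" "t \<in> S" "\<exists>u\<in>S. u \<otimes> (a \<otimes> t) = u \<otimes> (b \<otimes> s)" "frac b t = frac a s"
proof -
  show 1: "b \<in> carrier A" "t \<in> S" "\<exists>u\<in>S. u \<otimes> (a \<otimes> t) = u \<otimes> (b \<otimes> s)"
    using assms by (auto simp: fraction_def)
  then obtain u where "u \<in> S" "u \<otimes> (a \<otimes> t) = u \<otimes> (b \<otimes> s)"
    by blast
  then show "frac b t = frac a s"
    by (intro fraction_eqI[OF assms(2) 1(1) assms(3) 1(2), symmetric])
qed

text \<open>The operations on fractions are unions over representatives; this evaluates them at one representative.\<close>

lemma Union_fraction:
  assumes "a \<in> carrier A" "s \<in> S"
    and "\<And>b t. (b, t) \<in> frac a s \<Longrightarrow> F b t = F a s"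
  shows "(\<Union>(b, t)\<in>frac a s. F b t) = F a s"
  by (rule UN_constant_eq[OF fraction_self[OF assms(1,2)]]) (simp add: assms(3) split_beta)

lemma fraction_mult:
  assumes [simp]: "a \<in> carrier A" "b \<in> carrier A" "s \<in> S" "t \<in> S"
  shows "frac a s \<otimes>\<^bsub>Loc\<^esub> frac b t = frac (a \<otimes> b) (s \<otimes> t)"
proof -
  have "frac (a' \<otimes> b') (s' \<otimes> t') = frac (a \<otimes> b) (s \<otimes> t)"
    if 1: "(a', s') \<in> frac a s" and 2: "(b', t') \<in> frac b t" for a' s' b' t'
  proof -
    note [simp] = fraction_memD(1,2)[OF 1 assms(1,3)] fraction_memD(1,2)[OF 2 assms(2,4)]
    obtain u where [simp]: "u \<in> S" and u: "u \<otimes> (a \<otimes> s') = u \<otimes> (a' \<otimes> s)"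
      using fraction_memD(3)[OF 1 assms(1,3)] by blast
    obtain v where [simp]: "v \<in> S" and v: "v \<otimes> (b \<otimes> t') = v \<otimes> (b' \<otimes> t)"
      using fraction_memD(3)[OF 2 assms(2,4)] by blast
    have "u \<otimes> v \<otimes> (a' \<otimes> b' \<otimes> (s \<otimes> t)) = (u \<otimes> (a' \<otimes> s)) \<otimes> (v \<otimes> (b' \<otimes> t))"
      by (simp add: m_ac)
    also have "\<dots> = (u \<otimes> (a \<otimes> s')) \<otimes> (v \<otimes> (b \<otimes> t'))"
      by (simp only: u v)
    also have "\<dots> = u \<otimes> v \<otimes> (a \<otimes> b \<otimes> (s' \<otimes> t'))"
      by (simp add: m_ac)
    finally show ?thesis
      by (rule fraction_eqI[rotated 5]) simp_all
  qed
  note main = this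
  have inner: "(\<Union>(b', t')\<in>frac b t. frac (a' \<otimes> b') (s' \<otimes> t')) = frac (a \<otimes> b) (s \<otimes> t)"
    if "(a', s') \<in> frac a s" for a' s'
    by (subst Union_fraction) (simp_all add: main[OF that] fraction_self)
  have "(\<Union>(a', s')\<in>frac a s. \<Union>(b', t')\<in>frac b t. frac (a' \<otimes> b') (s' \<otimes> t')) = frac (a \<otimes> b) (s \<otimes> t)"
    by (subst Union_fraction) (simp_all only: inner fraction_self assms)
  then show ?thesis
    by (simp add: fraction_ring_def)
qed

lemma fraction_add:
  assumes [simp]: "a \<in> carrier A" "b \<in> carrier A" "s \<in> S" "t \<in> S"
  shows "frac a s \<oplus>\<^bsub>Loc\<^esub> frac b t = frac (a \<otimes> t \<oplus> b \<otimes> s) (s \<otimes> t)"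
proof -
  have "frac (a' \<otimes> t' \<oplus> b' \<otimes> s') (s' \<otimes> t') = frac (a \<otimes> t \<oplus> b \<otimes> s) (s \<otimes> t)"
    if 1: "(a', s') \<in> frac a s" and 2: "(b', t') \<in> frac b t" for a' s' b' t'
  proof -
    note [simp] = fraction_memD(1,2)[OF 1 assms(1,3)] fraction_memD(1,2)[OF 2 assms(2,4)]
    obtain u where [simp]: "u \<in> S" and u: "u \<otimes> (a \<otimes> s') = u \<otimes> (a' \<otimes> s)"
      using fraction_memD(3)[OF 1 assms(1,3)] by blast
    obtain v where [simp]: "v \<in> S" and v: "v \<otimes> (b \<otimes> t') = v \<otimes> (b' \<otimes> t)"
      using fraction_memD(3)[OF 2 assms(2,4)] by blast
    have "u \<otimes> v \<otimes> ((a' \<otimes> t' \<oplus> b' \<otimes> s') \<otimes> (s \<otimes> t)) =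
        (u \<otimes> (a' \<otimes> s)) \<otimes> (v \<otimes> t \<otimes> t') \<oplus> (v \<otimes> (b' \<otimes> t)) \<otimes> (u \<otimes> s \<otimes> s')"
      by (simp add: m_ac l_distr r_distr)
    also have "\<dots> = (u \<otimes> (a \<otimes> s')) \<otimes> (v \<otimes> t \<otimes> t') \<oplus> (v \<otimes> (b \<otimes> t')) \<otimes> (u \<otimes> s \<otimes> s')"
      by (simp only: u v)
    also have "\<dots> = u \<otimes> v \<otimes> ((a \<otimes> t \<oplus> b \<otimes> s) \<otimes> (s' \<otimes> t'))"
      by (simp add: m_ac l_distr r_distr)
    finally show ?thesis
      by (rule fraction_eqI[rotated 5]) simp_all
  qed
  note main = this
  have inner: "(\<Union>(b', t')\<in>frac b t. frac (a' \<otimes> t' \<oplus> b' \<otimes> s') (s' \<otimes> t')) = frac (a \<otimes> t \<oplus> b \<otimes> s) (s \<otimes> t)"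
    if "(a', s') \<in> frac a s" for a' s'
    by (subst Union_fraction) (simp_all add: main[OF that] fraction_self)
  have "(\<Union>(a', s')\<in>frac a s. \<Union>(b', t')\<in>frac b t. frac (a' \<otimes> t' \<oplus> b' \<otimes> s') (s' \<otimes> t')) = frac (a \<otimes> t \<oplus> b \<otimes> s) (s \<otimes> t)"
    by (subst Union_fraction) (simp_all only: inner fraction_self assms)
  then show ?thesis
    by (simp add: fraction_ring_def)
qed

lemma fraction_carrier: "x \<in> carrier Loc \<longleftrightarrow> (\<exists>a s. x = frac a s \<and> a \<in> carrier A \<and> s \<in> S)"
  by (simp add: fraction_ring_def)

lemma fraction_closed [simp]: "a \<in> carrier A \<Longrightarrow> s \<in> S \<Longrightarrow> frac a s \<in> carrier Loc"
  using fraction_carrier by blast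

lemma fraction_one: "\<one>\<^bsub>Loc\<^esub> = frac \<one> \<one>" and fraction_zero: "\<zero>\<^bsub>Loc\<^esub> = frac \<zero> \<one>"
  by (simp_all add: fraction_ring_def)

lemmas fraction_simps = fraction_one fraction_zero fraction_mult fraction_add

lemma fraction_cong:
  assumes "a \<in> carrier A" "b \<in> carrier A" "s \<in> S" "t \<in> S" "a \<otimes> t = b \<otimes> s"
  shows "frac a s = frac b t"
  by (rule fraction_eqI[of _ _ _ _ \<one>]) (simp_all only: assms denom_one)

lemma fraction_neg_add:
  assumes [simp]: "a \<in> carrier A" "s \<in> S"
  shows "frac (\<ominus> a) s \<oplus>\<^bsub>Loc\<^esub> frac a s = \<zero>\<^bsub>Loc\<^esub>"
proof -
  have "\<ominus> a \<otimes> s \<oplus> a \<otimes> s = \<zero>"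
    by (simp add: l_minus l_neg)
  then have "(\<ominus> a \<otimes> s \<oplus> a \<otimes> s) \<otimes> \<one> = \<zero> \<otimes> (s \<otimes> s)"
    by simp
  from fraction_cong[OF _ _ _ _ this] show ?thesis
    by (simp add: fraction_zero fraction_add)
qed

lemma fraction_ring_cring: "cring Loc"
proof (rule cringI)
  show "abelian_group Loc"
  proof (rule abelian_groupI)
    fix x y assume "x \<in> carrier Loc" "y \<in> carrier Loc"
    then obtain a b s t where [simp]: "x = frac a s" "y = frac b t" "a \<in> carrier A" "b \<in> carrier A" "s \<in> S" "t \<in> S"
      by (auto simp: fraction_carrier)
    show "x \<oplus>\<^bsub>Loc\<^esub> y \<in> carrier Loc"
      by (simp add: fraction_add)
    show "x \<oplus>\<^bsub>Loc\<^esub> y = y \<oplus>\<^bsub>Loc\<^esub> x"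
      by (simp add: fraction_add a_comm m_comm)
    fix z assume "z \<in> carrier Loc"
    then obtain c w where [simp]: "z = frac c w" "c \<in> carrier A" "w \<in> S"
      by (auto simp: fraction_carrier)
    show "x \<oplus>\<^bsub>Loc\<^esub> y \<oplus>\<^bsub>Loc\<^esub> z = x \<oplus>\<^bsub>Loc\<^esub> (y \<oplus>\<^bsub>Loc\<^esub> z)"
      by (simp add: fraction_add l_distr r_distr m_ac a_assoc)
  next
    fix x assume "x \<in> carrier Loc"
    then obtain a s where [simp]: "x = frac a s" "a \<in> carrier A" "s \<in> S"
      by (auto simp: fraction_carrier)
    show "\<exists>y\<in>carrier Loc. y \<oplus>\<^bsub>Loc\<^esub> x = \<zero>\<^bsub>Loc\<^esub>"
      by (rule bexI[of _ "frac (\<ominus> a) s"]) (simp_all add: fraction_neg_add)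
    show "\<zero>\<^bsub>Loc\<^esub> \<oplus>\<^bsub>Loc\<^esub> x = x"
      by (simp add: fraction_simps)
  qed (simp add: fraction_zero)
  show "comm_monoid Loc"
  proof (rule comm_monoidI)
    fix x y assume "x \<in> carrier Loc" "y \<in> carrier Loc"
    then obtain a b s t where [simp]: "x = frac a s" "y = frac b t" "a \<in> carrier A" "b \<in> carrier A" "s \<in> S" "t \<in> S"
      by (auto simp: fraction_carrier)
    show "x \<otimes>\<^bsub>Loc\<^esub> y \<in> carrier Loc"
      by (simp add: fraction_mult)
    show "x \<otimes>\<^bsub>Loc\<^esub> y = y \<otimes>\<^bsub>Loc\<^esub> x"
      by (simp add: fraction_mult m_comm)
    fix z assume "z \<in> carrier Loc"
    then obtain c w where [simp]: "z = frac c w" "c \<in> carrier A" "w \<in> S"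
      by (auto simp: fraction_carrier)
    show "x \<otimes>\<^bsub>Loc\<^esub> y \<otimes>\<^bsub>Loc\<^esub> z = x \<otimes>\<^bsub>Loc\<^esub> (y \<otimes>\<^bsub>Loc\<^esub> z)"
      by (simp add: fraction_mult m_assoc)
  next
    fix x assume "x \<in> carrier Loc"
    then obtain a s where [simp]: "x = frac a s" "a \<in> carrier A" "s \<in> S"
      by (auto simp: fraction_carrier)
    show "\<one>\<^bsub>Loc\<^esub> \<otimes>\<^bsub>Loc\<^esub> x = x"
      by (simp add: fraction_simps)
  qed (simp add: fraction_one)
  fix x y z assume "x \<in> carrier Loc" "y \<in> carrier Loc" "z \<in> carrier Loc"
  then obtain a b c s t w where [simp]: "x = frac a s" "y = frac b t" "z = frac c w"
      "a \<in> carrier A" "b \<in> carrier A" "c \<in> carrier A" "s \<in> S" "t \<in> S" "w \<in> S"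
    by (auto simp: fraction_carrier)
  have e: "(a \<otimes> t \<oplus> b \<otimes> s) \<otimes> c \<otimes> ((s \<otimes> w) \<otimes> (t \<otimes> w)) = ((a \<otimes> c) \<otimes> (t \<otimes> w) \<oplus> (b \<otimes> c) \<otimes> (s \<otimes> w)) \<otimes> (s \<otimes> t \<otimes> w)"
    by (simp add: l_distr r_distr m_ac)
  show "(x \<oplus>\<^bsub>Loc\<^esub> y) \<otimes>\<^bsub>Loc\<^esub> z = x \<otimes>\<^bsub>Loc\<^esub> z \<oplus>\<^bsub>Loc\<^esub> y \<otimes>\<^bsub>Loc\<^esub> z"
    by (simp add: fraction_mult fraction_add) (rule fraction_cong[OF _ _ _ _ e], simp_all)
qed

section \<open>Completed localizations\<close>

abbreviation frac_coset where
  "frac_coset x n a s \<equiv> ideal_pow Loc (PIdl\<^bsub>Loc\<^esub> (frac x \<one>)) n +>\<^bsub>Loc\<^esub> frac a s"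

lemma fraction_pow:
  assumes [simp]: "x \<in> carrier A"
  shows "frac x \<one> [^]\<^bsub>Loc\<^esub> n = frac (x [^] (n::nat)) \<one>"
proof -
  interpret Loc: cring Loc by (rule fraction_ring_cring)
  show ?thesis
    by (induction n) (simp_all add: fraction_one fraction_mult)
qed

text \<open>Denominators are units, so membership concerns the numerator only; it may need a further denominator
  \<open>u\<close> because the localization map need not be injective.\<close>

lemma fraction_mem_ideal_pow:
  assumes [simp]: "x \<in> carrier A" "a \<in> carrier A" "s \<in> S"
  shows "frac a s \<in> ideal_pow Loc (PIdl\<^bsub>Loc\<^esub> (frac x \<one>)) n \<longleftrightarrow> (\<exists>u\<in>S. u \<otimes> a \<in> PIdl (x [^] n))"
proof -
  interpret Loc: cring Loc by (rule fraction_ring_cring)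
  have "frac a s \<in> ideal_pow Loc (PIdl\<^bsub>Loc\<^esub> (frac x \<one>)) n \<longleftrightarrow>
      (\<exists>b\<in>carrier A. \<exists>t\<in>S. frac a s = frac (b \<otimes> x [^] n) t)" (is "_ \<longleftrightarrow> ?R")
  proof -
    have "frac a s \<in> ideal_pow Loc (PIdl\<^bsub>Loc\<^esub> (frac x \<one>)) n \<longleftrightarrow>
        (\<exists>y\<in>carrier Loc. frac a s = y \<otimes>\<^bsub>Loc\<^esub> frac (x [^] n) \<one>)"
      by (simp add: Loc.ideal_pow_principal fraction_pow) (auto simp: cgenideal_def)
    also have "\<dots> \<longleftrightarrow> (\<exists>b\<in>carrier A. \<exists>t\<in>S. frac a s = frac b t \<otimes>\<^bsub>Loc\<^esub> frac (x [^] n) \<one>)"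
      using fraction_carrier fraction_closed by metis
    also have "\<dots> \<longleftrightarrow> ?R"
      by (intro bex_cong refl) (simp add: fraction_mult)
    finally show ?thesis .
  qed
  also have "\<dots> \<longleftrightarrow> (\<exists>u\<in>S. u \<otimes> a \<in> PIdl (x [^] n))"
  proof
    assume ?R
    then obtain b t where bt [simp]: "b \<in> carrier A" "t \<in> S" and "frac a s = frac (b \<otimes> x [^] n) t"
      by blast
    then obtain u where [simp]: "u \<in> S" and u: "u \<otimes> (a \<otimes> t) = u \<otimes> (b \<otimes> x [^] n \<otimes> s)"
      using fraction_eq_iff[of a "b \<otimes> x [^] n" s t] by auto
    have "(u \<otimes> t) \<otimes> a = u \<otimes> (a \<otimes> t)"
      by (simp add: m_ac)
    also have "\<dots> = (u \<otimes> b \<otimes> s) \<otimes> x [^] n"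
      by (simp only: u) (simp add: m_ac)
    finally show "\<exists>u\<in>S. u \<otimes> a \<in> PIdl (x [^] n)"
      by (intro bexI[of _ "u \<otimes> t"]) (auto simp: cgenideal_def)
  next
    assume "\<exists>u\<in>S. u \<otimes> a \<in> PIdl (x [^] n)"
    then obtain u b where [simp]: "u \<in> S" "b \<in> carrier A" and u: "u \<otimes> a = b \<otimes> x [^] n"
      by (auto simp: cgenideal_def)
    have "a \<otimes> (u \<otimes> s) = (u \<otimes> a) \<otimes> s"
      by (simp add: m_ac)
    also have "\<dots> = b \<otimes> x [^] n \<otimes> s"
      by (simp only: u)
    finally have "frac a s = frac (b \<otimes> x [^] n) (u \<otimes> s)"
      by (intro fraction_cong) simp_all
    then show ?R
      by (intro bexI[of _ b] bexI[of _ "u \<otimes> s"]) simp_all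
  qed
  finally show ?thesis .
qed

lemma fraction_minus:
  assumes [simp]: "a \<in> carrier A" "b \<in> carrier A" "s \<in> S" "t \<in> S"
  shows "frac a s \<ominus>\<^bsub>Loc\<^esub> frac b t = frac (a \<otimes> t \<ominus> b \<otimes> s) (s \<otimes> t)"
proof -
  interpret Loc: cring Loc by (rule fraction_ring_cring)
  have "\<ominus>\<^bsub>Loc\<^esub> frac b t = frac (\<ominus> b) t"
    by (rule Loc.minus_equality) (simp_all add: fraction_neg_add)
  then show ?thesis
    by (simp add: Loc.minus_eq minus_eq fraction_add l_minus)
qed

lemma fraction_ideal_pow:
  assumes "x \<in> carrier A"
  shows "ideal (ideal_pow Loc (PIdl\<^bsub>Loc\<^esub> (frac x \<one>)) n) Loc"
proof -
  interpret Loc: cring Loc by (rule fraction_ring_cring)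
  show ?thesis
    using assms by (simp add: Loc.ideal_pow_principal Loc.cgenideal_ideal)
qed

lemma frac_coset_eq_iff:
  assumes [simp]: "x \<in> carrier A" "a \<in> carrier A" "b \<in> carrier A" "s \<in> S" "t \<in> S"
  shows "frac_coset x n a s = frac_coset x n b t \<longleftrightarrow> (\<exists>u\<in>S. u \<otimes> (a \<otimes> t \<ominus> b \<otimes> s) \<in> PIdl (x [^] n))"
  using ideal.coset_eq_iff[OF fraction_ideal_pow[of x n], of "frac a s" "frac b t"]
  by (simp add: fraction_minus fraction_mem_ideal_pow)

lemma frac_coset_self:
  assumes "x \<in> carrier A" "a \<in> carrier A" "s \<in> S"
  shows "frac a s \<in> frac_coset x n a s"
proof -
  interpret I: ideal "ideal_pow Loc (PIdl\<^bsub>Loc\<^esub> (frac x \<one>)) n" Loc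
    by (rule fraction_ideal_pow) fact
  show ?thesis
    using assms I.a_rcos_self by simp
qed

lemma frac_coset_memE:
  assumes "y \<in> frac_coset x n a s" "x \<in> carrier A" "a \<in> carrier A" "s \<in> S"
  obtains b t where "y = frac b t" "b \<in> carrier A" "t \<in> S" "frac_coset x n b t = frac_coset x n a s"
proof -
  interpret I: ideal "ideal_pow Loc (PIdl\<^bsub>Loc\<^esub> (frac x \<one>)) n" Loc
    by (rule fraction_ideal_pow) fact
  have "y \<in> carrier Loc"
    using assms(3,4) I.a_elemrcos_carrier[OF _ assms(1)] by simp
  then obtain b t where y: "y = frac b t" "b \<in> carrier A" "t \<in> S"
    by (auto simp: fraction_carrier)
  have "frac_coset x n a s = frac_coset x n b t"
    using I.a_repr_independence'[OF assms(1)] assms(3,4) y(1) by simp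
  then show ?thesis
    using that[OF y] by simp
qed

lemma frac_coset_mono:
  assumes "x \<in> carrier A" "a \<in> carrier A" "s \<in> S" "m \<le> n"
  shows "frac_coset x n a s \<subseteq> frac_coset x m a s"
proof
  fix y assume "y \<in> frac_coset x n a s"
  then obtain b t where y: "y = frac b t" "b \<in> carrier A" "t \<in> S" "frac_coset x n b t = frac_coset x n a s"
    using assms by (auto elim: frac_coset_memE)
  then have "\<exists>u\<in>S. u \<otimes> (b \<otimes> s \<ominus> a \<otimes> t) \<in> PIdl (x [^] m)"
    using assms by (auto simp: frac_coset_eq_iff intro: PIdl_pow_mono)
  then have "frac_coset x m b t = frac_coset x m a s"
    using y assms by (simp add: frac_coset_eq_iff)
  then show "y \<in> frac_coset x m a s"
    using frac_coset_self[of x b t m] y assms by simp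
qed

lemma completion_carrier:
  "z \<in> carrier (completion Loc (PIdl\<^bsub>Loc\<^esub> (frac x \<one>))) \<longleftrightarrow>
    (\<forall>n. (\<exists>a\<in>carrier A. \<exists>s\<in>S. z n = frac_coset x n a s) \<and> z (Suc n) \<subseteq> z n)"
proof -
  have "y \<in> carrier (Loc Quot I) \<longleftrightarrow> (\<exists>a\<in>carrier A. \<exists>s\<in>S. y = I +>\<^bsub>Loc\<^esub> frac a s)" for y I
    unfolding FactRing_simps using fraction_carrier by fastforce
  then show ?thesis
    by (simp add: completion_def)
qed

end

lemma fraction_map_fraction:
  assumes "fractions A S" "fractions C S'" "\<phi> \<in> ring_hom A C" "\<phi> ` S \<subseteq> S'"
    and "a \<in> carrier A" "s \<in> S"
  shows "fraction_map C S' \<phi> (fraction A S a s) = fraction C S' (\<phi> a) (\<phi> s)"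
proof -
  interpret A: fractions A S by fact
  interpret C: fractions C S' by fact
  have *: "fraction C S' (\<phi> b) (\<phi> t) = fraction C S' (\<phi> a) (\<phi> s)" if bt: "(b, t) \<in> fraction A S a s" for b t
  proof -
    note b = A.fraction_memD(1,2)[OF bt assms(5,6)]
    obtain u where u: "u \<in> S" "u \<otimes>\<^bsub>A\<^esub> (a \<otimes>\<^bsub>A\<^esub> t) = u \<otimes>\<^bsub>A\<^esub> (b \<otimes>\<^bsub>A\<^esub> s)"
      using A.fraction_memD(3)[OF bt assms(5,6)] by blast
    then have "\<phi> (u \<otimes>\<^bsub>A\<^esub> (a \<otimes>\<^bsub>A\<^esub> t)) = \<phi> (u \<otimes>\<^bsub>A\<^esub> (b \<otimes>\<^bsub>A\<^esub> s))"
      by simp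
    then have "\<phi> u \<otimes>\<^bsub>C\<^esub> (\<phi> a \<otimes>\<^bsub>C\<^esub> \<phi> t) = \<phi> u \<otimes>\<^bsub>C\<^esub> (\<phi> b \<otimes>\<^bsub>C\<^esub> \<phi> s)"
      using assms(3,5,6) b u(1) by (simp add: ring_hom_mult)
    from C.fraction_eqI[OF _ _ _ _ _ this] show ?thesis
      using b u(1) assms by (simp add: ring_hom_closed image_subset_iff)
  qed
  show ?thesis
    unfolding fraction_map_def
    by (rule UN_constant_eq[OF A.fraction_self[OF assms(5,6)]]) (simp add: * split_beta)
qed

text \<open>The union over the representatives \<open>b/t\<close> of the coset of \<open>a/s\<close> does not depend on the representative, since \<open>\<phi>\<close>
  maps multiples of \<open>x\<^sup>n\<close> to multiples of \<open>\<phi>(x)\<^sup>n\<close>.\<close>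

lemma completion_map_frac_coset:
  assumes "fractions A S" "fractions C S'" "\<phi> \<in> ring_hom A C" "\<phi> ` S \<subseteq> S'"
    and "x \<in> carrier A" "a \<in> carrier A" "s \<in> S"
    and z: "z n = fractions.frac_coset A S x n a s"
  shows "completion_map (fraction_ring C S') (PIdl\<^bsub>fraction_ring C S'\<^esub> (fraction C S' (\<phi> x) \<one>\<^bsub>C\<^esub>))
      (fraction_map C S' \<phi>) z n = fractions.frac_coset C S' (\<phi> x) n (\<phi> a) (\<phi> s)"
proof -
  interpret A: fractions A S by fact
  interpret C: fractions C S' by fact
  interpret ring_hom_cring A C \<phi>
    by (rule ring_hom_cringI) (use assms(3) A.is_cring C.is_cring in \<open>auto simp: ring_hom_ringI2 A.ring_axioms C.ring_axioms\<close>)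
  have S': "\<phi> t \<in> S'" if "t \<in> S" for t
    using assms(4) that by auto
  have *: "C.frac_coset (\<phi> x) n (\<phi> b) (\<phi> t) = C.frac_coset (\<phi> x) n (\<phi> a) (\<phi> s)"
    if b: "b \<in> carrier A" "t \<in> S" "A.frac_coset x n b t = A.frac_coset x n a s" for b t
  proof -
    obtain u where u: "u \<in> S" "u \<otimes>\<^bsub>A\<^esub> (b \<otimes>\<^bsub>A\<^esub> s \<ominus>\<^bsub>A\<^esub> a \<otimes>\<^bsub>A\<^esub> t) \<in> PIdl\<^bsub>A\<^esub> (x [^]\<^bsub>A\<^esub> n)"
      using b assms by (auto simp: A.frac_coset_eq_iff)
    then obtain c where c: "c \<in> carrier A"
        "u \<otimes>\<^bsub>A\<^esub> (b \<otimes>\<^bsub>A\<^esub> s \<ominus>\<^bsub>A\<^esub> a \<otimes>\<^bsub>A\<^esub> t) = c \<otimes>\<^bsub>A\<^esub> x [^]\<^bsub>A\<^esub> n"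
      by (auto simp: cgenideal_def)
    have "\<phi> (u \<otimes>\<^bsub>A\<^esub> (b \<otimes>\<^bsub>A\<^esub> s \<ominus>\<^bsub>A\<^esub> a \<otimes>\<^bsub>A\<^esub> t)) = \<phi> (c \<otimes>\<^bsub>A\<^esub> x [^]\<^bsub>A\<^esub> n)"
      by (simp only: c(2))
    then have "\<phi> u \<otimes>\<^bsub>C\<^esub> (\<phi> b \<otimes>\<^bsub>C\<^esub> \<phi> s \<ominus>\<^bsub>C\<^esub> \<phi> a \<otimes>\<^bsub>C\<^esub> \<phi> t) = \<phi> c \<otimes>\<^bsub>C\<^esub> \<phi> x [^]\<^bsub>C\<^esub> n"
      using b(1,2) u(1) c(1) assms(5-7)
      by (simp add: A.minus_eq C.minus_eq hom_nat_pow)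
    then have "\<phi> u \<otimes>\<^bsub>C\<^esub> (\<phi> b \<otimes>\<^bsub>C\<^esub> \<phi> s \<ominus>\<^bsub>C\<^esub> \<phi> a \<otimes>\<^bsub>C\<^esub> \<phi> t) \<in> PIdl\<^bsub>C\<^esub> (\<phi> x [^]\<^bsub>C\<^esub> n)"
      unfolding cgenideal_def using c(1) hom_closed by blast
    then show ?thesis
      using b(1,2) u(1) assms(5-7) S' by (subst C.frac_coset_eq_iff) auto
  qed
  have "\<forall>y\<in>z n. ideal_pow (fraction_ring C S') (PIdl\<^bsub>fraction_ring C S'\<^esub> (fraction C S' (\<phi> x) \<one>\<^bsub>C\<^esub>)) n
      +>\<^bsub>fraction_ring C S'\<^esub> fraction_map C S' \<phi> y = C.frac_coset (\<phi> x) n (\<phi> a) (\<phi> s)"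
  proof
    fix y assume "y \<in> z n"
    then obtain b t where y: "y = A.frac b t" "b \<in> carrier A" "t \<in> S" "A.frac_coset x n b t = A.frac_coset x n a s"
      unfolding z using assms(5-7) by (elim A.frac_coset_memE) auto
    show "ideal_pow (fraction_ring C S') (PIdl\<^bsub>fraction_ring C S'\<^esub> (fraction C S' (\<phi> x) \<one>\<^bsub>C\<^esub>)) n
      +>\<^bsub>fraction_ring C S'\<^esub> fraction_map C S' \<phi> y = C.frac_coset (\<phi> x) n (\<phi> a) (\<phi> s)"
      using *[OF y(2-4)] by (simp only: y(1) fraction_map_fraction[OF assms(1-4) y(2,3)])
  qed
  moreover have "A.frac a s \<in> z n"
    unfolding z using assms(5-7) by (simp add: A.frac_coset_self)
  ultimately show ?thesis
    unfolding completion_map_def by (intro UN_constant_eq)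
qed


section \<open>Patching functions on the envelope\<close>

lemma (in cring) fractions_powers:
  assumes [simp]: "f \<in> carrier R"
  shows "fractions R (powers R f)"
proof unfold_locales
  show "powers R f \<subseteq> carrier R"
    by (auto simp: powers_def)
  show "\<one> \<in> powers R f"
    unfolding powers_def by (rule range_eqI[of _ _ 0]) simp
  fix s t assume "s \<in> powers R f" "t \<in> powers R f"
  then obtain i j :: nat where "s = f [^] i" "t = f [^] j"
    by (auto simp: powers_def)
  then show "s \<otimes> t \<in> powers R f"
    unfolding powers_def by (intro range_eqI[of _ _ "i + j"]) (simp add: nat_pow_mult)
qed

text \<open>Equivalently, \<open>f\<close> is a nonzerodivisor modulo every power of \<open>p\<close>, so that localization at \<open>f\<close> is
  injective modulo \<open>p\<^sup>n\<close>.\<close>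

definition (in cring) adic_regular where
  "adic_regular p f \<longleftrightarrow> (\<forall>n::nat. \<forall>a\<in>carrier R. f \<otimes> a \<in> PIdl (p [^] n) \<longrightarrow> a \<in> PIdl (p [^] n))"

context cring
begin

lemma adic_regular_pow:
  assumes "adic_regular p f" "f \<in> carrier R" "a \<in> carrier R" "f [^] (k::nat) \<otimes> a \<in> PIdl (p [^] (n::nat))"
  shows "a \<in> PIdl (p [^] n)"
  using assms(3,4)
proof (induction k arbitrary: a)
  case (Suc k)
  then have "f [^] k \<otimes> (f \<otimes> a) \<in> PIdl (p [^] n)"
    using assms(2) by (simp add: m_assoc)
  then have "f \<otimes> a \<in> PIdl (p [^] n)"
    using Suc assms(2) by simp
  then show ?case
    using assms(1) Suc.prems unfolding adic_regular_def by blast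
qed (use assms in simp)

lemma adic_regular_one: "adic_regular p \<one>"
  by (simp add: adic_regular_def)

abbreviation loc_coset where
  "loc_coset p f n a s \<equiv> fractions.frac_coset R (powers R f) p n a s"

lemma loc_coset_eq_iff:
  assumes "adic_regular p f" "p \<in> carrier R" "f \<in> carrier R" "a \<in> carrier R" "b \<in> carrier R"
    "s \<in> powers R f" "t \<in> powers R f"
  shows "loc_coset p f n a s = loc_coset p f n b t \<longleftrightarrow> a \<otimes> t \<ominus> b \<otimes> s \<in> PIdl (p [^] n)" (is "?L \<longleftrightarrow> ?R")
proof -
  interpret fractions R "powers R f"
    using assms(3) by (rule fractions_powers)
  have "?L \<longleftrightarrow> (\<exists>u\<in>powers R f. u \<otimes> (a \<otimes> t \<ominus> b \<otimes> s) \<in> PIdl (p [^] n))"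
    using assms by (simp add: frac_coset_eq_iff)
  also have "\<dots> \<longleftrightarrow> ?R"
  proof
    assume "\<exists>u\<in>powers R f. u \<otimes> (a \<otimes> t \<ominus> b \<otimes> s) \<in> PIdl (p [^] n)"
    then obtain k :: nat where "f [^] k \<otimes> (a \<otimes> t \<ominus> b \<otimes> s) \<in> PIdl (p [^] n)"
      unfolding powers_def by blast
    from adic_regular_pow[OF assms(1,3) _ this] show ?R
      using assms(4-7) by simp
  next
    assume ?R
    then show "\<exists>u\<in>powers R f. u \<otimes> (a \<otimes> t \<ominus> b \<otimes> s) \<in> PIdl (p [^] n)"
      using assms(4-7) by (intro bexI[of _ \<one>]) simp_all
  qed
  finally show ?thesis .
qed

lemma powers_one: "powers R \<one> = {\<one>}"
  by (auto simp: powers_def)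

lemma pow_in_powers: "f [^] (k::nat) \<in> powers R f"
  by (simp add: powers_def)

lemma one_in_powers: "\<one> \<in> powers R f"
  unfolding powers_def by (rule range_eqI[of _ _ 0]) simp

lemma envelope_functions_carrier:
  assumes "f \<in> carrier R"
  shows "z \<in> carrier (envelope_functions R p f) \<longleftrightarrow>
    (\<forall>n. (\<exists>a\<in>carrier R. \<exists>s\<in>powers R f. z n = loc_coset p f n a s) \<and> z (Suc n) \<subseteq> z n)"
  unfolding envelope_functions_def adic_ideal_def
  by (rule fractions.completion_carrier[OF fractions_powers[OF assms]])

end

lemma envelope_pullback_coset:
  assumes "cring A" "cring C" "\<phi> \<in> ring_hom A C" "f \<in> carrier A" "e \<in> carrier C" "\<phi> ` powers A f \<subseteq> powers C e"
    and "p \<in> carrier A" "a \<in> carrier A" "s \<in> powers A f"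
    and "z n = cring.loc_coset A p f n a s"
  shows "envelope_pullback C (\<phi> p) e \<phi> z n = cring.loc_coset C (\<phi> p) e n (\<phi> a) (\<phi> s)"
  unfolding envelope_pullback_def adic_ideal_def
  by (rule completion_map_frac_coset[OF cring.fractions_powers[OF assms(1,4)] cring.fractions_powers[OF assms(2,5)]])
    (use assms in auto)

text \<open>Represent \<open>g\<close> by fractions \<open>a\<^sub>n / f\<^sup>k\<close> and \<open>h\<close> by elements \<open>b\<^sub>n\<close> of \<open>C\<close>.  The assumption \<open>glue\<close>, where the
  geometry enters, provides \<open>c\<^sub>n\<close> in \<open>A\<close> with \<open>a\<^sub>n / f\<^sup>k = c\<^sub>n\<close> modulo \<open>p\<^sup>n\<close>.  As \<open>f\<close> may be cancelled modulo \<open>p\<^sup>n\<close>,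
  the \<open>c\<^sub>n\<close> are compatible and unique, and \<open>\<phi>(c\<^sub>n) = b\<^sub>n\<close> modulo \<open>\<phi>(p)\<^sup>n\<close> because this holds after
  multiplication by a power of \<open>\<phi>(f)\<close>.\<close>

theorem envelope_patching:
  fixes A :: "('a, 'm) ring_scheme" and C :: "('b, 'l) ring_scheme"
  assumes A: "cring A" and C: "cring C" and \<phi>: "\<phi> \<in> ring_hom A C"
    and p: "p \<in> carrier A" and f: "f \<in> carrier A"
    and regA: "cring.adic_regular A p f" and regC: "cring.adic_regular C (\<phi> p) (\<phi> f)"
    and glue: "\<And>(a::nat \<Rightarrow> 'a) (k::nat \<Rightarrow> nat) M. (\<And>N. a N \<in> carrier A) \<Longrightarrow>
        (\<And>M N. M \<le> N \<Longrightarrow> a N \<otimes>\<^bsub>A\<^esub> f [^]\<^bsub>A\<^esub> k M \<ominus>\<^bsub>A\<^esub> a M \<otimes>\<^bsub>A\<^esub> f [^]\<^bsub>A\<^esub> k N \<in> PIdl\<^bsub>A\<^esub> (p [^]\<^bsub>A\<^esub> M)) \<Longrightarrow>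
        (\<And>N. \<exists>x\<in>carrier C. \<phi> (a N) \<ominus>\<^bsub>C\<^esub> x \<otimes>\<^bsub>C\<^esub> \<phi> f [^]\<^bsub>C\<^esub> k N \<in> PIdl\<^bsub>C\<^esub> (\<phi> p [^]\<^bsub>C\<^esub> N)) \<Longrightarrow>
        \<exists>c\<in>carrier A. a M \<ominus>\<^bsub>A\<^esub> c \<otimes>\<^bsub>A\<^esub> f [^]\<^bsub>A\<^esub> k M \<in> PIdl\<^bsub>A\<^esub> (p [^]\<^bsub>A\<^esub> M)"
    and g: "g \<in> carrier (envelope_functions A p f)"
    and h: "h \<in> carrier (envelope_functions C (\<phi> p) \<one>\<^bsub>C\<^esub>)"
    and gh: "envelope_pullback C (\<phi> p) (\<phi> f) \<phi> g = envelope_restrict C (\<phi> p) (\<phi> f) h"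
  shows "\<exists>!u. u \<in> carrier (envelope_functions A p \<one>\<^bsub>A\<^esub>)
            \<and> envelope_restrict A p f u = g
            \<and> envelope_pullback C (\<phi> p) \<one>\<^bsub>C\<^esub> \<phi> u = h"
proof -
  interpret A: cring A by fact
  interpret C: cring C by fact
  interpret ring_hom_cring A C \<phi>
    by (rule ring_hom_cringI) (use \<phi> A C in \<open>auto simp: ring_hom_ringI2 A.ring_axioms C.ring_axioms\<close>)
  note [simp] = p f A.pow_in_powers C.pow_in_powers A.one_in_powers C.one_in_powers
  define IA where "IA n = PIdl\<^bsub>A\<^esub> (p [^]\<^bsub>A\<^esub> n)" for n :: nat
  define IC where "IC n = PIdl\<^bsub>C\<^esub> (\<phi> p [^]\<^bsub>C\<^esub> n)" for n :: nat
  have IA: "ideal (IA n) A" for n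
    by (simp add: IA_def A.cgenideal_ideal)
  have IC: "ideal (IC n) C" for n
    by (simp add: IC_def C.cgenideal_ideal)
  have \<phi>_IA: "\<phi> x \<in> IC n" if "x \<in> IA n" for x n
    using that by (auto simp: IA_def IC_def cgenideal_def hom_nat_pow)
  have IA_mono: "x \<in> IA m" if "x \<in> IA n" "m \<le> n" for x m n
    using that A.PIdl_pow_mono[of p m n x] by (simp add: IA_def)
  note eqA = A.loc_coset_eq_iff[OF regA p f, folded IA_def]
  note eqA1 = A.loc_coset_eq_iff[OF A.adic_regular_one p A.one_closed, folded IA_def]
  note eqC = C.loc_coset_eq_iff[OF regC hom_closed[OF p] hom_closed[OF f], folded IC_def]
  note eqC1 = C.loc_coset_eq_iff[OF C.adic_regular_one hom_closed[OF p] C.one_closed, folded IC_def]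
  have powers_\<phi>: "\<phi> ` powers A f \<subseteq> powers C (\<phi> f)"
    by (auto simp: powers_def hom_nat_pow)

  have "\<exists>a k. a \<in> carrier A \<and> g n = A.loc_coset p f n a (f [^]\<^bsub>A\<^esub> (k::nat))" for n
    using g unfolding A.envelope_functions_carrier[OF f] powers_def by blast
  then obtain a k where a [simp]: "\<And>n. a n \<in> carrier A"
      and ga: "\<And>n. g n = A.loc_coset p f n (a n) (f [^]\<^bsub>A\<^esub> (k n :: nat))"
    by metis
  have powers1: "s = \<one>\<^bsub>A\<^esub>" if "s \<in> powers A \<one>\<^bsub>A\<^esub>" for s
    using that by (simp add: A.powers_one)
  have powers1': "s = \<one>\<^bsub>C\<^esub>" if "s \<in> powers C \<one>\<^bsub>C\<^esub>" for s
    using that by (simp add: C.powers_one)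
  have [simp]: "powers A \<one>\<^bsub>A\<^esub> \<subseteq> powers A x" "powers C \<one>\<^bsub>C\<^esub> \<subseteq> powers C y"
      "\<phi> ` powers A \<one>\<^bsub>A\<^esub> \<subseteq> powers C \<one>\<^bsub>C\<^esub>" for x y
    by (auto simp: A.powers_one C.powers_one)
  have "\<exists>b. b \<in> carrier C \<and> h n = C.loc_coset (\<phi> p) \<one>\<^bsub>C\<^esub> n b \<one>\<^bsub>C\<^esub>" for n
    using h unfolding C.envelope_functions_carrier[OF C.one_closed] using powers1' by blast
  then obtain b where b [simp]: "\<And>n. b n \<in> carrier C"
      and hb: "\<And>n. h n = C.loc_coset (\<phi> p) \<one>\<^bsub>C\<^esub> n (b n) \<one>\<^bsub>C\<^esub>"
    by metis

  have compat: "a N \<otimes>\<^bsub>A\<^esub> f [^]\<^bsub>A\<^esub> k M \<ominus>\<^bsub>A\<^esub> a M \<otimes>\<^bsub>A\<^esub> f [^]\<^bsub>A\<^esub> k N \<in> IA M" if "M \<le> N" for M N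
  proof -
    interpret F: fractions A "powers A f"
      by (rule A.fractions_powers) simp
    have "g N \<subseteq> g M"
      using that by (rule lift_Suc_antimono_le[rotated]) (use g A.envelope_functions_carrier[OF f] in blast)
    moreover have "F.frac (a N) (f [^]\<^bsub>A\<^esub> k N) \<in> g N"
      unfolding ga by (rule F.frac_coset_self) simp_all
    ultimately have "F.frac (a N) (f [^]\<^bsub>A\<^esub> k N) \<in> F.frac_coset p M (a M) (f [^]\<^bsub>A\<^esub> k M)"
      unfolding ga by blast
    then have "F.frac_coset p M (a M) (f [^]\<^bsub>A\<^esub> k M) = F.frac_coset p M (a N) (f [^]\<^bsub>A\<^esub> k N)"
      by (intro abelian_subgroup.a_repr_independence'[OF abelian_subgroupI3]
          F.fraction_closed ideal.axioms(1)[OF F.fraction_ideal_pow]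
          ring.is_abelian_group cring.axioms(1)[OF F.fraction_ring_cring]) simp_all
    then show ?thesis
      by (simp add: eqA[symmetric])
  qed
  have agree: "\<phi> (a n) \<ominus>\<^bsub>C\<^esub> b n \<otimes>\<^bsub>C\<^esub> \<phi> f [^]\<^bsub>C\<^esub> k n \<in> IC n" for n
  proof -
    have "C.loc_coset (\<phi> p) (\<phi> f) n (\<phi> (a n)) (\<phi> (f [^]\<^bsub>A\<^esub> k n)) = envelope_pullback C (\<phi> p) (\<phi> f) \<phi> g n"
      by (rule envelope_pullback_coset[OF A C \<phi> f _ powers_\<phi>, symmetric]) (simp_all add: ga)
    also have "\<dots> = envelope_pullback C (id (\<phi> p)) (\<phi> f) id h n"
      by (simp add: gh)
    also have "\<dots> = C.loc_coset (id (\<phi> p)) (\<phi> f) n (id (b n)) (id \<one>\<^bsub>C\<^esub>)"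
      by (rule envelope_pullback_coset[OF C C _ C.one_closed]) (simp_all add: hb ring_hom_def)
    finally show ?thesis
      by (simp add: eqC hom_nat_pow)
  qed
  have "\<exists>c\<in>carrier A. a M \<ominus>\<^bsub>A\<^esub> c \<otimes>\<^bsub>A\<^esub> f [^]\<^bsub>A\<^esub> k M \<in> IA M" for M
    unfolding IA_def
  proof (rule glue)
    show "\<exists>x\<in>carrier C. \<phi> (a N) \<ominus>\<^bsub>C\<^esub> x \<otimes>\<^bsub>C\<^esub> \<phi> f [^]\<^bsub>C\<^esub> k N \<in> PIdl\<^bsub>C\<^esub> (\<phi> p [^]\<^bsub>C\<^esub> N)" for N
      using agree[of N] b[of N] unfolding IC_def by blast
  qed (use compat in \<open>simp_all add: IA_def\<close>)
  then obtain c where c [simp]: "\<And>M. c M \<in> carrier A" and ac: "\<And>M. a M \<ominus>\<^bsub>A\<^esub> c M \<otimes>\<^bsub>A\<^esub> f [^]\<^bsub>A\<^esub> k M \<in> IA M"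
    by metis

  have c_Suc: "c (Suc n) \<ominus>\<^bsub>A\<^esub> c n \<in> IA n" for n
  proof -
    interpret I: ideal "IA n" A by (rule IA)
    let ?F = "f [^]\<^bsub>A\<^esub> k n" and ?G = "f [^]\<^bsub>A\<^esub> k (Suc n)"
    have "(f [^]\<^bsub>A\<^esub> (k n + k (Suc n))) \<otimes>\<^bsub>A\<^esub> (c (Suc n) \<ominus>\<^bsub>A\<^esub> c n) =
      (a (Suc n) \<otimes>\<^bsub>A\<^esub> ?F \<ominus>\<^bsub>A\<^esub> a n \<otimes>\<^bsub>A\<^esub> ?G) \<oplus>\<^bsub>A\<^esub> (?G \<otimes>\<^bsub>A\<^esub> (a n \<ominus>\<^bsub>A\<^esub> c n \<otimes>\<^bsub>A\<^esub> ?F)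
        \<ominus>\<^bsub>A\<^esub> ?F \<otimes>\<^bsub>A\<^esub> (a (Suc n) \<ominus>\<^bsub>A\<^esub> c (Suc n) \<otimes>\<^bsub>A\<^esub> ?G))"
    proof -
      have "?F \<in> carrier A" "?G \<in> carrier A" "a n \<in> carrier A" "a (Suc n) \<in> carrier A" "c n \<in> carrier A" "c (Suc n) \<in> carrier A"
        by simp_all
      moreover have "f [^]\<^bsub>A\<^esub> (k n + k (Suc n)) = ?F \<otimes>\<^bsub>A\<^esub> ?G"
        by (simp add: A.nat_pow_mult)
      ultimately show ?thesis
        by (simp only:) algebra
    qed
    also have "\<dots> \<in> IA n"
      using compat[of n "Suc n"] ac[of n] IA_mono[OF ac[of "Suc n"], of n]
      by (simp add: A.minus_eq I.I_l_closed)
    finally show ?thesis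
      unfolding IA_def by (rule A.adic_regular_pow[OF regA f, rotated]) simp
  qed
  have cb: "\<phi> (c n) \<ominus>\<^bsub>C\<^esub> b n \<in> IC n" for n
  proof -
    interpret I: ideal "IC n" C by (rule IC)
    let ?F = "\<phi> f [^]\<^bsub>C\<^esub> k n"
    have "?F \<in> carrier C" "\<phi> (a n) \<in> carrier C" "\<phi> (c n) \<in> carrier C" "b n \<in> carrier C"
      by simp_all
    then have "?F \<otimes>\<^bsub>C\<^esub> (\<phi> (c n) \<ominus>\<^bsub>C\<^esub> b n) =
      (\<phi> (a n) \<ominus>\<^bsub>C\<^esub> b n \<otimes>\<^bsub>C\<^esub> ?F) \<ominus>\<^bsub>C\<^esub> (\<phi> (a n) \<ominus>\<^bsub>C\<^esub> \<phi> (c n) \<otimes>\<^bsub>C\<^esub> ?F)"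
      by algebra
    also have "\<phi> (a n) \<ominus>\<^bsub>C\<^esub> \<phi> (c n) \<otimes>\<^bsub>C\<^esub> ?F = \<phi> (a n \<ominus>\<^bsub>A\<^esub> c n \<otimes>\<^bsub>A\<^esub> f [^]\<^bsub>A\<^esub> k n)"
      by (simp add: A.minus_eq C.minus_eq hom_nat_pow)
    also have "(\<phi> (a n) \<ominus>\<^bsub>C\<^esub> b n \<otimes>\<^bsub>C\<^esub> ?F) \<ominus>\<^bsub>C\<^esub> \<dots> \<in> IC n"
      using agree[of n] \<phi>_IA[OF ac[of n]] unfolding C.minus_eq[of "\<phi> (a n) \<ominus>\<^bsub>C\<^esub> b n \<otimes>\<^bsub>C\<^esub> ?F"] by simp
    finally show ?thesis
      unfolding IC_def by (rule C.adic_regular_pow[OF regC hom_closed[OF f], rotated]) simp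
  qed

  define u where "u n = A.loc_coset p \<one>\<^bsub>A\<^esub> n (c n) \<one>\<^bsub>A\<^esub>" for n
  show ?thesis
  proof (rule ex1I[of _ u], intro conjI)
    interpret F: fractions A "powers A \<one>\<^bsub>A\<^esub>"
      by (rule A.fractions_powers) simp
    have "u (Suc n) \<subseteq> u n" for n
    proof -
      have "u (Suc n) \<subseteq> A.loc_coset p \<one>\<^bsub>A\<^esub> n (c (Suc n)) \<one>\<^bsub>A\<^esub>"
        unfolding u_def by (rule F.frac_coset_mono) simp_all
      also have "\<dots> = u n"
        using c_Suc[of n] by (simp add: u_def eqA1)
      finally show ?thesis .
    qed
    moreover have "\<exists>a\<in>carrier A. \<exists>s\<in>powers A \<one>\<^bsub>A\<^esub>. u n = A.loc_coset p \<one>\<^bsub>A\<^esub> n a s" for n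
      by (intro bexI[of _ "c n"] bexI[of _ "\<one>\<^bsub>A\<^esub>"]) (simp_all add: u_def)
    ultimately show "u \<in> carrier (envelope_functions A p \<one>\<^bsub>A\<^esub>)"
      unfolding A.envelope_functions_carrier[OF A.one_closed] by blast
    show "envelope_restrict A p f u = g"
    proof
      fix n
      have "envelope_pullback A (id p) f id u n = A.loc_coset (id p) f n (id (c n)) (id \<one>\<^bsub>A\<^esub>)"
        by (rule envelope_pullback_coset[OF A A _ A.one_closed]) (simp_all add: u_def ring_hom_def)
      also have "\<dots> = g n"
      proof -
        have "A.loc_coset p f n (a n) (f [^]\<^bsub>A\<^esub> k n) = A.loc_coset p f n (c n) \<one>\<^bsub>A\<^esub>"
          using ac[of n] by (simp add: eqA)
        then show ?thesis by (simp add: ga)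
      qed
      finally show "envelope_restrict A p f u n = g n" by simp
    qed
    show "envelope_pullback C (\<phi> p) \<one>\<^bsub>C\<^esub> \<phi> u = h"
    proof
      fix n
      have "envelope_pullback C (\<phi> p) \<one>\<^bsub>C\<^esub> \<phi> u n = C.loc_coset (\<phi> p) \<one>\<^bsub>C\<^esub> n (\<phi> (c n)) (\<phi> \<one>\<^bsub>A\<^esub>)"
        by (rule envelope_pullback_coset[OF A C \<phi> A.one_closed]) (simp_all add: u_def)
      also have "\<dots> = h n"
        using cb[of n] by (simp add: hb eqC1)
      finally show "envelope_pullback C (\<phi> p) \<one>\<^bsub>C\<^esub> \<phi> u n = h n" .
    qed
  next
    fix v assume v: "v \<in> carrier (envelope_functions A p \<one>\<^bsub>A\<^esub>)
            \<and> envelope_restrict A p f v = g \<and> envelope_pullback C (\<phi> p) \<one>\<^bsub>C\<^esub> \<phi> v = h"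
    show "v = u"
    proof
      fix n
      obtain d where d [simp]: "d \<in> carrier A" and vd: "v n = A.loc_coset p \<one>\<^bsub>A\<^esub> n d \<one>\<^bsub>A\<^esub>"
        using v unfolding A.envelope_functions_carrier[OF A.one_closed] using powers1 by blast
      have "A.loc_coset (id p) f n (id d) (id \<one>\<^bsub>A\<^esub>) = envelope_pullback A (id p) f id v n"
        by (rule envelope_pullback_coset[OF A A _ A.one_closed, symmetric]) (simp_all add: vd ring_hom_def)
      also have "\<dots> = g n"
        using v by simp
      also have "\<dots> = A.loc_coset p f n (c n) \<one>\<^bsub>A\<^esub>"
        using ac[of n] by (simp add: eqA ga)
      finally have "d \<ominus>\<^bsub>A\<^esub> c n \<in> IA n"
        by (simp add: eqA)
      then show "v n = u n"
        by (simp add: vd u_def eqA1)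
    qed
  qed
qed

section \<open>Series with weighted divisibility of coefficients\<close>

abbreviation sdeg :: "coord multiset \<Rightarrow> nat" where
  "sdeg m \<equiv> size (filter_mset (\<lambda>v. v \<noteq> Z_coord) m)"

abbreviation Zpow :: "nat \<Rightarrow> coord multiset" where
  "Zpow j \<equiv> replicate_mset j Z_coord"

lemma sdeg_Zpow [simp]: "sdeg (Zpow j) = 0"
  by (induction j) simp_all

lemma sdeg_zero_iff: "sdeg m = 0 \<longleftrightarrow> m = Zpow (count m Z_coord)"
proof
  assume "sdeg m = 0"
  then have "\<forall>v\<in>#m. v = Z_coord"
    by simp
  then show "m = Zpow (count m Z_coord)"
    by (intro multiset_eqI) (auto simp: count_eq_zero_iff)
next
  assume m: "m = Zpow (count m Z_coord)"
  show "sdeg m = 0"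
    by (subst m) simp
qed

context complete_dvr
begin

lemma pi_closed [simp]: "\<pi> \<in> carrier R"
  by (rule uniformizer_closed)

abbreviation pi_ideal :: "nat \<Rightarrow> 'a set" where
  "pi_ideal k \<equiv> PIdl (\<pi> [^] k)"

lemma pi_ideal_ideal: "ideal (pi_ideal k) R"
  by (simp add: cgenideal_ideal)

lemma pi_ideal_iff: "x \<in> pi_ideal k \<longleftrightarrow> (\<exists>y\<in>carrier R. x = \<pi> [^] k \<otimes> y)"
  unfolding cgenideal_def by (auto simp: m_comm)

lemma PIdl_one [simp]: "PIdl \<one> = carrier R"
  by (force simp: cgenideal_def)

lemma pi_ideal_mono: "x \<in> pi_ideal n \<Longrightarrow> m \<le> n \<Longrightarrow> x \<in> pi_ideal m"
  by (rule PIdl_pow_mono) simp_all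

lemma zero_in_pi_ideal [simp]: "\<zero> \<in> pi_ideal k"
  using additive_subgroup.zero_closed[OF ideal.axioms(1)[OF pi_ideal_ideal]] .

lemma pi_ideal_mult:
  assumes "x \<in> pi_ideal j" "y \<in> pi_ideal k"
  shows "x \<otimes> y \<in> pi_ideal (j + k)"
proof -
  obtain a b where "a \<in> carrier R" "b \<in> carrier R" "x = \<pi> [^] j \<otimes> a" "y = \<pi> [^] k \<otimes> b"
    using assms by (auto simp: pi_ideal_iff)
  then show ?thesis
    unfolding pi_ideal_iff by (intro bexI[of _ "a \<otimes> b"]) (simp_all add: m_ac flip: nat_pow_mult)
qed

lemma pi_pow_in_pi_ideal: "\<pi> [^] k \<in> pi_ideal k"
  by (rule cgenideal_self) simp

lemma pi_pow_cancel:
  assumes "x \<in> carrier R" "\<pi> [^] k \<otimes> x \<in> pi_ideal n"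
  shows "x \<in> pi_ideal (n - k)"
proof (cases "k \<le> n")
  case True
  obtain y where y: "y \<in> carrier R" "\<pi> [^] k \<otimes> x = \<pi> [^] n \<otimes> y"
    using assms(2) by (auto simp: pi_ideal_iff)
  have "\<pi> [^] k \<otimes> x = \<pi> [^] k \<otimes> (\<pi> [^] (n - k) \<otimes> y)"
    using True y by (simp add: nat_pow_mult flip: m_assoc)
  moreover have "\<pi> [^] k \<noteq> \<zero>"
    using uniformizer_nonzero by (induction k) (auto simp: integral_iff)
  ultimately have "x = \<pi> [^] (n - k) \<otimes> y"
    using m_lcancel[of "\<pi> [^] k" x] assms(1) y(1) by simp
  then show ?thesis
    using y(1) by (auto simp: pi_ideal_iff)
qed (use assms in simp)

text \<open>The ideal of \<open>\<pi>\<close> is prime, so the factors \<open>\<pi>\<close> can be split off from \<open>x\<close> one at a time.\<close>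

lemma pi_ideal_unit_cancel:
  assumes "c \<in> carrier R" "c \<notin> PIdl \<pi>" "x \<in> carrier R" "c \<otimes> x \<in> pi_ideal k"
  shows "x \<in> pi_ideal k"
  using assms(3,4)
proof (induction k arbitrary: x)
  case 0
  then show ?case by simp
next
  case (Suc k)
  interpret primeideal "PIdl \<pi>" R
    by (rule maximalideal_prime[OF uniformizer_maximal])
  have "c \<otimes> x \<in> PIdl \<pi>"
    using pi_ideal_mono[OF Suc.prems(2), of 1] by simp
  then have "x \<in> PIdl \<pi>"
    using I_prime assms(1,2) Suc.prems(1) by blast
  then obtain y where y: "y \<in> carrier R" "x = \<pi> [^] (1::nat) \<otimes> y"
    using pi_ideal_iff[of x 1] by auto
  have "\<pi> [^] (1::nat) \<otimes> (c \<otimes> y) \<in> pi_ideal (Suc k)"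
    using Suc.prems(2) y assms(1) by (simp add: m_lcomm)
  then have "c \<otimes> y \<in> pi_ideal k"
    using pi_pow_cancel[of "c \<otimes> y" 1 "Suc k"] y assms(1) by simp
  then have "y \<in> pi_ideal k"
    using Suc.IH y by blast
  then show ?case
    using pi_ideal_mult[OF pi_pow_in_pi_ideal[of 1], of y k] y by simp
qed

text \<open>Several subgroups of \<open>R[[S, Z]]\<close> have this form.  A constant weight \<open>N\<close> gives the multiples of \<open>\<pi>\<^sup>N\<close>; the
  weight \<open>k - size m\<close> gives the \<open>k\<close>-th power of the ideal of definition; the weight that is \<open>M\<close> in
  \<open>S\<close>-degree less than \<open>j\<close> and zero elsewhere gives the multiples of \<open>\<pi>\<^sup>M\<close> up to \<open>S\<close>-degree at least \<open>j\<close>;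
  and \<open>min N (r * sdeg m)\<close> gives the multiples of \<open>\<pi>\<^sup>N\<close> together with the image of \<open>F(S, Z) \<mapsto> F(\<pi>\<^sup>r S, Z)\<close>.\<close>

definition weighted :: "'v set \<Rightarrow> ('v multiset \<Rightarrow> nat) \<Rightarrow> ('v multiset \<Rightarrow> 'a) set" where
  "weighted V e = {F \<in> carrier (power_series R V). \<forall>m. F m \<in> pi_ideal (e m)}"

lemma weighted_carrier: "F \<in> weighted V e \<Longrightarrow> F \<in> carrier (power_series R V)"
  by (simp add: weighted_def)

lemma weighted_mono: "F \<in> weighted V e \<Longrightarrow> (\<And>m. e' m \<le> e m) \<Longrightarrow> F \<in> weighted V e'"
  by (auto simp: weighted_def intro: pi_ideal_mono)

lemma weighted_minus:
  assumes "F \<in> weighted V e" "G \<in> weighted V e"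
  shows "F \<ominus>\<^bsub>power_series R V\<^esub> G \<in> weighted V e"
proof -
  interpret A: cring "power_series R V" by (rule power_series_cring)
  have "x \<ominus> y \<in> pi_ideal k" if "x \<in> pi_ideal k" "y \<in> pi_ideal k" for x y k
  proof -
    interpret ideal "pi_ideal k" R by (rule pi_ideal_ideal)
    show ?thesis using that by (simp add: minus_eq)
  qed
  then show ?thesis
    using assms A.minus_closed[of F G] by (simp add: weighted_def power_series_minus)
qed

lemma weighted_mult:
  assumes "F \<in> carrier (power_series R V)" "G \<in> weighted V e"
    and "\<And>x y c. c \<in> pi_ideal (e y) \<Longrightarrow> F x \<otimes> c \<in> pi_ideal (e (x + y))"
  shows "F \<otimes>\<^bsub>power_series R V\<^esub> G \<in> weighted V e"
proof -
  interpret A: cring "power_series R V" by (rule power_series_cring)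
  have "conv F G m \<in> pi_ideal (e m)" for m
  proof -
    interpret ideal "pi_ideal (e m)" R by (rule pi_ideal_ideal)
    show ?thesis
    proof (rule finsum_mem)
      fix a assume "a \<in> {a. a \<subseteq># m}"
      then have "a + (m - a) = m" by simp
      then show "F a \<otimes> G (m - a) \<in> pi_ideal (e m)"
        using assms(2) assms(3)[of "G (m - a)" "m - a" a] by (simp add: weighted_def)
    qed simp
  qed
  then show ?thesis
    using assms A.m_closed[of F G] by (simp add: weighted_def power_series_mult)
qed

text \<open>An antitone weight imposes less on a multiple of a monomial than on the monomial itself.  The last weight
  listed above is in general not antitone, and gives only a subgroup.\<close>

lemma weighted_ideal:
  assumes "\<And>x y. e (x + y) \<le> e y"
  shows "ideal (weighted V e) (power_series R V)"
proof -
  interpret A: cring "power_series R V" by (rule power_series_cring)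
  have mult: "F \<otimes>\<^bsub>power_series R V\<^esub> G \<in> weighted V e"
    if F: "F \<in> carrier (power_series R V)" and G: "G \<in> weighted V e" for F G
  proof (rule weighted_mult[OF F G])
    fix x y c assume "c \<in> pi_ideal (e y)"
    then have "F x \<otimes> c \<in> pi_ideal (e y)"
      using F ideal.I_l_closed[OF pi_ideal_ideal] power_series_closed by blast
    then show "F x \<otimes> c \<in> pi_ideal (e (x + y))"
      by (rule pi_ideal_mono) (rule assms)
  qed
  show ?thesis
  proof (rule idealI)
    show "subgroup (weighted V e) (add_monoid (power_series R V))"
    proof (rule A.add.subgroupI)
      show "weighted V e \<noteq> {}"
        using A.zero_closed by (auto simp: weighted_def power_series_zero intro!: exI[of _ "\<lambda>m. \<zero>"])
      fix F assume F: "F \<in> weighted V e"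
      have zero: "\<zero>\<^bsub>power_series R V\<^esub> \<in> weighted V e"
        using A.zero_closed by (auto simp: weighted_def power_series_zero)
      show neg: "\<ominus>\<^bsub>power_series R V\<^esub> F \<in> weighted V e"
        using weighted_minus[OF zero F] weighted_carrier[OF F] by (simp add: A.minus_eq)
      fix G assume G: "G \<in> weighted V e"
      have "F = \<ominus>\<^bsub>power_series R V\<^esub> (\<ominus>\<^bsub>power_series R V\<^esub> F)"
        using weighted_carrier[OF F] by simp
      then have "G \<oplus>\<^bsub>power_series R V\<^esub> F \<in> weighted V e"
        using weighted_minus[OF G neg] by (simp add: A.minus_eq)
      then show "F \<oplus>\<^bsub>power_series R V\<^esub> G \<in> weighted V e"
        using weighted_carrier[OF F] weighted_carrier[OF G] by (simp add: A.a_comm)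
    qed (auto dest: weighted_carrier)
    fix F G assume FG: "F \<in> weighted V e" "G \<in> carrier (power_series R V)"
    then show "G \<otimes>\<^bsub>power_series R V\<^esub> F \<in> weighted V e" "F \<otimes>\<^bsub>power_series R V\<^esub> G \<in> weighted V e"
      using mult[of G F] A.m_comm[OF weighted_carrier[OF FG(1)] FG(2)] by auto
  qed (rule A.ring_axioms)
qed

lemma PIdl_base_const_pow:
  "PIdl\<^bsub>power_series R V\<^esub> (indexed_const \<pi> [^]\<^bsub>power_series R V\<^esub> (N::nat)) = weighted V (\<lambda>m. N)"
  by (simp add: indexed_const_pow PIdl_indexed_const weighted_def)

text \<open>Modulo \<open>\<pi>\<close> and the variables \<open>S\<^sub>i\<close>, such an \<open>f\<close> is \<open>Z\<^sup>d\<close> times a unit.\<close>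

definition Z_order :: "(coord multiset \<Rightarrow> 'a) \<Rightarrow> nat \<Rightarrow> bool" where
  "Z_order f d \<longleftrightarrow> f (Zpow d) \<notin> PIdl \<pi> \<and> (\<forall>j<d. f (Zpow j) \<in> PIdl \<pi>)"

text \<open>The condition \<open>a m \<in> pi_ideal (e m)\<close> is proved in the truncated form \<open>pi_ideal (min i (e m))\<close>, by induction on
  \<open>i\<close>, and for fixed \<open>i\<close> by induction on the \<open>S\<close>-degree of \<open>m\<close> and then its \<open>Z\<close>-degree.  The coefficient of
  \<open>f a\<close> at \<open>m Z\<^sup>d\<close> contains the term \<open>f(Z\<^sup>d) a(m)\<close>, whose first factor is prime to \<open>\<pi>\<close>.  In every other
  term \<open>f(x) a(y)\<close>, either \<open>y\<close> precedes \<open>m\<close>, and then the inner induction bounds \<open>a(y)\<close>, a bound that \<open>stable\<close> carries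
  over to the term; or \<open>x = Z\<^sup>j\<close> with
  \<open>j < d\<close>, and then \<open>\<pi>\<close> divides \<open>f(x)\<close> and the outer induction supplies the remaining factors.\<close>

lemma weighted_regular:
  assumes f: "f \<in> carrier (power_series R V)" and a: "a \<in> carrier (power_series R V)"
    and d: "Z_order f d"
    and e: "\<And>m j. e (m + Zpow j) = e m"
    and stable: "\<And>x y c. c \<in> pi_ideal (e y) \<Longrightarrow> f x \<otimes> c \<in> pi_ideal (e (x + y))"
    and fa: "f \<otimes>\<^bsub>power_series R V\<^esub> a \<in> weighted V e"
  shows "a \<in> weighted V e"
proof -
  have [simp]: "f m \<in> carrier R" "a m \<in> carrier R" for m
    using f a by (auto simp: power_series_closed)
  have "a m \<in> pi_ideal (min i (e m))" for i m
  proof (induction i arbitrary: m)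
    case 0
    then show ?case by simp
  next
    case (Suc i)
    show ?case
    proof (induction m rule: wf_induct_rule[OF wf_measures[of "[sdeg, \<lambda>m. count m Z_coord]"]])
      case (1 m)
      show ?case
      proof (cases "e m \<le> i")
        case True
        then show ?thesis
          using Suc.IH[of m] by (simp add: min_def split: if_splits)
      next
        case False
        define M where "M = m + Zpow d"
        have eM: "e M = e m"
          by (simp add: M_def e)
        interpret I: ideal "pi_ideal (Suc i)" R by (rule pi_ideal_ideal)
        have "f x \<otimes> a (M - x) \<in> pi_ideal (Suc i)" if x: "x \<in> {x. x \<subseteq># M} - {Zpow d}" for x
        proof -
          define y where "y = M - x"
          have xy: "x + y = m + Zpow d"
            using x by (simp add: y_def M_def[symmetric])
          have count: "count x Z_coord + count y Z_coord = count m Z_coord + d"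
            using arg_cong[OF xy, of "\<lambda>m. count m Z_coord"] by simp
          have sxy: "filter_mset (\<lambda>v. v \<noteq> Z_coord) x + filter_mset (\<lambda>v. v \<noteq> Z_coord) y = filter_mset (\<lambda>v. v \<noteq> Z_coord) m"
            using arg_cong[OF xy, of "filter_mset (\<lambda>v. v \<noteq> Z_coord)"] by simp
          have sdeg: "sdeg x + sdeg y = sdeg m"
            using arg_cong[OF sxy, of size] by simp
          show ?thesis
          proof (cases "(y, m) \<in> measures [sdeg, \<lambda>m. count m Z_coord]")
            case less: True
            have ay: "a y \<in> pi_ideal (min (Suc i) (e y))"
              by (rule 1) fact
            show ?thesis
            proof (cases "e y \<le> Suc i")
              case True
              then have "f x \<otimes> a y \<in> pi_ideal (e (x + y))"
                using stable ay by (simp add: min_def split: if_splits)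
              moreover have "e (x + y) = e m"
                by (simp add: xy e)
              ultimately have "f x \<otimes> a y \<in> pi_ideal (e m)"
                by metis
              then show ?thesis
                unfolding y_def[symmetric] using \<open>\<not> e m \<le> i\<close> pi_ideal_mono[of _ "e m" "Suc i"] by simp
            next
              case False
              then have "a y \<in> pi_ideal (Suc i)"
                using ay by (simp add: min_def split: if_splits)
              then show ?thesis
                unfolding y_def[symmetric] by (rule I.I_l_closed) simp
            qed
          next
            case False
            then have "sdeg y \<ge> sdeg m" "sdeg y = sdeg m \<Longrightarrow> count y Z_coord \<ge> count m Z_coord"
              by (auto simp: not_less)
            then have *: "sdeg x = 0" "count y Z_coord \<ge> count m Z_coord"
              using sdeg by linarith+
            define j where "j = count x Z_coord"
            have xj: "x = Zpow j"
              using iffD1[OF sdeg_zero_iff *(1)] unfolding j_def .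
            have "j < d"
            proof -
              have "j \<le> d"
                using count *(2) unfolding j_def by linarith
              moreover have "j \<noteq> d"
                using x xj by blast
              ultimately show ?thesis by simp
            qed
            then have "f x \<in> pi_ideal 1"
              using d by (simp add: Z_order_def xj)
            moreover have "y = m + Zpow (d - j)"
            proof -
              have "Zpow d = Zpow j + Zpow (d - j)"
                using \<open>j < d\<close> by (intro multiset_eqI) simp
              then show ?thesis
                using xy unfolding xj by (simp add: add.left_commute)
            qed
            then have "e y = e m"
              by (simp add: e)
            then have "a y \<in> pi_ideal i"
              using Suc.IH[of y] False \<open>\<not> e m \<le> i\<close> by (simp add: min_def split: if_splits)
            ultimately show ?thesis
              using pi_ideal_mult[of "f x" 1 "a y" i] by (simp add: y_def)
          qed
        qed
        then have rest: "finsum R (\<lambda>x. f x \<otimes> a (M - x)) ({x. x \<subseteq># M} - {Zpow d}) \<in> pi_ideal (Suc i)"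
          by (intro I.finsum_mem) auto
        have "conv f a M = f (Zpow d) \<otimes> a (M - Zpow d) \<oplus> finsum R (\<lambda>x. f x \<otimes> a (M - x)) ({x. x \<subseteq># M} - {Zpow d})"
        proof -
          have "{x. x \<subseteq># M} = insert (Zpow d) ({x. x \<subseteq># M} - {Zpow d})"
            by (auto simp: M_def)
          then show ?thesis
            by (subst finsum_insert[symmetric]) (auto simp: insert_absorb)
        qed
        then have "f (Zpow d) \<otimes> a m = conv f a M \<ominus> finsum R (\<lambda>x. f x \<otimes> a (M - x)) ({x. x \<subseteq># M} - {Zpow d})"
          using I.Icarr[OF rest] by (simp add: M_def minus_eq a_assoc r_neg)
        moreover have "conv f a M \<in> pi_ideal (Suc i)"
        proof -
          have "conv f a M \<in> pi_ideal (e m)"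
            using fa unfolding weighted_def power_series_mult eM[symmetric] by blast
          then show ?thesis
            using False pi_ideal_mono[of _ "e m" "Suc i"] by simp
        qed
        ultimately have "f (Zpow d) \<otimes> a m \<in> pi_ideal (Suc i)"
          using rest by (simp only: minus_eq I.a_closed I.a_inv_closed)
        then have "a m \<in> pi_ideal (Suc i)"
          using d pi_ideal_unit_cancel[of "f (Zpow d)" "a m" "Suc i"] by (simp add: Z_order_def)
        then show ?thesis
          using False by (simp add: min_def)
      qed
    qed
  qed
  then have "a m \<in> pi_ideal (min (e m) (e m))" for m
    by blast
  then show ?thesis
    using a by (simp add: weighted_def)
qed


section \<open>Rescaling the coordinates\<close>

lemma weighted_regular_pow:
  assumes f: "f \<in> carrier (power_series R V)" and d: "Z_order f d"
    and e: "\<And>m j. e (m + Zpow j) = e m"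
    and stable: "\<And>x y c. c \<in> pi_ideal (e y) \<Longrightarrow> f x \<otimes> c \<in> pi_ideal (e (x + y))"
    and a: "a \<in> carrier (power_series R V)"
    and fa: "f [^]\<^bsub>power_series R V\<^esub> (k::nat) \<otimes>\<^bsub>power_series R V\<^esub> a \<in> weighted V e"
  shows "a \<in> weighted V e"
proof -
  interpret A: cring "power_series R V" by (rule power_series_cring)
  show ?thesis
    using a fa
  proof (induction k arbitrary: a)
    case (Suc k)
    then have "f [^]\<^bsub>power_series R V\<^esub> k \<otimes>\<^bsub>power_series R V\<^esub> (f \<otimes>\<^bsub>power_series R V\<^esub> a) \<in> weighted V e"
      using f by (simp add: A.m_assoc)
    then have "f \<otimes>\<^bsub>power_series R V\<^esub> a \<in> weighted V e"
      using Suc f by simp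
    then show ?case
      using weighted_regular[OF f Suc.prems(1) d e stable] by blast
  qed simp
qed

lemma antitone_stable:
  assumes "f \<in> carrier (power_series R V)" "\<And>x y. e (x + y) \<le> e y" "c \<in> pi_ideal (e y)"
  shows "f x \<otimes> c \<in> pi_ideal (e (x + y))"
  using assms ideal.I_l_closed[OF pi_ideal_ideal] power_series_closed pi_ideal_mono by metis

text \<open>The substitution of \<open>\<pi>\<^sup>r S\<^sub>i\<close> for \<open>S\<^sub>i\<close>, fixing \<open>Z\<close>.\<close>

definition rescale :: "nat \<Rightarrow> (coord multiset \<Rightarrow> 'a) \<Rightarrow> coord multiset \<Rightarrow> 'a" where
  "rescale r F m = \<pi> [^] (r * sdeg m) \<otimes> F m"

lemma rescale_hom: "rescale r \<in> ring_hom (power_series R V) (power_series R V)"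
proof (rule ring_hom_memI)
  fix F G assume F: "F \<in> carrier (power_series R V)" and G: "G \<in> carrier (power_series R V)"
  have [simp]: "F m \<in> carrier R" "G m \<in> carrier R" for m
    using F G by (auto simp: power_series_closed)
  show "rescale r F \<in> carrier (power_series R V)"
    using F by (auto simp: power_series_carrier rescale_def)
  show "rescale r (F \<oplus>\<^bsub>power_series R V\<^esub> G) = rescale r F \<oplus>\<^bsub>power_series R V\<^esub> rescale r G"
    by (simp add: power_series_add rescale_def r_distr fun_eq_iff)
  show "rescale r (F \<otimes>\<^bsub>power_series R V\<^esub> G) = rescale r F \<otimes>\<^bsub>power_series R V\<^esub> rescale r G"
  proof
    fix m
    have "\<pi> [^] (r * sdeg m) \<otimes> conv F G m =
        finsum R (\<lambda>a. \<pi> [^] (r * sdeg m) \<otimes> (F a \<otimes> G (m - a))) {a. a \<subseteq># m}"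
      by (rule finsum_rdistr) auto
    also have "\<dots> = conv (rescale r F) (rescale r G) m"
    proof (rule finsum_cong')
      fix a assume "a \<in> {a. a \<subseteq># m}"
      then have "filter_mset (\<lambda>v. v \<noteq> Z_coord) a + filter_mset (\<lambda>v. v \<noteq> Z_coord) (m - a) = filter_mset (\<lambda>v. v \<noteq> Z_coord) m"
        by (metis filter_union_mset mem_Collect_eq subset_mset.add_diff_inverse)
      then have "sdeg m = sdeg a + sdeg (m - a)"
        by (metis size_union)
      then have "\<pi> [^] (r * sdeg m) = \<pi> [^] (r * sdeg a) \<otimes> \<pi> [^] (r * sdeg (m - a))"
        by (simp add: nat_pow_mult distrib_left)
      then show "\<pi> [^] (r * sdeg m) \<otimes> (F a \<otimes> G (m - a)) = rescale r F a \<otimes> rescale r G (m - a)"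
        by (simp add: rescale_def m_ac)
    qed (auto simp: rescale_def)
    finally show "rescale r (F \<otimes>\<^bsub>power_series R V\<^esub> G) m = (rescale r F \<otimes>\<^bsub>power_series R V\<^esub> rescale r G) m"
      by (simp add: power_series_mult rescale_def)
  qed
qed (auto simp: power_series_one rescale_def fun_eq_iff)

lemma rescale_Z_order: "f \<in> carrier (power_series R V) \<Longrightarrow> Z_order (rescale r f) d \<longleftrightarrow> Z_order f d"
  by (simp add: Z_order_def rescale_def power_series_closed)

text \<open>The series \<open>\<sigma>(f)\<^sup>k w\<close> differs from \<open>\<sigma>(a)\<close> by a multiple of \<open>\<pi>\<^sup>N\<close>, so it has weight \<open>min N (r * sdeg m)\<close>.
  Multiplication by \<open>\<sigma>(f)\<close> respects this weight, as the coefficient of \<open>\<sigma>(f)\<close> at \<open>x\<close> is divisible by \<open>\<pi>\<close> to the power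
  \<open>r * sdeg x\<close>.  Cancelling \<open>\<sigma>(f)\<^sup>k\<close> shows that \<open>w\<close> has the same weight, which means that \<open>w\<close> is \<open>\<sigma>(b)\<close>
  modulo \<open>\<pi>\<^sup>N\<close>.  Then \<open>\<sigma>(a - b f\<^sup>k)\<close> is divisible by \<open>\<pi>\<^sup>N\<close>, and undoing the rescaling costs the factor \<open>\<pi>\<close> to the
  power \<open>r * sdeg m\<close>.\<close>

lemma rescale_divides:
  assumes f: "f \<in> carrier (power_series R V)" and d: "Z_order f d"
    and a: "a \<in> carrier (power_series R V)" and w: "w \<in> carrier (power_series R V)"
    and aw: "rescale r a \<ominus>\<^bsub>power_series R V\<^esub> w \<otimes>\<^bsub>power_series R V\<^esub> rescale r f [^]\<^bsub>power_series R V\<^esub> (k::nat)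
      \<in> weighted V (\<lambda>m. N)"
  shows "\<exists>b\<in>carrier (power_series R V).
    a \<ominus>\<^bsub>power_series R V\<^esub> b \<otimes>\<^bsub>power_series R V\<^esub> f [^]\<^bsub>power_series R V\<^esub> k \<in> weighted V (\<lambda>m. N - r * sdeg m)"
proof -
  interpret A: cring "power_series R V" by (rule power_series_cring)
  interpret \<sigma>: ring_hom_cring "power_series R V" "power_series R V" "rescale r"
    by (rule ring_hom_cringI) (simp_all add: ring_hom_ringI2 A.ring_axioms A.is_cring rescale_hom)
  let ?e = "\<lambda>m. min N (r * sdeg m)"
  let ?fk = "f [^]\<^bsub>power_series R V\<^esub> k"
  have fk: "rescale r ?fk = rescale r f [^]\<^bsub>power_series R V\<^esub> k"
    using ring_hom_ring.hom_nat_pow[OF ring_hom_ringI2[OF A.ring_axioms A.ring_axioms rescale_hom] f] .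
  have in_pi: "rescale r F m \<in> pi_ideal (r * sdeg m)" if "F \<in> carrier (power_series R V)" for F m
    unfolding rescale_def pi_ideal_iff using power_series_closed[OF that] by blast
  have "rescale r a \<in> weighted V ?e"
    unfolding weighted_def using pi_ideal_mono[OF in_pi[OF a]] a by simp
  moreover have "rescale r a \<ominus>\<^bsub>power_series R V\<^esub> w \<otimes>\<^bsub>power_series R V\<^esub> rescale r ?fk \<in> weighted V ?e"
    using aw unfolding fk by (rule weighted_mono) simp
  ultimately have "rescale r a \<ominus>\<^bsub>power_series R V\<^esub>
      (rescale r a \<ominus>\<^bsub>power_series R V\<^esub> w \<otimes>\<^bsub>power_series R V\<^esub> rescale r ?fk) \<in> weighted V ?e"
    by (rule weighted_minus)
  also have "rescale r a \<ominus>\<^bsub>power_series R V\<^esub>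
      (rescale r a \<ominus>\<^bsub>power_series R V\<^esub> w \<otimes>\<^bsub>power_series R V\<^esub> rescale r ?fk) =
      rescale r f [^]\<^bsub>power_series R V\<^esub> k \<otimes>\<^bsub>power_series R V\<^esub> w"
  proof -
    have "rescale r a \<in> carrier (power_series R V)" "w \<in> carrier (power_series R V)"
        "rescale r ?fk \<in> carrier (power_series R V)"
      using a w f by simp_all
    then show ?thesis
      unfolding fk[symmetric] by algebra
  qed
  finally have *: "rescale r f [^]\<^bsub>power_series R V\<^esub> k \<otimes>\<^bsub>power_series R V\<^esub> w \<in> weighted V ?e" .
  have w_e: "w \<in> weighted V ?e"
  proof (rule weighted_regular_pow[OF _ _ _ _ w *])
    show "Z_order (rescale r f) d"
      using f d by (simp add: rescale_Z_order)
    fix x y c assume "c \<in> pi_ideal (?e y)"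
    then have "rescale r f x \<otimes> c \<in> pi_ideal (r * sdeg x + ?e y)"
      by (rule pi_ideal_mult[OF in_pi[OF f]])
    then show "rescale r f x \<otimes> c \<in> pi_ideal (?e (x + y))"
      by (rule pi_ideal_mono) (simp add: distrib_left)
  qed (use f in simp_all)
  have "\<exists>c\<in>carrier R. w m = \<pi> [^] (r * sdeg m) \<otimes> c" if "r * sdeg m \<le> N" for m
  proof -
    have "w m \<in> pi_ideal (min N (r * sdeg m))"
      using w_e by (simp add: weighted_def)
    moreover have "min N (r * sdeg m) = r * sdeg m"
      using that by simp
    ultimately show ?thesis
      by (simp only: pi_ideal_iff)
  qed
  then obtain c where c: "\<And>m. r * sdeg m \<le> N \<Longrightarrow> c m \<in> carrier R \<and> w m = \<pi> [^] (r * sdeg m) \<otimes> c m"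
    by metis
  \<comment> \<open>Where \<open>r * sdeg m > N\<close>, the coefficient of \<open>w\<close> is already divisible by \<open>\<pi>\<^sup>N\<close>.\<close>
  define b where "b m = (if r * sdeg m \<le> N \<and> w m \<noteq> \<zero> then c m else \<zero>)" for m
  have b: "b \<in> carrier (power_series R V)"
    using c w by (auto simp: power_series_carrier b_def)
  have wb: "w \<ominus>\<^bsub>power_series R V\<^esub> rescale r b \<in> weighted V (\<lambda>m. N)"
  proof -
    have "w m \<ominus> rescale r b m \<in> pi_ideal N" for m
    proof (cases "r * sdeg m \<le> N")
      case True
      then have "w m = rescale r b m"
        using c[OF True] by (auto simp: rescale_def b_def)
      then show ?thesis
        using power_series_closed[OF w, of m] by (simp add: r_neg minus_eq)
    next
      case False
      then have "rescale r b m = \<zero>"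
        by (simp add: rescale_def b_def)
      moreover have "w m \<in> pi_ideal N"
      proof -
        have "w m \<in> pi_ideal (min N (r * sdeg m))"
          using w_e by (simp add: weighted_def)
        moreover have "min N (r * sdeg m) = N"
          using False by simp
        ultimately show ?thesis
          by (simp only:)
      qed
      ultimately show ?thesis
        using power_series_closed[OF w, of m] by (simp add: minus_eq)
    qed
    then show ?thesis
      using w b A.minus_closed[OF w \<sigma>.hom_closed[OF b]] by (simp add: weighted_def power_series_minus)
  qed
  interpret I: ideal "weighted V (\<lambda>m. N)" "power_series R V"
    by (rule weighted_ideal) simp
  have "rescale r (a \<ominus>\<^bsub>power_series R V\<^esub> b \<otimes>\<^bsub>power_series R V\<^esub> ?fk) =
      (rescale r a \<ominus>\<^bsub>power_series R V\<^esub> w \<otimes>\<^bsub>power_series R V\<^esub> rescale r ?fk) \<oplus>\<^bsub>power_series R V\<^esub>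
      (w \<ominus>\<^bsub>power_series R V\<^esub> rescale r b) \<otimes>\<^bsub>power_series R V\<^esub> rescale r ?fk"
  proof -
    have "rescale r a \<in> carrier (power_series R V)" "w \<in> carrier (power_series R V)"
        "rescale r ?fk \<in> carrier (power_series R V)" "rescale r b \<in> carrier (power_series R V)"
      using a w f b by simp_all
    moreover have "rescale r (a \<ominus>\<^bsub>power_series R V\<^esub> b \<otimes>\<^bsub>power_series R V\<^esub> ?fk) =
        rescale r a \<ominus>\<^bsub>power_series R V\<^esub> rescale r b \<otimes>\<^bsub>power_series R V\<^esub> rescale r ?fk"
      using a b f by (simp add: A.minus_eq)
    ultimately show ?thesis
      by (simp only:) algebra
  qed
  also have "\<dots> \<in> weighted V (\<lambda>m. N)"
    using aw wb f unfolding fk by (intro I.a_closed I.I_r_closed) simp_all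
  finally have "rescale r (a \<ominus>\<^bsub>power_series R V\<^esub> b \<otimes>\<^bsub>power_series R V\<^esub> ?fk) \<in> weighted V (\<lambda>m. N)" .
  moreover have "a \<ominus>\<^bsub>power_series R V\<^esub> b \<otimes>\<^bsub>power_series R V\<^esub> ?fk \<in> carrier (power_series R V)"
    using a b f by simp
  ultimately have "a \<ominus>\<^bsub>power_series R V\<^esub> b \<otimes>\<^bsub>power_series R V\<^esub> ?fk \<in> weighted V (\<lambda>m. N - r * sdeg m)"
    unfolding weighted_def rescale_def by (auto intro: pi_pow_cancel power_series_closed)
  then show ?thesis
    using b by blast
qed

text \<open>Multiples of \<open>f\<^sup>k\<close> are \<open>S\<close>-adically closed modulo \<open>\<pi>\<^sup>M\<close>: since \<open>f\<close> can be cancelled to the precision in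
  question, quotients of higher and higher precision form a Cauchy sequence.\<close>

lemma divisible_closed:
  assumes f: "f \<in> carrier (power_series R V)" and d: "Z_order f d" and a: "a \<in> carrier (power_series R V)"
    and approx: "\<And>j. \<exists>b\<in>carrier (power_series R V).
      a \<ominus>\<^bsub>power_series R V\<^esub> b \<otimes>\<^bsub>power_series R V\<^esub> f [^]\<^bsub>power_series R V\<^esub> (k::nat) \<in> weighted V (\<lambda>m. if sdeg m < j then M else 0)"
  shows "\<exists>b\<in>carrier (power_series R V).
      a \<ominus>\<^bsub>power_series R V\<^esub> b \<otimes>\<^bsub>power_series R V\<^esub> f [^]\<^bsub>power_series R V\<^esub> k \<in> weighted V (\<lambda>m. M)"
proof -
  interpret A: cring "power_series R V" by (rule power_series_cring)
  let ?e = "\<lambda>j m. if sdeg m < j then M else 0"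
  let ?fk = "f [^]\<^bsub>power_series R V\<^esub> k"
  have fk: "?fk \<in> carrier (power_series R V)"
    using f by simp
  have anti: "?e j (x + y) \<le> ?e j y" for j x y
    by auto
  have ideal: "ideal (weighted V (?e j)) (power_series R V)" for j
    by (rule weighted_ideal) (rule anti)
  obtain b where b: "\<And>j. b j \<in> carrier (power_series R V)"
      and ab: "\<And>j. a \<ominus>\<^bsub>power_series R V\<^esub> b j \<otimes>\<^bsub>power_series R V\<^esub> ?fk \<in> weighted V (?e j)"
    using approx by metis
  have cauchy: "b i \<ominus>\<^bsub>power_series R V\<^esub> b j \<in> weighted V (?e j)" if "j \<le> i" for i j
  proof (rule weighted_regular_pow[OF f d])
    show "f x \<otimes> c \<in> pi_ideal (?e j (x + y))" if "c \<in> pi_ideal (?e j y)" for x y c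
      using f anti that by (rule antitone_stable)
    have "a \<ominus>\<^bsub>power_series R V\<^esub> b i \<otimes>\<^bsub>power_series R V\<^esub> ?fk \<in> weighted V (?e j)"
      by (rule weighted_mono[OF ab[of i]]) (use that in auto)
    from weighted_minus[OF ab[of j] this]
    show "?fk \<otimes>\<^bsub>power_series R V\<^esub> (b i \<ominus>\<^bsub>power_series R V\<^esub> b j) \<in> weighted V (?e j)"
    proof (rule back_subst[of "\<lambda>x. x \<in> weighted V (?e j)"])
      show "a \<ominus>\<^bsub>power_series R V\<^esub> b j \<otimes>\<^bsub>power_series R V\<^esub> ?fk \<ominus>\<^bsub>power_series R V\<^esub>
          (a \<ominus>\<^bsub>power_series R V\<^esub> b i \<otimes>\<^bsub>power_series R V\<^esub> ?fk) =
          ?fk \<otimes>\<^bsub>power_series R V\<^esub> (b i \<ominus>\<^bsub>power_series R V\<^esub> b j)"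
        using a b[of i] b[of j] fk by algebra
    qed
  qed (use b in simp_all)
  \<comment> \<open>The limit: the coefficients of \<open>b j\<close> at \<open>m\<close> agree modulo \<open>\<pi>\<^sup>M\<close> once \<open>j\<close> exceeds the \<open>S\<close>-degree of \<open>m\<close>.\<close>
  define B where "B m = b (Suc (sdeg m)) m" for m
  have B: "B \<in> carrier (power_series R V)"
    using b by (auto simp: B_def power_series_carrier)
  have bB: "b j \<ominus>\<^bsub>power_series R V\<^esub> B \<in> weighted V (?e j)" for j
  proof -
    have "b j m \<ominus> B m \<in> pi_ideal (?e j m)" for m
    proof (cases "sdeg m < j")
      case True
      then have "b j \<ominus>\<^bsub>power_series R V\<^esub> b (Suc (sdeg m)) \<in> weighted V (?e (Suc (sdeg m)))"
        by (intro cauchy) simp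
      then show ?thesis
        using True b by (auto simp: weighted_def power_series_minus B_def dest!: spec[of _ m])
    qed (use b B in \<open>auto simp: power_series_carrier\<close>)
    then show ?thesis
      using b[of j] B A.minus_closed[OF b[of j] B] by (simp add: weighted_def power_series_minus)
  qed
  have "a \<ominus>\<^bsub>power_series R V\<^esub> B \<otimes>\<^bsub>power_series R V\<^esub> ?fk \<in> weighted V (?e j)" for j
  proof -
    interpret I: ideal "weighted V (?e j)" "power_series R V" by (rule ideal)
    have "a \<ominus>\<^bsub>power_series R V\<^esub> B \<otimes>\<^bsub>power_series R V\<^esub> ?fk =
        (a \<ominus>\<^bsub>power_series R V\<^esub> b j \<otimes>\<^bsub>power_series R V\<^esub> ?fk) \<oplus>\<^bsub>power_series R V\<^esub>
        (b j \<ominus>\<^bsub>power_series R V\<^esub> B) \<otimes>\<^bsub>power_series R V\<^esub> ?fk"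
      using a b[of j] B fk by algebra
    also have "\<dots> \<in> weighted V (?e j)"
      using ab[of j] bB[of j] fk by (intro I.a_closed I.I_r_closed)
    finally show ?thesis .
  qed
  then have "(a \<ominus>\<^bsub>power_series R V\<^esub> B \<otimes>\<^bsub>power_series R V\<^esub> ?fk) m \<in> pi_ideal M" for m
    by (auto simp: weighted_def dest!: spec[of _ m] meta_spec[of _ "Suc (sdeg m)"])
  then have "a \<ominus>\<^bsub>power_series R V\<^esub> B \<otimes>\<^bsub>power_series R V\<^esub> ?fk \<in> weighted V (\<lambda>m. M)"
    using a B fk by (simp add: weighted_def)
  then show ?thesis
    using B by blast
qed

text \<open>Let \<open>F\<close> and \<open>G\<close> be the powers of \<open>f\<close> belonging to \<open>M\<close> and to a large \<open>N\<close>.  If \<open>a\<^sub>N\<close> is \<open>b G\<close> up to the errors of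
  \<open>rescale_divides\<close>, then \<open>G a\<^sub>M = F a\<^sub>N\<close> is \<open>F G b\<close> up to these errors and a multiple of \<open>\<pi>\<^sup>M\<close>.  Cancelling \<open>G\<close>
  leaves \<open>a\<^sub>M = F b\<close> to the precision that \<open>divisible_closed\<close> asks for.\<close>

lemma glue_over_rescaling:
  assumes f: "f \<in> carrier (power_series R V)" and d: "Z_order f d"
    and a: "\<And>N. a N \<in> carrier (power_series R V)"
    and compat: "\<And>M N. M \<le> N \<Longrightarrow> a N \<otimes>\<^bsub>power_series R V\<^esub> f [^]\<^bsub>power_series R V\<^esub> (k M :: nat) \<ominus>\<^bsub>power_series R V\<^esub>
      a M \<otimes>\<^bsub>power_series R V\<^esub> f [^]\<^bsub>power_series R V\<^esub> k N \<in> weighted V (\<lambda>m. M)"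
    and div: "\<And>N. \<exists>w\<in>carrier (power_series R V). rescale r (a N) \<ominus>\<^bsub>power_series R V\<^esub>
      w \<otimes>\<^bsub>power_series R V\<^esub> rescale r f [^]\<^bsub>power_series R V\<^esub> k N \<in> weighted V (\<lambda>m. N)"
  shows "\<exists>c\<in>carrier (power_series R V).
      a M \<ominus>\<^bsub>power_series R V\<^esub> c \<otimes>\<^bsub>power_series R V\<^esub> f [^]\<^bsub>power_series R V\<^esub> k M \<in> weighted V (\<lambda>m. M)"
proof (rule divisible_closed[OF f d a])
  interpret A: cring "power_series R V" by (rule power_series_cring)
  fix j
  let ?e = "\<lambda>m. if sdeg m < j then M else 0"
  \<comment> \<open>This makes \<open>N - r * sdeg m\<close> at least \<open>M\<close> in \<open>S\<close>-degree less than \<open>j\<close>.\<close>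
  define N where "N = M + r * j"
  let ?F = "f [^]\<^bsub>power_series R V\<^esub> k M" and ?G = "f [^]\<^bsub>power_series R V\<^esub> k N"
  have anti: "?e (x + y) \<le> ?e y" for x y
    by auto
  interpret I: ideal "weighted V ?e" "power_series R V"
    by (rule weighted_ideal) (rule anti)
  have F: "?F \<in> carrier (power_series R V)" and G: "?G \<in> carrier (power_series R V)"
    using f by simp_all
  obtain b where b: "b \<in> carrier (power_series R V)"
      and ab: "a N \<ominus>\<^bsub>power_series R V\<^esub> b \<otimes>\<^bsub>power_series R V\<^esub> ?G \<in> weighted V (\<lambda>m. N - r * sdeg m)"
    using div[of N] rescale_divides[OF f d a[of N]] by blast
  have ab': "a N \<ominus>\<^bsub>power_series R V\<^esub> b \<otimes>\<^bsub>power_series R V\<^esub> ?G \<in> weighted V ?e"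
  proof (rule weighted_mono[OF ab])
    show "?e m \<le> N - r * sdeg m" for m
    proof (cases "sdeg m < j")
      case True
      then have "r * sdeg m \<le> r * j"
        by (intro mult_le_mono2) simp
      then have "M \<le> N - r * sdeg m"
        unfolding N_def by linarith
      then show ?thesis
        using True by simp
    qed simp
  qed
  have c': "a N \<otimes>\<^bsub>power_series R V\<^esub> ?F \<ominus>\<^bsub>power_series R V\<^esub> a M \<otimes>\<^bsub>power_series R V\<^esub> ?G \<in> weighted V ?e"
    by (rule weighted_mono[OF compat]) (simp_all add: N_def)
  have "?G \<otimes>\<^bsub>power_series R V\<^esub> (a M \<ominus>\<^bsub>power_series R V\<^esub> b \<otimes>\<^bsub>power_series R V\<^esub> ?F) =
      ?F \<otimes>\<^bsub>power_series R V\<^esub> (a N \<ominus>\<^bsub>power_series R V\<^esub> b \<otimes>\<^bsub>power_series R V\<^esub> ?G) \<ominus>\<^bsub>power_series R V\<^esub>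
      (a N \<otimes>\<^bsub>power_series R V\<^esub> ?F \<ominus>\<^bsub>power_series R V\<^esub> a M \<otimes>\<^bsub>power_series R V\<^esub> ?G)"
    using a[of M] a[of N] b F G by algebra
  also have "\<dots> \<in> weighted V ?e"
    by (intro weighted_minus I.I_l_closed ab' c' F)
  finally have "?G \<otimes>\<^bsub>power_series R V\<^esub> (a M \<ominus>\<^bsub>power_series R V\<^esub> b \<otimes>\<^bsub>power_series R V\<^esub> ?F) \<in> weighted V ?e" .
  then have "a M \<ominus>\<^bsub>power_series R V\<^esub> b \<otimes>\<^bsub>power_series R V\<^esub> ?F \<in> weighted V ?e"
    by (rule weighted_regular_pow[OF f d, rotated -1]) (use antitone_stable[OF f anti] a b F in simp_all)
  then show "\<exists>b\<in>carrier (power_series R V).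
      a M \<ominus>\<^bsub>power_series R V\<^esub> b \<otimes>\<^bsub>power_series R V\<^esub> ?F \<in> weighted V ?e"
    using b by blast
qed

end

section \<open>Restricted power series\<close>

context cring
begin

lemma ideal_pow_ideal:
  assumes "ideal I R"
  shows "ideal (ideal_pow R I k) R"
proof -
  interpret IS: comm_monoid "ideals_set R" by (rule ideals_set_is_comm_monoid)
  have "I \<in> carrier (ideals_set R)"
    using assms by (simp add: ideals_set_def)
  then have "ideal_pow R I k \<in> carrier (ideals_set R)"
    by (rule IS.nat_pow_closed)
  then show ?thesis
    by (simp add: ideals_set_def)
qed

lemma ideal_pow_Suc: "ideal_pow R I (Suc k) = ideal_pow R I k \<cdot> I"
  by simp (simp add: ideals_set_def)

lemma ideal_pow_0: "ideal_pow R I 0 = carrier R"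
  by (simp add: ideals_set_def)

lemma restricted_series_carrier:
  "F \<in> carrier (restricted_series R I V) \<longleftrightarrow>
    F \<in> carrier (power_series R V) \<and> (\<forall>k. finite {m. F m \<notin> ideal_pow R I k})"
  by (simp add: restricted_series_def)

lemma restricted_series_simps:
  shows "F \<otimes>\<^bsub>restricted_series R I V\<^esub> G = F \<otimes>\<^bsub>power_series R V\<^esub> G"
    and "F \<oplus>\<^bsub>restricted_series R I V\<^esub> G = F \<oplus>\<^bsub>power_series R V\<^esub> G"
    and "\<zero>\<^bsub>restricted_series R I V\<^esub> = \<zero>\<^bsub>power_series R V\<^esub>"
    and "\<one>\<^bsub>restricted_series R I V\<^esub> = \<one>\<^bsub>power_series R V\<^esub>"
  by (simp_all add: restricted_series_def)

text \<open>Closure under multiplication: a term \<open>F a \<otimes> G b\<close> lies outside the ideal \<open>I\<^sup>k\<close> only if both factors do, so a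
  coefficient of the product outside \<open>I\<^sup>k\<close> has one of finitely many indices \<open>a + b\<close>.\<close>

lemma restricted_series_cring:
  assumes I: "ideal I R"
  shows "cring (restricted_series R I V)"
proof -
  interpret P: cring "power_series R V" by (rule power_series_cring)
  let ?H = "carrier (restricted_series R I V)"
  have sub: "?H \<subseteq> carrier (power_series R V)"
    by (auto simp: restricted_series_carrier)
  have "subring ?H (power_series R V)"
  proof (rule P.subringI[OF sub])
    have zero: "\<zero> \<in> ideal_pow R I k" for k
      using additive_subgroup.zero_closed[OF ideal.axioms(1)[OF ideal_pow_ideal[OF I]]] .
    have "finite {m. \<one>\<^bsub>power_series R V\<^esub> m \<notin> ideal_pow R I k}" for k
      by (rule finite_subset[of _ "{{#}}"]) (auto simp: power_series_one zero)
    then show "\<one>\<^bsub>power_series R V\<^esub> \<in> ?H"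
      by (simp add: restricted_series_carrier)
  next
    fix F assume F: "F \<in> ?H"
    then have FP: "F \<in> carrier (power_series R V)"
      by (simp add: restricted_series_carrier)
    have "\<ominus>\<^bsub>power_series R V\<^esub> F = \<zero>\<^bsub>power_series R V\<^esub> \<ominus>\<^bsub>power_series R V\<^esub> F"
      using FP by (simp add: P.minus_eq)
    also have "\<dots> = (\<lambda>m. \<ominus> F m)"
      using power_series_closed[OF FP]
      by (subst power_series_minus[OF P.zero_closed FP]) (simp add: power_series_zero minus_eq)
    finally have *: "\<ominus>\<^bsub>power_series R V\<^esub> F = (\<lambda>m. \<ominus> F m)" .
    have "finite {m. \<ominus> F m \<notin> ideal_pow R I k}" for k
    proof -
      interpret J: ideal "ideal_pow R I k" R by (rule ideal_pow_ideal[OF I])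
      have "{m. \<ominus> F m \<notin> ideal_pow R I k} \<subseteq> {m. F m \<notin> ideal_pow R I k}"
        by auto
      then show ?thesis
        using F finite_subset by (auto simp: restricted_series_carrier)
    qed
    then show "\<ominus>\<^bsub>power_series R V\<^esub> F \<in> ?H"
      using F P.a_inv_closed[of F] by (simp add: restricted_series_carrier *)
  next
    fix F G assume FG: "F \<in> ?H" "G \<in> ?H"
    have "finite {m. F m \<oplus> G m \<notin> ideal_pow R I k}" for k
    proof -
      interpret J: ideal "ideal_pow R I k" R by (rule ideal_pow_ideal[OF I])
      have "{m. F m \<oplus> G m \<notin> ideal_pow R I k} \<subseteq> {m. F m \<notin> ideal_pow R I k} \<union> {m. G m \<notin> ideal_pow R I k}"
        by auto
      then show ?thesis
        by (rule finite_subset) (use FG in \<open>auto simp: restricted_series_carrier\<close>)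
    qed
    then show "F \<oplus>\<^bsub>power_series R V\<^esub> G \<in> ?H"
      using FG P.a_closed[of F G] by (simp add: restricted_series_carrier power_series_add)
    have "finite {m. conv F G m \<notin> ideal_pow R I k}" for k
    proof -
      interpret J: ideal "ideal_pow R I k" R by (rule ideal_pow_ideal[OF I])
      let ?S = "\<lambda>F. {m. F m \<notin> ideal_pow R I k}"
      have [simp]: "F m \<in> carrier R" "G m \<in> carrier R" for m
        using FG by (auto simp: restricted_series_carrier power_series_closed)
      have "?S (conv F G) \<subseteq> (\<lambda>(a, b). a + b) ` (?S F \<times> ?S G)"
      proof
        fix m assume "m \<in> ?S (conv F G)"
        then have "\<not> (\<forall>a\<in>{a. a \<subseteq># m}. F a \<otimes> G (m - a) \<in> ideal_pow R I k)"
          using J.finsum_mem[of "{a. a \<subseteq># m}" "\<lambda>a. F a \<otimes> G (m - a)"] by auto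
        then obtain a where a: "a \<subseteq># m" "F a \<otimes> G (m - a) \<notin> ideal_pow R I k"
          by auto
        then have "(a, m - a) \<in> ?S F \<times> ?S G"
          using J.I_l_closed J.I_r_closed by auto
        then show "m \<in> (\<lambda>(a, b). a + b) ` (?S F \<times> ?S G)"
          using a(1) by (intro image_eqI[of _ _ "(a, m - a)"]) auto
      qed
      then show ?thesis
        by (rule finite_subset) (use FG in \<open>auto simp: restricted_series_carrier\<close>)
    qed
    then show "F \<otimes>\<^bsub>power_series R V\<^esub> G \<in> ?H"
      using FG P.m_closed[of F G] by (simp add: restricted_series_carrier power_series_mult)
  qed
  then have "subcring ?H (power_series R V)"
    by (rule P.subcringI')
  then have "cring ((power_series R V) \<lparr> carrier := ?H \<rparr>)"
    using P.subcring_iff[OF sub] by simp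
  then show ?thesis
    by (simp add: restricted_series_def)
qed

end

section \<open>The adic topology of the base ring\<close>

context complete_dvr
begin

lemma base_ideal_ideal: "ideal (base_ideal R \<pi> n) (base_ring R n)"
proof -
  interpret A: cring "base_ring R n" by (rule power_series_cring)
  show ?thesis
    unfolding base_ideal_def
    by (rule A.genideal_ideal) (auto intro: indexed_const_carrier indexed_var_carrier)
qed

lemma base_ideal_gens:
  shows "indexed_const \<pi> \<in> base_ideal R \<pi> n"
    and "v \<in> coords n \<Longrightarrow> indexed_var v \<in> base_ideal R \<pi> n"
proof -
  interpret A: cring "base_ring R n" by (rule power_series_cring)
  have "insert (indexed_const \<pi>) (indexed_var ` coords n) \<subseteq> base_ideal R \<pi> n"
    unfolding base_ideal_def
    by (rule A.genideal_self) (auto intro: indexed_const_carrier indexed_var_carrier)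
  then show "indexed_const \<pi> \<in> base_ideal R \<pi> n"
    and "v \<in> coords n \<Longrightarrow> indexed_var v \<in> base_ideal R \<pi> n"
    by auto
qed

lemma finite_coords: "finite (coords n)"
  by (simp add: coords_def)

lemma weighted_size_ideal: "ideal (weighted V (\<lambda>m. k - size m)) (power_series R V)"
  by (rule weighted_ideal) simp

lemma base_ideal_weighted: "base_ideal R \<pi> n \<subseteq> weighted (coords n) (\<lambda>m. 1 - size m)"
proof -
  interpret A: cring "base_ring R n" by (rule power_series_cring)
  have "indexed_const \<pi> \<in> weighted (coords n) (\<lambda>m. 1 - size m)"
    using pi_pow_in_pi_ideal[of 1] indexed_const_carrier[OF pi_closed, of "coords n"]
    by (auto simp: weighted_def indexed_const_def)
  moreover have "indexed_var v \<in> weighted (coords n) (\<lambda>m. 1 - size m)" if "v \<in> coords n" for v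
    using indexed_var_carrier[OF that] by (auto simp: weighted_def indexed_var_eq)
  ultimately show ?thesis
    unfolding base_ideal_def by (intro A.genideal_minimal weighted_size_ideal) auto
qed

lemma ideal_pow_base_ideal_subset:
  "ideal_pow (base_ring R n) (base_ideal R \<pi> n) k \<subseteq> weighted (coords n) (\<lambda>m. k - size m)"
proof (induction k)
  interpret A: cring "base_ring R n" by (rule power_series_cring)
  case 0
  show ?case
    unfolding A.ideal_pow_0 by (auto simp: weighted_def power_series_closed)
next
  interpret A: cring "base_ring R n" by (rule power_series_cring)
  case (Suc k)
  interpret W: ideal "weighted (coords n) (\<lambda>m. Suc k - size m)" "base_ring R n"
    by (rule weighted_size_ideal)
  show ?case
  proof
    fix F assume "F \<in> ideal_pow (base_ring R n) (base_ideal R \<pi> n) (Suc k)"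
    then have "F \<in> ideal_prod (base_ring R n) (ideal_pow (base_ring R n) (base_ideal R \<pi> n) k) (base_ideal R \<pi> n)"
      by (simp only: A.ideal_pow_Suc)
    then show "F \<in> weighted (coords n) (\<lambda>m. Suc k - size m)"
    proof (induction rule: ideal_prod.induct)
      case (prod F G)
      then have F: "F \<in> weighted (coords n) (\<lambda>m. k - size m)" and G: "G \<in> weighted (coords n) (\<lambda>m. 1 - size m)"
        using Suc.IH base_ideal_weighted by auto
      have "conv F G m \<in> pi_ideal (Suc k - size m)" for m
      proof -
        interpret ideal "pi_ideal (Suc k - size m)" R by (rule pi_ideal_ideal)
        show ?thesis
        proof (rule finsum_mem)
          fix a assume "a \<in> {a. a \<subseteq># m}"
          then have "a + (m - a) = m"
            by simp
          from arg_cong[OF this, of size] have m: "size a + size (m - a) = size m"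
            unfolding size_union .
          have "F a \<in> pi_ideal (k - size a)" "G (m - a) \<in> pi_ideal (1 - size (m - a))"
            using F G unfolding weighted_def by blast+
          from pi_ideal_mult[OF this]
          show "F a \<otimes> G (m - a) \<in> pi_ideal (Suc k - size m)"
            by (rule pi_ideal_mono) (use m in linarith)
        qed simp
      qed
      then have "(F \<otimes>\<^bsub>base_ring R n\<^esub> G) m \<in> pi_ideal (Suc k - size m)" for m
        unfolding power_series_mult .
      then show ?case
        using A.m_closed[OF weighted_carrier[OF F] weighted_carrier[OF G]]
        unfolding weighted_def by blast
    next
      case (sum F G)
      then show ?case by (intro W.a_closed)
    qed
  qed
qed

text \<open>A series of weight \<open>k + 1 - size m\<close> is stripped of its variables one at a time: the terms
  containing \<open>v\<close> form \<open>v\<close> times a series of weight \<open>k - size m\<close>.  The constant term that remains is divisible by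
  \<open>\<pi>\<^sup>k\<^sup>+\<^sup>1\<close>.\<close>

lemma weighted_subset_ideal_pow_base_ideal:
  "weighted (coords n) (\<lambda>m. k - size m) \<subseteq> ideal_pow (base_ring R n) (base_ideal R \<pi> n) k"
proof (induction k)
  interpret A: cring "base_ring R n" by (rule power_series_cring)
  case 0
  show ?case
    unfolding A.ideal_pow_0 by (auto simp: weighted_carrier)
next
  interpret A: cring "base_ring R n" by (rule power_series_cring)
  case (Suc k)
  let ?J = "ideal_pow (base_ring R n) (base_ideal R \<pi> n) (Suc k)"
  interpret J: ideal ?J "base_ring R n"
    by (rule A.ideal_pow_ideal[OF base_ideal_ideal])
  have prod: "F \<otimes>\<^bsub>base_ring R n\<^esub> G \<in> ?J"
    if F: "F \<in> base_ideal R \<pi> n" and G: "G \<in> weighted (coords n) (\<lambda>m. k - size m)" for F G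
  proof -
    have "G \<otimes>\<^bsub>base_ring R n\<^esub> F \<in> ?J"
      unfolding A.ideal_pow_Suc using F G Suc.IH by (intro ideal_prod.prod) auto
    then show ?thesis
      using A.m_comm[of F G] weighted_carrier[OF G] ideal.Icarr[OF base_ideal_ideal F] by simp
  qed
  have "F \<in> ?J"
    if "finite D" "D \<subseteq> coords n" "F \<in> weighted (coords n) (\<lambda>m. Suc k - size m)"
      "\<And>m. \<not> set_mset m \<subseteq> D \<Longrightarrow> F m = \<zero>" for D F
    using that
  proof (induction D arbitrary: F rule: finite_induct)
    case empty
    have "F {#} \<in> pi_ideal (Suc k)"
      using empty.prems(2) by (auto simp: weighted_def dest: spec[of _ "{#}"])
    then obtain c where c: "c \<in> carrier R" "F {#} = \<pi> [^] Suc k \<otimes> c"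
      unfolding pi_ideal_iff by blast
    have "\<pi> [^] k \<otimes> c \<in> pi_ideal k"
      using c(1) unfolding pi_ideal_iff by blast
    then have "indexed_const (\<pi> [^] k \<otimes> c) \<in> weighted (coords n) (\<lambda>m. k - size m)"
      using c(1) indexed_const_carrier[of "\<pi> [^] k \<otimes> c" "coords n"]
      by (simp add: weighted_def indexed_const_def)
    from prod[OF base_ideal_gens(1) this]
    have "indexed_const \<pi> \<otimes>\<^bsub>base_ring R n\<^esub> indexed_const (\<pi> [^] k \<otimes> c) \<in> ?J" .
    also have "indexed_const \<pi> \<otimes>\<^bsub>base_ring R n\<^esub> indexed_const (\<pi> [^] k \<otimes> c) = F"
    proof -
      have "indexed_const \<pi> \<otimes>\<^bsub>base_ring R n\<^esub> indexed_const (\<pi> [^] k \<otimes> c) =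
          (\<lambda>m. \<pi> \<otimes> indexed_const (\<pi> [^] k \<otimes> c) m)"
        using c(1) by (intro indexed_const_mult indexed_const_carrier) auto
      also have "\<dots> = F"
        using c(1) empty.prems(3) by (auto simp: indexed_const_def c(2) m_ac fun_eq_iff)
      finally show ?thesis .
    qed
    finally show ?case .
  next
    case (insert v D)
    define F0 where "F0 m = (if v \<in># m then \<zero> else F m)" for m
    define G where "G m = F (add_mset v m)" for m
    have FW: "F m \<in> pi_ideal (Suc k - size m)" for m
      using insert.prems(2) by (auto simp: weighted_def)
    have F: "F \<in> carrier (base_ring R n)"
      using insert.prems(2) by (rule weighted_carrier)
    have F0: "F0 \<in> weighted (coords n) (\<lambda>m. Suc k - size m)"
      using FW F by (auto simp: weighted_def F0_def power_series_carrier)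
    have G: "G \<in> weighted (coords n) (\<lambda>m. k - size m)"
      using FW[of "add_mset v _"] F by (auto simp: weighted_def G_def power_series_carrier)
    have "F0 \<in> ?J"
      using insert.prems by (intro insert.IH F0) (auto simp: F0_def)
    moreover have "indexed_var v \<otimes>\<^bsub>base_ring R n\<^esub> G \<in> ?J"
      using insert.prems(1) G by (intro prod base_ideal_gens) auto
    moreover have "F = F0 \<oplus>\<^bsub>base_ring R n\<^esub> indexed_var v \<otimes>\<^bsub>base_ring R n\<^esub> G"
      using weighted_carrier[OF G] power_series_closed[OF F]
      by (auto simp: power_series_add indexed_var_mult F0_def G_def fun_eq_iff)
    ultimately show ?case
      by (simp only: J.a_closed)
  qed
  from this[OF finite_coords order_refl] show ?case
    by (auto simp: weighted_def power_series_carrier)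
qed

lemma ideal_pow_base_ideal:
  "ideal_pow (base_ring R n) (base_ideal R \<pi> n) k = weighted (coords n) (\<lambda>m. k - size m)"
  using ideal_pow_base_ideal_subset weighted_subset_ideal_pow_base_ideal by blast

end

section \<open>The cover of the blowup chart\<close>

locale blowup_chart = complete_dvr R \<pi> for R (structure) and \<pi> +
  fixes n r :: nat
begin

abbreviation A where "A \<equiv> base_ring R n"
abbreviation B where "B \<equiv> chart_cover R \<pi> n"
abbreviation Tpow where "Tpow \<equiv> power_series A {1..n}"

sublocale A: cring A
  by (rule power_series_cring)

sublocale B: cring B
  unfolding chart_cover_def by (rule A.restricted_series_cring[OF base_ideal_ideal])

lemma cover_carrier:
  "b \<in> carrier B \<longleftrightarrow> b \<in> carrier Tpow \<and> (\<forall>k. finite {t. b t \<notin> weighted (coords n) (\<lambda>m. k - size m)})"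
  unfolding chart_cover_def A.restricted_series_carrier ideal_pow_base_ideal ..

lemma cover_carrier_Tpow: "b \<in> carrier B \<Longrightarrow> b \<in> carrier Tpow"
  by (simp add: cover_carrier)

lemma cover_coeff: "b \<in> carrier B \<Longrightarrow> b t \<in> carrier A"
  using A.power_series_closed[OF cover_carrier_Tpow] .

lemma cover_coeff_coeff: "b \<in> carrier B \<Longrightarrow> b t m \<in> carrier R"
  using power_series_closed[OF cover_coeff] .

lemma cover_simps:
  shows cover_mult: "b \<otimes>\<^bsub>B\<^esub> c = b \<otimes>\<^bsub>Tpow\<^esub> c"
    and cover_add: "b \<oplus>\<^bsub>B\<^esub> c = (\<lambda>t m. b t m \<oplus> c t m)"
    and cover_zero: "\<zero>\<^bsub>B\<^esub> = (\<lambda>t m. \<zero>)"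
    and cover_one: "\<one>\<^bsub>B\<^esub> = \<one>\<^bsub>Tpow\<^esub>"
  unfolding chart_cover_def A.restricted_series_simps A.power_series_add A.power_series_zero power_series_add power_series_zero
  by simp_all

lemma base_zero_apply [simp]: "\<zero>\<^bsub>A\<^esub> m = \<zero>"
  by (simp add: power_series_zero)

lemma weighted_zero: "\<zero>\<^bsub>A\<^esub> \<in> weighted (coords n) e"
  using A.zero_closed by (simp add: weighted_def power_series_zero)

lemma cover_const_carrier: "a \<in> carrier A \<Longrightarrow> cover_const R n a \<in> carrier B"
  unfolding cover_carrier
proof (intro conjI allI)
  assume a: "a \<in> carrier A"
  show "cover_const R n a \<in> carrier Tpow"
    using a by (rule A.indexed_const_carrier)
  show "finite {t. cover_const R n a t \<notin> weighted (coords n) (\<lambda>m. k - size m)}" for k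
    by (rule finite_subset[of _ "{{#}}"]) (auto simp: A.indexed_const_def weighted_zero)
qed

lemma cover_const_mult:
  assumes "a \<in> carrier A" "b \<in> carrier B"
  shows "cover_const R n a \<otimes>\<^bsub>B\<^esub> b = (\<lambda>t. a \<otimes>\<^bsub>A\<^esub> b t)"
  unfolding cover_mult by (rule A.indexed_const_mult[OF assms(1) cover_carrier_Tpow[OF assms(2)]])

lemma cover_const_hom: "cover_const R n \<in> ring_hom A B"
proof (rule ring_hom_memI)
  fix a c assume ac: "a \<in> carrier A" "c \<in> carrier A"
  show "cover_const R n a \<in> carrier B"
    using ac by (simp add: cover_const_carrier)
  show "cover_const R n (a \<otimes>\<^bsub>A\<^esub> c) = cover_const R n a \<otimes>\<^bsub>B\<^esub> cover_const R n c"
    using ac by (simp add: cover_const_mult cover_const_carrier) (auto simp: A.indexed_const_def)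
  show "cover_const R n (a \<oplus>\<^bsub>A\<^esub> c) = cover_const R n a \<oplus>\<^bsub>B\<^esub> cover_const R n c"
    by (auto simp: cover_add A.indexed_const_def power_series_add power_series_zero fun_eq_iff)
next
  show "cover_const R n \<one>\<^bsub>A\<^esub> = \<one>\<^bsub>B\<^esub>"
    unfolding cover_one A.power_series_one A.indexed_const_def ..
qed

abbreviation T where "T \<equiv> ring.indexed_var A"

lemma T_carrier: "i \<in> {1..n} \<Longrightarrow> T i \<in> carrier B"
  unfolding cover_carrier
proof (intro conjI allI)
  assume i: "i \<in> {1..n}"
  show "T i \<in> carrier Tpow"
    using i by (rule A.indexed_var_carrier)
  show "finite {t. T i t \<notin> weighted (coords n) (\<lambda>m. k - size m)}" for k
    by (rule finite_subset[of _ "{{#i#}}"]) (auto simp: A.indexed_var_eq weighted_zero)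
qed

lemma T_mult:
  assumes "b \<in> carrier B"
  shows "T i \<otimes>\<^bsub>B\<^esub> b = (\<lambda>t. if i \<in># t then b (t - {#i#}) else \<zero>\<^bsub>A\<^esub>)"
  unfolding cover_mult by (rule A.indexed_var_mult[OF cover_carrier_Tpow[OF assms]])

section \<open>Evaluation on the chart\<close>

abbreviation scl where "scl \<equiv> rescale (Suc r)"

sublocale scl: ring_hom_cring A A scl
  by (rule ring_hom_cringI) (simp_all add: ring_hom_ringI2 A.ring_axioms A.is_cring rescale_hom)

text \<open>The index of the monomial in \<open>T\<close> that corresponds to a monomial in \<open>S\<close>.  The value at \<open>Z_coord\<close> is a
  placeholder: \<open>idx\<close> is applied to monomials without \<open>Z\<close> only.\<close>

definition idx :: "coord multiset \<Rightarrow> nat multiset" where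
  "idx = image_mset (\<lambda>v. case v of S_coord i \<Rightarrow> i | Z_coord \<Rightarrow> 0)"

text \<open>Substituting \<open>S\<^sub>i\<close> for \<open>T\<^sub>i\<close> and \<open>\<pi>\<^sup>r\<^sup>+\<^sup>1 S\<^sub>i\<close> for \<open>S\<^sub>i\<close>, a series \<open>b\<close> becomes \<open>\<Sum>\<^sub>t S\<^sup>t \<sigma>(b\<^sub>t)\<close>.  The monomial \<open>y\<close> in
  \<open>chart_eval\<close> is \<open>S\<^sup>t\<close>.  Every coefficient is a finite sum, as \<open>S\<^sup>t\<close> must divide \<open>m\<close>.\<close>

definition chart_term :: "(nat multiset \<Rightarrow> 'a series) \<Rightarrow> coord multiset \<Rightarrow> 'a series" where
  "chart_term b y z = (if Z_coord \<in># y then \<zero> else scl (b (idx y)) z)"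

definition chart_eval :: "(nat multiset \<Rightarrow> 'a series) \<Rightarrow> 'a series" where
  "chart_eval b m = finsum R (\<lambda>y. chart_term b y (m - y)) {y. y \<subseteq># m}"

lemma chart_term_closed [simp]: "b \<in> carrier B \<Longrightarrow> chart_term b y z \<in> carrier R"
  using power_series_closed[OF scl.hom_closed[OF cover_coeff]] by (simp add: chart_term_def)

lemma chart_eval_closed: "b \<in> carrier B \<Longrightarrow> chart_eval b m \<in> carrier R"
  unfolding chart_eval_def by (auto intro!: finsum_closed)

lemma idx_support:
  assumes "Z_coord \<notin># y" "\<not> set_mset y \<subseteq> coords n"
  shows "\<not> set_mset (idx y) \<subseteq> {1..n}"
proof -
  obtain v where v: "v \<in># y" "v \<notin> coords n"
    using assms(2) by auto
  then obtain i where "v = S_coord i"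
    using assms(1) by (cases v) auto
  then have "i \<in># idx y" "i \<notin> {1..n}"
    using v by (force simp: idx_def coords_def)+
  then show ?thesis
    by blast
qed

lemma chart_eval_carrier: "b \<in> carrier B \<Longrightarrow> chart_eval b \<in> carrier A"
  unfolding power_series_carrier
proof (intro conjI allI impI)
  assume b: "b \<in> carrier B"
  show "chart_eval b m \<in> carrier R" for m
    using b by (rule chart_eval_closed)
  fix m assume m: "\<not> set_mset m \<subseteq> coords n"
  show "chart_eval b m = \<zero>"
    unfolding chart_eval_def
  proof (rule add.finprod_one_eqI)
    fix y assume "y \<in> {y. y \<subseteq># m}"
    then have "set_mset m = set_mset y \<union> set_mset (m - y)"
      by (metis mem_Collect_eq set_mset_union subset_mset.add_diff_inverse)
    then have *: "\<not> set_mset y \<subseteq> coords n \<or> \<not> set_mset (m - y) \<subseteq> coords n"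
      using m by auto
    show "chart_term b y (m - y) = \<zero>"
    proof (cases "Z_coord \<in># y \<or> set_mset y \<subseteq> coords n")
      case True
      have "scl (b (idx y)) \<in> carrier A"
        using b by (intro scl.hom_closed cover_coeff)
      then show ?thesis
        using True * by (auto simp: chart_term_def power_series_carrier)
    next
      case False
      then have "b (idx y) = \<zero>\<^bsub>A\<^esub>"
        using idx_support[of y] cover_carrier_Tpow[OF b] unfolding A.power_series_carrier by blast
      then show ?thesis
        by (simp add: chart_term_def)
    qed
  qed
qed

lemma chart_eval_add:
  assumes b: "b \<in> carrier B" and c: "c \<in> carrier B"
  shows "chart_eval (b \<oplus>\<^bsub>B\<^esub> c) = chart_eval b \<oplus>\<^bsub>A\<^esub> chart_eval c"
proof
  fix m
  have "chart_term (b \<oplus>\<^bsub>B\<^esub> c) y z = chart_term b y z \<oplus> chart_term c y z" for y z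
    using cover_coeff_coeff[OF b] cover_coeff_coeff[OF c]
    by (simp add: chart_term_def cover_add rescale_def r_distr)
  then show "chart_eval (b \<oplus>\<^bsub>B\<^esub> c) m = (chart_eval b \<oplus>\<^bsub>A\<^esub> chart_eval c) m"
    using b c by (simp add: chart_eval_def power_series_add finsum_addf Pi_def)
qed

lemma chart_eval_const_mult:
  assumes a: "a \<in> carrier A" and b: "b \<in> carrier B"
  shows "chart_eval (cover_const R n a \<otimes>\<^bsub>B\<^esub> b) = scl a \<otimes>\<^bsub>A\<^esub> chart_eval b"
proof
  fix m
  let ?h = "\<lambda>y x z. if Z_coord \<in># y then \<zero> else scl a x \<otimes> scl (b (idx y)) z"
  have scl_a [simp]: "scl a x \<in> carrier R" for x
    using power_series_closed[OF scl.hom_closed[OF a]] .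
  have scl_b [simp]: "scl (b t) x \<in> carrier R" for t x
    using power_series_closed[OF scl.hom_closed[OF cover_coeff[OF b]]] .
  have ab: "chart_term (cover_const R n a \<otimes>\<^bsub>B\<^esub> b) y z = finsum R (\<lambda>x. ?h y x (z - x)) {x. x \<subseteq># z}" for y z
  proof (cases "Z_coord \<in># y")
    case False
    have "scl (a \<otimes>\<^bsub>A\<^esub> b (idx y)) = scl a \<otimes>\<^bsub>A\<^esub> scl (b (idx y))"
      using a cover_coeff[OF b] by simp
    then show ?thesis
      using False by (simp add: chart_term_def cover_const_mult[OF a b] power_series_mult)
  qed (simp add: chart_term_def)
  have "chart_eval (cover_const R n a \<otimes>\<^bsub>B\<^esub> b) m =
      finsum R (\<lambda>y. finsum R (\<lambda>x. ?h y x (m - y - x)) {x. x \<subseteq># m - y}) {y. y \<subseteq># m}"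
    unfolding chart_eval_def ab ..
  also have "\<dots> = finsum R (\<lambda>x. finsum R (\<lambda>y. ?h y x (m - x - y)) {y. y \<subseteq># m - x}) {x. x \<subseteq># m}"
    by (rule finsum_triples_swap) simp
  also have "\<dots> = finsum R (\<lambda>x. scl a x \<otimes> chart_eval b (m - x)) {x. x \<subseteq># m}"
  proof (rule finsum_cong')
    fix x
    have "scl a x \<otimes> chart_eval b (m - x) = finsum R (\<lambda>y. scl a x \<otimes> chart_term b y (m - x - y)) {y. y \<subseteq># m - x}"
      unfolding chart_eval_def by (rule finsum_rdistr) (use b in auto)
    also have "\<dots> = finsum R (\<lambda>y. ?h y x (m - x - y)) {y. y \<subseteq># m - x}"
      by (rule finsum_cong') (auto simp: chart_term_def)
    finally show "finsum R (\<lambda>y. ?h y x (m - x - y)) {y. y \<subseteq># m - x} = scl a x \<otimes> chart_eval b (m - x)" ..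
  qed (use b in \<open>auto intro: chart_eval_closed\<close>)
  finally show "chart_eval (cover_const R n a \<otimes>\<^bsub>B\<^esub> b) m = (scl a \<otimes>\<^bsub>A\<^esub> chart_eval b) m"
    by (simp add: power_series_mult)
qed

lemma chart_eval_const:
  assumes a: "a \<in> carrier A"
  shows "chart_eval (cover_const R n a) = scl a"
proof
  fix m
  have scl_a [simp]: "scl a x \<in> carrier R" for x
    using power_series_closed[OF scl.hom_closed[OF a]] .
  have "chart_eval (cover_const R n a) m = finsum R (\<lambda>y. if {#} = y then scl a (m - y) else \<zero>) {y. y \<subseteq># m}"
    unfolding chart_eval_def
    by (rule finsum_cong') (auto simp: chart_term_def A.indexed_const_def idx_def)
  also have "\<dots> = scl a (m - {#})"
    by (rule finsum_singleton) auto
  finally show "chart_eval (cover_const R n a) m = scl a m"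
    by simp
qed

lemma chart_eval_T_mult:
  assumes b: "b \<in> carrier B" and i: "i \<in> {1..n}"
  shows "chart_eval (T i \<otimes>\<^bsub>B\<^esub> b) = indexed_var (S_coord i) \<otimes>\<^bsub>A\<^esub> chart_eval b"
proof
  fix m
  have Tb: "T i \<otimes>\<^bsub>B\<^esub> b \<in> carrier B"
    using b i T_carrier by simp
  have idx_mem: "i \<in># idx y \<longleftrightarrow> S_coord i \<in># y" if "Z_coord \<notin># y" for y
    using that by (force simp: idx_def split: coord.splits)
  have zero: "chart_term (T i \<otimes>\<^bsub>B\<^esub> b) y z = \<zero>" if "S_coord i \<notin># y" for y z
    using that idx_mem[of y] by (simp add: chart_term_def T_mult[OF b])
  have shift: "chart_term (T i \<otimes>\<^bsub>B\<^esub> b) (add_mset (S_coord i) y) z = chart_term b y z" for y z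
    by (simp add: chart_term_def T_mult[OF b] idx_def)
  have "chart_eval (T i \<otimes>\<^bsub>B\<^esub> b) m = (if S_coord i \<in># m then chart_eval b (m - {#S_coord i#}) else \<zero>)"
  proof (cases "S_coord i \<in># m")
    case False
    then have "chart_eval (T i \<otimes>\<^bsub>B\<^esub> b) m = \<zero>"
      unfolding chart_eval_def by (intro add.finprod_one_eqI zero) (auto dest: mset_subset_eqD)
    then show ?thesis
      using False by simp
  next
    case True
    let ?m = "m - {#S_coord i#}"
    have m: "m = add_mset (S_coord i) ?m"
      using True by simp
    let ?Y = "add_mset (S_coord i) ` {y. y \<subseteq># ?m}"
    have Y: "y \<in> ?Y" if "y \<subseteq># m" "S_coord i \<in># y" for y
    proof (rule image_eqI[of _ _ "y - {#S_coord i#}"])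
      show "y = add_mset (S_coord i) (y - {#S_coord i#})"
        using that by simp
      show "y - {#S_coord i#} \<in> {y. y \<subseteq># ?m}"
        using that True by (simp add: subset_eq_diff_conv)
    qed
    have sub: "?Y \<subseteq> {y. y \<subseteq># m}"
    proof (safe)
      fix y assume "y \<subseteq># ?m"
      then have "add_mset (S_coord i) y \<subseteq># add_mset (S_coord i) ?m"
        by simp
      then show "add_mset (S_coord i) y \<subseteq># m"
        using m by simp
    qed
    have "chart_eval (T i \<otimes>\<^bsub>B\<^esub> b) m = finsum R (\<lambda>y. chart_term (T i \<otimes>\<^bsub>B\<^esub> b) y (m - y)) ?Y"
      unfolding chart_eval_def
    proof (rule add.finprod_mono_neutral_cong_right[OF _ sub])
      fix y assume "y \<in> {y. y \<subseteq># m} - ?Y"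
      then have "S_coord i \<notin># y"
        using Y by blast
      then show "chart_term (T i \<otimes>\<^bsub>B\<^esub> b) y (m - y) = \<zero>"
        by (rule zero)
    qed (use Tb in auto)
    also have "\<dots> = finsum R (\<lambda>y. chart_term (T i \<otimes>\<^bsub>B\<^esub> b) (add_mset (S_coord i) y) (m - add_mset (S_coord i) y)) {y. y \<subseteq># ?m}"
      by (rule finsum_reindex) (use Tb in \<open>auto simp: inj_on_def\<close>)
    also have "\<dots> = chart_eval b ?m"
      unfolding chart_eval_def shift by simp
    finally show ?thesis
      using True by simp
  qed
  then show "chart_eval (T i \<otimes>\<^bsub>B\<^esub> b) m = (indexed_var (S_coord i) \<otimes>\<^bsub>A\<^esub> chart_eval b) m"
    by (simp add: indexed_var_mult[OF chart_eval_carrier[OF b]])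
qed

section \<open>The kernel of the evaluation\<close>

lemma chart_eval_minus:
  assumes "b \<in> carrier B" "c \<in> carrier B"
  shows "chart_eval (b \<ominus>\<^bsub>B\<^esub> c) = chart_eval b \<ominus>\<^bsub>A\<^esub> chart_eval c"
proof -
  have "chart_eval b = chart_eval ((b \<ominus>\<^bsub>B\<^esub> c) \<oplus>\<^bsub>B\<^esub> c)"
    using assms by (simp add: B.minus_eq B.a_assoc B.l_neg)
  also have "\<dots> = chart_eval (b \<ominus>\<^bsub>B\<^esub> c) \<oplus>\<^bsub>A\<^esub> chart_eval c"
    using assms by (simp add: chart_eval_add)
  finally show ?thesis
    using assms by (simp add: A.minus_eq A.a_assoc A.r_neg chart_eval_carrier)
qed

lemma chart_eval_zero: "chart_eval \<zero>\<^bsub>B\<^esub> = \<zero>\<^bsub>A\<^esub>"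
  using chart_eval_minus[of "\<zero>\<^bsub>B\<^esub>" "\<zero>\<^bsub>B\<^esub>"] chart_eval_carrier[of "\<zero>\<^bsub>B\<^esub>"]
  by (simp add: B.minus_eq A.minus_eq A.r_neg)

definition const_pi :: "nat \<Rightarrow> 'a series" where
  "const_pi k = base_const R (\<pi> [^] k)"

abbreviation cover_pi where "cover_pi k \<equiv> cover_const R n (const_pi k)"
abbreviation S_var where "S_var i \<equiv> indexed_var (S_coord i)"

lemma const_pi_carrier [simp]: "const_pi k \<in> carrier A"
  unfolding const_pi_def by (rule indexed_const_carrier) simp

lemma cover_pi_carrier [simp]: "cover_pi k \<in> carrier B"
  by (rule cover_const_carrier) simp

lemma S_var_carrier: "i \<in> {1..n} \<Longrightarrow> S_var i \<in> carrier A"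
  by (rule indexed_var_carrier) (simp add: coords_def)

lemma cover_pi_mult: "b \<in> carrier B \<Longrightarrow> cover_pi k \<otimes>\<^bsub>B\<^esub> b = (\<lambda>t m. \<pi> [^] k \<otimes> b t m)"
  by (simp add: cover_const_mult) (simp add: const_pi_def indexed_const_mult cover_coeff)

lemma scl_const_pi: "scl (const_pi k) = const_pi k"
  by (auto simp: const_pi_def rescale_def indexed_const_def fun_eq_iff)

lemma scl_S_var: "scl (S_var i) = const_pi (r + 1) \<otimes>\<^bsub>A\<^esub> S_var i" if "i \<in> {1..n}"
  unfolding const_pi_def by (subst indexed_const_mult[OF _ S_var_carrier[OF that]])
    (auto simp: rescale_def indexed_var_eq fun_eq_iff)

abbreviation relation where
  "relation i \<equiv> (cover_pi (r + 1) \<otimes>\<^bsub>B\<^esub> T i) \<ominus>\<^bsub>B\<^esub> cover_const R n (S_var i)"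

abbreviation Rel where "Rel \<equiv> chart_relations R \<pi> n r"

lemma Rel_eq: "Rel = Idl\<^bsub>B\<^esub> (relation ` {1..n})"
  by (simp only: chart_relations_def Let_def const_pi_def)

lemma relation_carrier: "i \<in> {1..n} \<Longrightarrow> relation i \<in> carrier B"
  by (intro B.minus_closed B.m_closed T_carrier cover_pi_carrier cover_const_carrier S_var_carrier)

lemma Rel_ideal: "ideal Rel B"
  unfolding Rel_eq by (rule B.genideal_ideal) (use relation_carrier in blast)

lemma relation_in_Rel: "i \<in> {1..n} \<Longrightarrow> relation i \<in> Rel"
  unfolding Rel_eq using B.genideal_self[of "relation ` {1..n}"] relation_carrier by blast

text \<open>Both \<open>\<pi>\<^sup>r\<^sup>+\<^sup>1 T\<^sub>i\<close> and \<open>S\<^sub>i\<close> act on values of the evaluation as \<open>\<pi>\<^sup>r\<^sup>+\<^sup>1 S\<^sub>i\<close>.\<close>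

lemma chart_eval_mult_relation:
  assumes i: "i \<in> {1..n}" and c: "c \<in> carrier B"
  shows "chart_eval (c \<otimes>\<^bsub>B\<^esub> relation i) = \<zero>\<^bsub>A\<^esub>"
proof -
  note [simp] = c T_carrier[OF i] S_var_carrier[OF i] chart_eval_carrier cover_const_carrier
  have "c \<otimes>\<^bsub>B\<^esub> relation i =
      (cover_pi (r + 1) \<otimes>\<^bsub>B\<^esub> (T i \<otimes>\<^bsub>B\<^esub> c)) \<ominus>\<^bsub>B\<^esub> (cover_const R n (S_var i) \<otimes>\<^bsub>B\<^esub> c)"
  proof -
    have "c \<in> carrier B" "T i \<in> carrier B" "cover_pi (r + 1) \<in> carrier B" "cover_const R n (S_var i) \<in> carrier B"
      by simp_all
    then show ?thesis by algebra
  qed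
  then have "chart_eval (c \<otimes>\<^bsub>B\<^esub> relation i) =
      const_pi (r + 1) \<otimes>\<^bsub>A\<^esub> (S_var i \<otimes>\<^bsub>A\<^esub> chart_eval c) \<ominus>\<^bsub>A\<^esub>
      (const_pi (r + 1) \<otimes>\<^bsub>A\<^esub> S_var i) \<otimes>\<^bsub>A\<^esub> chart_eval c"
    by (simp only: chart_eval_minus chart_eval_const_mult chart_eval_T_mult[OF _ i] scl_const_pi scl_S_var[OF i]
        B.m_closed cover_pi_carrier cover_const_carrier c T_carrier[OF i] S_var_carrier[OF i] const_pi_carrier)
  also have "\<dots> = \<zero>\<^bsub>A\<^esub>"
    using chart_eval_carrier[OF c] S_var_carrier[OF i] const_pi_carrier[of "r + 1"] by algebra
  finally show ?thesis .
qed

text \<open>The elements all of whose multiples evaluate to zero form an ideal; by linearity over \<open>A\<close> and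
  compatibility with the \<open>T\<^sub>i\<close>, it contains the generators of the relations.\<close>

lemma chart_eval_Rel:
  assumes "b \<in> Rel"
  shows "chart_eval b = \<zero>\<^bsub>A\<^esub>"
proof -
  define K where "K = {b \<in> carrier B. \<forall>c\<in>carrier B. chart_eval (c \<otimes>\<^bsub>B\<^esub> b) = \<zero>\<^bsub>A\<^esub>}"
  have "ideal K B"
  proof (rule idealI[OF B.ring_axioms])
    show "subgroup K (add_monoid B)"
    proof (rule B.add.subgroupI)
      show "K \<subseteq> carrier B"
        by (auto simp: K_def)
      have "\<zero>\<^bsub>B\<^esub> \<in> K"
        by (simp add: K_def chart_eval_zero)
      then show "K \<noteq> {}"
        by blast
      fix a b assume a: "a \<in> K" and b: "b \<in> K"
      then show "a \<oplus>\<^bsub>B\<^esub> b \<in> K"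
        by (auto simp: K_def B.r_distr chart_eval_add)
    next
      fix a assume a: "a \<in> K"
      have "chart_eval (c \<otimes>\<^bsub>B\<^esub> (\<ominus>\<^bsub>B\<^esub> a)) = \<zero>\<^bsub>A\<^esub>" if "c \<in> carrier B" for c
      proof -
        have "c \<otimes>\<^bsub>B\<^esub> (\<ominus>\<^bsub>B\<^esub> a) = \<zero>\<^bsub>B\<^esub> \<ominus>\<^bsub>B\<^esub> c \<otimes>\<^bsub>B\<^esub> a"
          using a that by (simp add: K_def B.minus_eq B.r_minus)
        then show ?thesis
          using a that by (simp add: K_def chart_eval_minus chart_eval_zero A.minus_eq)
      qed
      then show "\<ominus>\<^bsub>B\<^esub> a \<in> K"
        using a by (simp add: K_def)
    qed
    fix a x assume "a \<in> K" "x \<in> carrier B"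
    then have a: "a \<in> carrier B" "x \<in> carrier B" "\<And>c. c \<in> carrier B \<Longrightarrow> chart_eval (c \<otimes>\<^bsub>B\<^esub> a) = \<zero>\<^bsub>A\<^esub>"
      by (auto simp: K_def)
    have "chart_eval (c \<otimes>\<^bsub>B\<^esub> (x \<otimes>\<^bsub>B\<^esub> a)) = \<zero>\<^bsub>A\<^esub>" if "c \<in> carrier B" for c
      using a(3)[of "c \<otimes>\<^bsub>B\<^esub> x"] a(1,2) that by (simp add: B.m_assoc)
    then show "x \<otimes>\<^bsub>B\<^esub> a \<in> K"
      using a(1,2) by (simp add: K_def)
    then show "a \<otimes>\<^bsub>B\<^esub> x \<in> K"
      using B.m_comm[OF a(1,2)] by simp
  qed
  moreover have "relation ` {1..n} \<subseteq> K"
    using relation_carrier chart_eval_mult_relation by (auto simp: K_def simp del: atLeastAtMost_iff)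
  ultimately have "Rel \<subseteq> K"
    unfolding Rel_eq by (rule B.genideal_minimal)
  then have "b \<in> K"
    using assms by blast
  then have "chart_eval (\<one>\<^bsub>B\<^esub> \<otimes>\<^bsub>B\<^esub> b) = \<zero>\<^bsub>A\<^esub>" "b \<in> carrier B"
    unfolding K_def using B.one_closed by blast+
  then show ?thesis
    by simp
qed

definition S_free :: "nat set \<Rightarrow> (nat multiset \<Rightarrow> 'a series) set" where
  "S_free D = {b \<in> carrier B. \<forall>t m. (\<exists>i\<in>D. S_coord i \<in># m) \<longrightarrow> b t m = \<zero>}"

lemma S_free_carrier: "b \<in> S_free D \<Longrightarrow> b \<in> carrier B"
  by (simp add: S_free_def)

lemma Tpow_carrier_iff:
  "b \<in> carrier Tpow \<longleftrightarrow> (\<forall>t. b t \<in> carrier A) \<and> (\<forall>t m. \<not> set_mset t \<subseteq> {1..n} \<longrightarrow> b t m = \<zero>)"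
  unfolding A.power_series_carrier power_series_zero by (auto simp: fun_eq_iff)

text \<open>Here \<open>b0\<close> collects the monomials without \<open>S\<^sub>i\<close>, and the others are divided by \<open>S\<^sub>i\<close>.  The shifted coefficients of \<open>s\<close>
  still converge to zero, since dividing by a variable lowers the order by one.\<close>

lemma cover_split:
  fixes b i
  assumes b: "b \<in> carrier B" and i: "i \<in> {1..n}"
  defines "b0 \<equiv> \<lambda>t m. if S_coord i \<in># m then \<zero> else b t m"
    and "s \<equiv> \<lambda>t m. b t (add_mset (S_coord i) m)"
  shows "b0 \<in> carrier B" "s \<in> carrier B" "b = b0 \<oplus>\<^bsub>B\<^esub> cover_const R n (S_var i) \<otimes>\<^bsub>B\<^esub> s"
proof -
  have bA: "b t m \<in> carrier R" "\<not> set_mset m \<subseteq> coords n \<Longrightarrow> b t m = \<zero>" for t m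
    using cover_coeff[OF b, of t] by (auto simp: power_series_carrier)
  have bT: "b t m = \<zero>" if "\<not> set_mset t \<subseteq> {1..n}" for t m
    using cover_carrier_Tpow[OF b] that unfolding Tpow_carrier_iff by blast
  have fin: "finite {t. b t \<notin> weighted (coords n) (\<lambda>m. k - size m)}" for k
    using b unfolding cover_carrier by blast
  have b0A: "b0 t \<in> carrier A" for t
    using bA by (simp add: b0_def power_series_carrier)
  have sA: "s t \<in> carrier A" for t
    using bA by (simp add: s_def power_series_carrier)
  have "b0 t \<in> weighted (coords n) (\<lambda>m. k - size m)" if "b t \<in> weighted (coords n) (\<lambda>m. k - size m)" for t k
    using that b0A[of t] unfolding weighted_def by (simp add: b0_def)
  then have "{t. b0 t \<notin> weighted (coords n) (\<lambda>m. k - size m)} \<subseteq> {t. b t \<notin> weighted (coords n) (\<lambda>m. k - size m)}" for k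
    by blast
  from finite_subset[OF this fin] have "finite {t. b0 t \<notin> weighted (coords n) (\<lambda>m. k - size m)}" for k .
  moreover have "b0 t m = \<zero>" if "\<not> set_mset t \<subseteq> {1..n}" for t m
    using bT[OF that] by (simp add: b0_def)
  ultimately show b0: "b0 \<in> carrier B"
    unfolding cover_carrier Tpow_carrier_iff using b0A by blast
  have "s t \<in> weighted (coords n) (\<lambda>m. k - size m)" if bt: "b t \<in> weighted (coords n) (\<lambda>m. Suc k - size m)" for t k
  proof -
    have "b t (add_mset (S_coord i) m) \<in> pi_ideal (Suc k - size (add_mset (S_coord i) m))" for m
      using bt unfolding weighted_def by blast
    then have "s t m \<in> pi_ideal (k - size m)" for m
      unfolding s_def size_add_mset diff_Suc_Suc .
    then show ?thesis
      using sA[of t] unfolding weighted_def by blast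
  qed
  then have "{t. s t \<notin> weighted (coords n) (\<lambda>m. k - size m)} \<subseteq> {t. b t \<notin> weighted (coords n) (\<lambda>m. Suc k - size m)}" for k
    by blast
  from finite_subset[OF this fin] have "finite {t. s t \<notin> weighted (coords n) (\<lambda>m. k - size m)}" for k .
  moreover have "s t m = \<zero>" if "\<not> set_mset t \<subseteq> {1..n}" for t m
    using bT[OF that] by (simp add: s_def)
  ultimately show s: "s \<in> carrier B"
    unfolding cover_carrier Tpow_carrier_iff using sA by blast
  have "b t m = (b0 \<oplus>\<^bsub>B\<^esub> cover_const R n (S_var i) \<otimes>\<^bsub>B\<^esub> s) t m" for t m
    using bA(1) by (simp add: cover_add cover_const_mult[OF S_var_carrier[OF i] s] indexed_var_mult[OF sA])
      (simp add: b0_def s_def)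
  then show "b = b0 \<oplus>\<^bsub>B\<^esub> cover_const R n (S_var i) \<otimes>\<^bsub>B\<^esub> s"
    by blast
qed

text \<open>Modulo the relations, \<open>S\<^sub>i s\<close> equals \<open>\<pi>\<^sup>r\<^sup>+\<^sup>1 T\<^sub>i s\<close>, which is a multiple of \<open>\<pi>\<close>.  So the variables \<open>S\<^sub>i\<close> can be
  removed one after another modulo \<open>\<pi>\<close>; by iteration, also modulo \<open>\<pi>\<^sup>N\<close>.\<close>

lemma reduce_mod_pi:
  assumes "finite D" "D \<subseteq> {1..n}" "b \<in> carrier B"
  shows "\<exists>b0\<in>S_free D. \<exists>c\<in>carrier B. b \<ominus>\<^bsub>B\<^esub> (b0 \<oplus>\<^bsub>B\<^esub> cover_pi 1 \<otimes>\<^bsub>B\<^esub> c) \<in> Rel"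
  using assms
proof (induction D rule: finite_induct)
  interpret I: ideal Rel B by (rule Rel_ideal)
  case empty
  then have "b \<in> S_free {}"
    by (simp add: S_free_def)
  moreover have "b \<ominus>\<^bsub>B\<^esub> (b \<oplus>\<^bsub>B\<^esub> cover_pi 1 \<otimes>\<^bsub>B\<^esub> \<zero>\<^bsub>B\<^esub>) \<in> Rel"
  proof -
    have "b \<ominus>\<^bsub>B\<^esub> (b \<oplus>\<^bsub>B\<^esub> cover_pi 1 \<otimes>\<^bsub>B\<^esub> \<zero>\<^bsub>B\<^esub>) = \<zero>\<^bsub>B\<^esub>"
      using empty cover_pi_carrier[of 1] by algebra
    then show ?thesis by simp
  qed
  ultimately show ?case
    by blast
next
  interpret I: ideal Rel B by (rule Rel_ideal)
  case (insert i D)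
  then obtain b1 c where b1: "b1 \<in> S_free D" and c: "c \<in> carrier B"
      and 1: "b \<ominus>\<^bsub>B\<^esub> (b1 \<oplus>\<^bsub>B\<^esub> cover_pi 1 \<otimes>\<^bsub>B\<^esub> c) \<in> Rel"
    by auto
  have i: "i \<in> {1..n}"
    using insert.prems by blast
  define b0 where "b0 = (\<lambda>t m. if S_coord i \<in># m then \<zero> else b1 t m)"
  define s where "s = (\<lambda>t m. b1 t (add_mset (S_coord i) m))"
  note split = cover_split[OF S_free_carrier[OF b1] i, folded b0_def s_def]
  have b0: "b0 \<in> S_free (insert i D)"
    using b1 split(1) by (auto simp: S_free_def b0_def)
  let ?c = "c \<oplus>\<^bsub>B\<^esub> cover_pi r \<otimes>\<^bsub>B\<^esub> (T i \<otimes>\<^bsub>B\<^esub> s)"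
  have pi: "cover_pi (r + 1) = cover_pi 1 \<otimes>\<^bsub>B\<^esub> cover_pi r"
    by (subst cover_pi_mult[OF cover_pi_carrier]) (auto simp: const_pi_def A.indexed_const_def indexed_const_def m_comm fun_eq_iff)
  have "b \<ominus>\<^bsub>B\<^esub> (b0 \<oplus>\<^bsub>B\<^esub> cover_pi 1 \<otimes>\<^bsub>B\<^esub> ?c) =
      (b \<ominus>\<^bsub>B\<^esub> (b1 \<oplus>\<^bsub>B\<^esub> cover_pi 1 \<otimes>\<^bsub>B\<^esub> c)) \<ominus>\<^bsub>B\<^esub> s \<otimes>\<^bsub>B\<^esub> relation i"
  proof -
    note closed = insert.prems(2) c split(1,2) T_carrier[OF i] cover_pi_carrier[of 1] cover_pi_carrier[of r]
      cover_const_carrier[OF S_var_carrier[OF i]]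
    show ?thesis
      unfolding pi by (subst split(3)) (use closed in algebra)
  qed
  also have "\<dots> \<in> Rel"
    using 1 I.I_l_closed[OF relation_in_Rel[OF i] split(2)]
    unfolding B.minus_eq[of "b \<ominus>\<^bsub>B\<^esub> (b1 \<oplus>\<^bsub>B\<^esub> cover_pi 1 \<otimes>\<^bsub>B\<^esub> c)"] by (intro I.a_closed I.a_inv_closed)
  finally show ?case
    using b0 c split(2) T_carrier[OF i] by (intro bexI[of _ b0] bexI[of _ ?c]) simp_all
qed

lemma cover_pi_add: "cover_pi (j + k) = cover_pi j \<otimes>\<^bsub>B\<^esub> cover_pi k"
  by (subst cover_pi_mult[OF cover_pi_carrier]) (auto simp: const_pi_def A.indexed_const_def indexed_const_def nat_pow_mult fun_eq_iff)

lemma cover_pi_0: "cover_pi 0 = \<one>\<^bsub>B\<^esub>"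
  unfolding cover_one A.power_series_one
  by (auto simp: const_pi_def A.indexed_const_def indexed_const_def power_series_one)

lemma reduce_mod_pi_pow:
  assumes b: "b \<in> carrier B"
  shows "\<exists>b0\<in>S_free {1..n}. \<exists>c\<in>carrier B. b \<ominus>\<^bsub>B\<^esub> (b0 \<oplus>\<^bsub>B\<^esub> cover_pi N \<otimes>\<^bsub>B\<^esub> c) \<in> Rel"
proof (induction N)
  interpret I: ideal Rel B by (rule Rel_ideal)
  case 0
  have "\<zero>\<^bsub>B\<^esub> \<in> S_free {1..n}"
    using B.zero_closed by (simp add: S_free_def) (simp add: cover_zero)
  moreover have "b \<ominus>\<^bsub>B\<^esub> (\<zero>\<^bsub>B\<^esub> \<oplus>\<^bsub>B\<^esub> \<one>\<^bsub>B\<^esub> \<otimes>\<^bsub>B\<^esub> b) \<in> Rel"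
    using b by (simp add: B.minus_eq B.r_neg)
  ultimately show ?case
    unfolding cover_pi_0 using b by blast
next
  interpret I: ideal Rel B by (rule Rel_ideal)
  case (Suc N)
  then obtain b0 c where b0: "b0 \<in> S_free {1..n}" and c: "c \<in> carrier B"
      and 1: "b \<ominus>\<^bsub>B\<^esub> (b0 \<oplus>\<^bsub>B\<^esub> cover_pi N \<otimes>\<^bsub>B\<^esub> c) \<in> Rel"
    by blast
  obtain c0 c1 where c0: "c0 \<in> S_free {1..n}" and c1: "c1 \<in> carrier B"
      and 2: "c \<ominus>\<^bsub>B\<^esub> (c0 \<oplus>\<^bsub>B\<^esub> cover_pi 1 \<otimes>\<^bsub>B\<^esub> c1) \<in> Rel"
    using reduce_mod_pi[OF _ order_refl c] by auto
  let ?b = "b0 \<oplus>\<^bsub>B\<^esub> cover_pi N \<otimes>\<^bsub>B\<^esub> c0"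
  have "?b \<in> S_free {1..n}"
  proof -
    have "?b \<in> carrier B"
      using S_free_carrier[OF b0] S_free_carrier[OF c0] by simp
    moreover have "?b t m = \<zero>" if "\<exists>i\<in>{1..n}. S_coord i \<in># m" for t m
    proof -
      have "b0 t m = \<zero>" "c0 t m = \<zero>"
        using b0 c0 that unfolding S_free_def by blast+
      then show ?thesis
        by (simp add: cover_add cover_pi_mult S_free_carrier[OF c0])
    qed
    ultimately show ?thesis
      unfolding S_free_def by blast
  qed
  moreover have "b \<ominus>\<^bsub>B\<^esub> (?b \<oplus>\<^bsub>B\<^esub> cover_pi (Suc N) \<otimes>\<^bsub>B\<^esub> c1) \<in> Rel"
  proof -
    note closed = b S_free_carrier[OF b0] c S_free_carrier[OF c0] c1 cover_pi_carrier[of 1] cover_pi_carrier[of N]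
    have pi: "cover_pi (Suc N) = cover_pi N \<otimes>\<^bsub>B\<^esub> cover_pi 1"
      using cover_pi_add[of N 1] by simp
    have "b \<ominus>\<^bsub>B\<^esub> (?b \<oplus>\<^bsub>B\<^esub> cover_pi (Suc N) \<otimes>\<^bsub>B\<^esub> c1) =
      (b \<ominus>\<^bsub>B\<^esub> (b0 \<oplus>\<^bsub>B\<^esub> cover_pi N \<otimes>\<^bsub>B\<^esub> c)) \<oplus>\<^bsub>B\<^esub> cover_pi N \<otimes>\<^bsub>B\<^esub> (c \<ominus>\<^bsub>B\<^esub> (c0 \<oplus>\<^bsub>B\<^esub> cover_pi 1 \<otimes>\<^bsub>B\<^esub> c1))"
      unfolding pi using closed by algebra
    also have "\<dots> \<in> Rel"
      by (intro I.a_closed 1 I.I_l_closed[OF 2]) simp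
    finally show ?thesis .
  qed
  ultimately show ?case
    using c1 by blast
qed

text \<open>If no \<open>S\<^sub>i\<close> occurs in the coefficients of \<open>b\<close>, then the evaluation merely renames \<open>T\<close> to \<open>S\<close>: the only
  contribution to the coefficient at \<open>S\<^sup>t Z\<^sup>l\<close> comes from \<open>b\<^sub>t\<close>.\<close>

lemma chart_eval_S_free:
  assumes b: "b \<in> S_free {1..n}" and t: "set_mset t \<subseteq> {1..n}"
  shows "chart_eval b (image_mset S_coord t + Zpow l) = b t (Zpow l)"
proof -
  let ?S = "image_mset S_coord t" let ?M = "?S + Zpow l"
  note bB = S_free_carrier[OF b]
  have idx_S: "idx ?S = t"
    by (simp add: idx_def image_mset.compositionality comp_def)
  have ZS: "Z_coord \<notin># ?S"
    by auto
  have val: "chart_term b ?S (?M - ?S) = b t (Zpow l)"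
    using ZS cover_coeff_coeff[OF bB, of t "Zpow l"] by (simp add: chart_term_def idx_S rescale_def)
  have other: "chart_term b y (?M - y) = \<zero>" if y: "y \<subseteq># ?M" "y \<noteq> ?S" for y
  proof (cases "Z_coord \<in># y")
    case False
    have yS: "y \<subseteq># ?S"
    proof (rule mset_subset_eqI)
      fix v
      show "count y v \<le> count ?S v"
      proof (cases "v = Z_coord")
        case True
        then show ?thesis
          using False by (simp add: not_in_iff)
      next
        case False
        then show ?thesis
          using mset_subset_eq_count[OF y(1), of v] by simp
      qed
    qed
    then have "?S - y \<noteq> {#}"
      using y(2) by (metis Diff_eq_empty_iff_mset subset_mset.antisym)
    then obtain v where v: "v \<in># ?S - y"
      by blast
    then have "v \<in># ?S"
      by (rule in_diffD)
    then obtain i where i: "v = S_coord i" "i \<in> {1..n}"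
      using t by auto
    have M_y: "?M - y = (?S - y) + Zpow l"
      by (rule subset_mset.diff_add_assoc2[OF yS])
    have "S_coord i \<in># ?M - y"
      using v unfolding M_y i(1) union_iff by (rule disjI1)
    then have "b (idx y) (?M - y) = \<zero>"
      using b i(2) unfolding S_free_def by blast
    then show ?thesis
      by (simp add: chart_term_def rescale_def)
  qed (simp add: chart_term_def)
  have "chart_eval b ?M = finsum R (\<lambda>y. if ?S = y then chart_term b y (?M - y) else \<zero>) {y. y \<subseteq># ?M}"
    unfolding chart_eval_def
    by (rule finsum_cong') (use other bB in auto)
  also have "\<dots> = chart_term b ?S (?M - ?S)"
    by (rule finsum_singleton) (use bB in auto)
  finally show ?thesis
    using val by simp
qed

text \<open>Division by \<open>\<pi>\<^sup>N\<close> preserves convergence to zero, as it lowers the order of a coefficient by at most \<open>N\<close>.\<close>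

lemma cover_divide_pi_pow:
  assumes b: "b \<in> carrier B" and div: "\<And>t m. b t m \<in> pi_ideal N"
  shows "\<exists>c\<in>carrier B. b = cover_pi N \<otimes>\<^bsub>B\<^esub> c"
proof -
  have "\<exists>x\<in>carrier R. b t m = \<pi> [^] N \<otimes> x" for t m
    using div[of t m] unfolding pi_ideal_iff .
  then obtain x where x: "\<And>t m. x t m \<in> carrier R" "\<And>t m. b t m = \<pi> [^] N \<otimes> x t m"
    by metis
  define c where "c t m = (if b t m = \<zero> then \<zero> else x t m)" for t m
  have bc: "b t m = \<pi> [^] N \<otimes> c t m" for t m
    using x by (simp add: c_def)
  have c_closed: "c t m \<in> carrier R" for t m
    using x by (simp add: c_def)
  have cA: "c t \<in> carrier A" for t
    using cover_coeff[OF b, of t] c_closed by (auto simp: power_series_carrier c_def)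
  have cT: "c t m = \<zero>" if "\<not> set_mset t \<subseteq> {1..n}" for t m
    using cover_carrier_Tpow[OF b] that unfolding Tpow_carrier_iff by (simp add: c_def)
  have "c t \<in> weighted (coords n) (\<lambda>m. k - size m)" if bt: "b t \<in> weighted (coords n) (\<lambda>m. (k + N) - size m)" for t k
  proof -
    have "c t m \<in> pi_ideal (k - size m)" for m
    proof -
      have "\<pi> [^] N \<otimes> c t m \<in> pi_ideal ((k + N) - size m)"
        using bt unfolding weighted_def bc[symmetric] by blast
      from pi_pow_cancel[OF c_closed this]
      show ?thesis
        by (rule pi_ideal_mono) linarith
    qed
    then show ?thesis
      using cA[of t] unfolding weighted_def by blast
  qed
  then have sub: "{t. c t \<notin> weighted (coords n) (\<lambda>m. k - size m)} \<subseteq> {t. b t \<notin> weighted (coords n) (\<lambda>m. (k + N) - size m)}" for k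
    by blast
  have "finite {t. c t \<notin> weighted (coords n) (\<lambda>m. k - size m)}" for k
    by (rule finite_subset[OF sub]) (use b in \<open>unfold cover_carrier, blast\<close>)
  then have c: "c \<in> carrier B"
    unfolding cover_carrier Tpow_carrier_iff using cA cT by blast
  have "b = cover_pi N \<otimes>\<^bsub>B\<^esub> c"
    unfolding cover_pi_mult[OF c] using bc by blast
  then show ?thesis
    using c by blast
qed

section \<open>The coordinate ring of the chart\<close>

lemma S_free_divisible:
  assumes b: "b \<in> S_free {1..n}" and ev: "chart_eval b \<in> weighted (coords n) (\<lambda>m. N)"
  shows "b t m \<in> pi_ideal N"
proof (cases "set_mset t \<subseteq> {1..n} \<and> set_mset m \<subseteq> {Z_coord}")
  case True
  then have "m = Zpow (count m Z_coord)"
    by (intro multiset_eqI) (auto simp: count_eq_zero_iff)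
  then have "b t m = chart_eval b (image_mset S_coord t + Zpow (count m Z_coord))"
    using chart_eval_S_free[OF b] True by metis
  then show ?thesis
    using ev unfolding weighted_def by simp
next
  case False
  note bB = S_free_carrier[OF b]
  have "b t m = \<zero>"
  proof (cases "set_mset t \<subseteq> {1..n}")
    case True
    then obtain v where v: "v \<in># m" "v \<noteq> Z_coord"
      using False by auto
    show ?thesis
    proof (cases "v \<in> coords n")
      case True
      then show ?thesis
        using v b unfolding S_free_def coords_def by blast
    next
      case False
      then show ?thesis
        using v(1) power_series_support[OF cover_coeff[OF bB]] by blast
    qed
  next
    case False
    then show ?thesis
      using cover_carrier_Tpow[OF bB] unfolding Tpow_carrier_iff by blast
  qed
  then show ?thesis
    by simp
qed

lemma chart_eval_cover_pi:
  assumes "b \<in> carrier B"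
  shows "chart_eval (cover_pi k \<otimes>\<^bsub>B\<^esub> b) = (\<lambda>m. \<pi> [^] k \<otimes> chart_eval b m)"
  using assms
  by (simp add: chart_eval_const_mult scl_const_pi)
    (simp add: const_pi_def indexed_const_mult chart_eval_carrier)

text \<open>Up to relations and multiples of \<open>\<pi>\<^sup>N\<close>, the series \<open>b\<close> may be taken free of the \<open>S\<^sub>i\<close>; then its
  coefficients can be read off from its evaluation.\<close>

lemma chart_eval_divisible:
  assumes b: "b \<in> carrier B" and ev: "chart_eval b \<in> weighted (coords n) (\<lambda>m. N)"
  shows "\<exists>c\<in>carrier B. b \<ominus>\<^bsub>B\<^esub> cover_pi N \<otimes>\<^bsub>B\<^esub> c \<in> Rel"
proof -
  interpret W: ideal "weighted (coords n) (\<lambda>m. N)" A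
    by (rule weighted_ideal) simp
  obtain b0 c where b0: "b0 \<in> S_free {1..n}" and c: "c \<in> carrier B"
      and rel: "b \<ominus>\<^bsub>B\<^esub> (b0 \<oplus>\<^bsub>B\<^esub> cover_pi N \<otimes>\<^bsub>B\<^esub> c) \<in> Rel"
    using reduce_mod_pi_pow[OF b] by blast
  note b0B = S_free_carrier[OF b0]
  note closed = chart_eval_carrier[OF b] chart_eval_carrier[OF b0B] chart_eval_carrier[OF c]
  have "chart_eval (b \<ominus>\<^bsub>B\<^esub> (b0 \<oplus>\<^bsub>B\<^esub> cover_pi N \<otimes>\<^bsub>B\<^esub> c)) = \<zero>\<^bsub>A\<^esub>"
    using rel by (rule chart_eval_Rel)
  then have *: "chart_eval b \<ominus>\<^bsub>A\<^esub> (chart_eval b0 \<oplus>\<^bsub>A\<^esub> chart_eval (cover_pi N \<otimes>\<^bsub>B\<^esub> c)) = \<zero>\<^bsub>A\<^esub>"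
    using b b0B c by (simp add: chart_eval_minus chart_eval_add)
  have pc: "chart_eval (cover_pi N \<otimes>\<^bsub>B\<^esub> c) \<in> weighted (coords n) (\<lambda>m. N)"
  proof -
    have "chart_eval (cover_pi N \<otimes>\<^bsub>B\<^esub> c) m \<in> pi_ideal N" for m
      unfolding chart_eval_cover_pi[OF c] pi_ideal_iff using chart_eval_closed[OF c] by blast
    then show ?thesis
      using chart_eval_carrier[of "cover_pi N \<otimes>\<^bsub>B\<^esub> c"] c unfolding weighted_def by simp
  qed
  have "chart_eval b0 = chart_eval b \<ominus>\<^bsub>A\<^esub> chart_eval (cover_pi N \<otimes>\<^bsub>B\<^esub> c) \<ominus>\<^bsub>A\<^esub>
      (chart_eval b \<ominus>\<^bsub>A\<^esub> (chart_eval b0 \<oplus>\<^bsub>A\<^esub> chart_eval (cover_pi N \<otimes>\<^bsub>B\<^esub> c)))"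
    using closed(1,2) weighted_carrier[OF pc] by algebra
  also have "\<dots> = chart_eval b \<ominus>\<^bsub>A\<^esub> chart_eval (cover_pi N \<otimes>\<^bsub>B\<^esub> c)"
    unfolding * using closed(1) weighted_carrier[OF pc] by algebra
  also have "\<dots> \<in> weighted (coords n) (\<lambda>m. N)"
    by (rule weighted_minus[OF ev pc])
  finally have "chart_eval b0 \<in> weighted (coords n) (\<lambda>m. N)" .
  then obtain c0 where c0: "c0 \<in> carrier B" and b0c0: "b0 = cover_pi N \<otimes>\<^bsub>B\<^esub> c0"
    using cover_divide_pi_pow[OF b0B] S_free_divisible[OF b0] by blast
  have "b0 \<oplus>\<^bsub>B\<^esub> cover_pi N \<otimes>\<^bsub>B\<^esub> c = cover_pi N \<otimes>\<^bsub>B\<^esub> (c0 \<oplus>\<^bsub>B\<^esub> c)"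
    unfolding b0c0 using c0 c by (simp add: B.r_distr)
  then show ?thesis
    using rel c0 c by (intro bexI[of _ "c0 \<oplus>\<^bsub>B\<^esub> c"]) simp_all
qed

abbreviation Q where "Q \<equiv> B Quot Rel"
abbreviation Tors where "Tors \<equiv> chart_torsion R \<pi> n r"
abbreviation A' where "A' \<equiv> chart_ring R \<pi> n r"

sublocale Rel: ideal Rel B
  by (rule Rel_ideal)

sublocale Q: cring Q
  by (rule Rel.quotient_is_cring) (rule B.is_cring)

lemma Tors_eq: "Tors = torsion Q (Rel +>\<^bsub>B\<^esub> cover_pi 1)"
  by (simp add: chart_torsion_def const_pi_def)

lemma Rel_coset_closed: "b \<in> carrier B \<Longrightarrow> Rel +>\<^bsub>B\<^esub> b \<in> carrier Q"
  using ring_hom_closed[OF Rel.rcos_ring_hom] .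

lemma Tors_ideal: "ideal Tors Q"
  unfolding Tors_eq by (rule Q.torsion_ideal) (simp add: Rel_coset_closed)

sublocale Tors: ideal Tors Q
  by (rule Tors_ideal)

lemma chart_ring_eq: "A' = Q Quot Tors"
  by (simp add: chart_ring_def)

sublocale A': cring A'
  unfolding chart_ring_eq by (rule Tors.quotient_is_cring) (rule Q.is_cring)

definition chart_quot :: "(nat multiset \<Rightarrow> 'a series) \<Rightarrow> (nat multiset \<Rightarrow> 'a series) set set" where
  "chart_quot b = Tors +>\<^bsub>Q\<^esub> (Rel +>\<^bsub>B\<^esub> b)"

lemma chart_quot_hom: "chart_quot \<in> ring_hom B A'"
proof -
  have "(\<lambda>b. Tors +>\<^bsub>Q\<^esub> b) \<circ> (\<lambda>b. Rel +>\<^bsub>B\<^esub> b) \<in> ring_hom B A'"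
    unfolding chart_ring_eq by (rule ring_hom_trans[OF Rel.rcos_ring_hom Tors.rcos_ring_hom])
  moreover have "(\<lambda>b. Tors +>\<^bsub>Q\<^esub> b) \<circ> (\<lambda>b. Rel +>\<^bsub>B\<^esub> b) = chart_quot"
    by (auto simp: chart_quot_def)
  ultimately show ?thesis
    by simp
qed

sublocale chart_quot: ring_hom_cring B A' chart_quot
  by (rule ring_hom_cringI) (simp_all add: ring_hom_ringI2 B.ring_axioms A'.ring_axioms B.is_cring A'.is_cring chart_quot_hom)

lemma chart_quot_surj:
  assumes "x \<in> carrier A'"
  obtains b where "b \<in> carrier B" "x = chart_quot b"
  using assms unfolding chart_ring_eq chart_quot_def FactRing_simps by auto

lemma chart_map_eq: "chart_map R \<pi> n r a = chart_quot (cover_const R n a)"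
  by (simp add: chart_map_def chart_quot_def)

lemma chart_map_hom: "chart_map R \<pi> n r \<in> ring_hom A A'"
proof -
  have "chart_quot \<circ> cover_const R n \<in> ring_hom A A'"
    by (rule ring_hom_trans[OF cover_const_hom chart_quot_hom])
  moreover have "chart_quot \<circ> cover_const R n = chart_map R \<pi> n r"
    by (auto simp: chart_map_eq)
  ultimately show ?thesis
    by simp
qed

lemma cover_pi_pow: "cover_pi 1 [^]\<^bsub>B\<^esub> k = cover_pi k"
proof (induction k)
  case 0
  show ?case
    by (simp add: cover_pi_0)
next
  case (Suc k)
  then show ?case
    using cover_pi_add[of k 1] by simp
qed

text \<open>Elements that become \<open>\<pi>\<close>-torsion modulo the relations evaluate to zero, because \<open>A\<close> has no \<open>\<pi>\<close>-torsion.\<close>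

lemma chart_eval_of_quot_zero:
  assumes b: "b \<in> carrier B" and zero: "chart_quot b = \<zero>\<^bsub>A'\<^esub>"
  shows "chart_eval b = \<zero>\<^bsub>A\<^esub>"
proof -
  have "Tors +>\<^bsub>Q\<^esub> (Rel +>\<^bsub>B\<^esub> b) = Tors"
    using zero by (simp add: chart_quot_def chart_ring_eq FactRing_def)
  then have "Rel +>\<^bsub>B\<^esub> b \<in> torsion Q (Rel +>\<^bsub>B\<^esub> cover_pi 1)"
    using Tors.a_rcos_self[OF Rel_coset_closed[OF b]] by (simp add: Tors_eq)
  then obtain k :: nat where "(Rel +>\<^bsub>B\<^esub> cover_pi 1) [^]\<^bsub>Q\<^esub> k \<otimes>\<^bsub>Q\<^esub> (Rel +>\<^bsub>B\<^esub> b) = \<zero>\<^bsub>Q\<^esub>"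
    by (auto simp: torsion_def)
  moreover have "(Rel +>\<^bsub>B\<^esub> cover_pi 1) [^]\<^bsub>Q\<^esub> k = Rel +>\<^bsub>B\<^esub> cover_pi k"
    using ring_hom_ring.hom_nat_pow[OF Rel.rcos_ring_hom_ring, of "cover_pi 1" k] cover_pi_pow by simp
  ultimately have "Rel +>\<^bsub>B\<^esub> (cover_pi k \<otimes>\<^bsub>B\<^esub> b) = \<zero>\<^bsub>Q\<^esub>"
    using ring_hom_mult[OF Rel.rcos_ring_hom, of "cover_pi k" b] b by simp
  then have "Rel +>\<^bsub>B\<^esub> (cover_pi k \<otimes>\<^bsub>B\<^esub> b) = Rel"
    by (simp add: FactRing_def)
  then have "cover_pi k \<otimes>\<^bsub>B\<^esub> b \<in> Rel"
    using Rel.a_rcos_self[of "cover_pi k \<otimes>\<^bsub>B\<^esub> b"] b by simp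
  then have "chart_eval (cover_pi k \<otimes>\<^bsub>B\<^esub> b) = \<zero>\<^bsub>A\<^esub>"
    by (rule chart_eval_Rel)
  then have "\<pi> [^] k \<otimes> chart_eval b m = \<zero>" for m
    unfolding chart_eval_cover_pi[OF b] power_series_zero by metis
  moreover have "\<pi> [^] k \<noteq> \<zero>"
    using uniformizer_nonzero by (induction k) (auto simp: integral_iff)
  ultimately have "chart_eval b m = \<zero>" for m
    using integral_iff[of "\<pi> [^] k" "chart_eval b m"] chart_eval_closed[OF b] by simp
  then show ?thesis
    by (auto simp: power_series_zero)
qed

text \<open>This is the identification of \<open>A'\<close> modulo \<open>\<pi>\<^sup>N\<close> with its image in \<open>A\<close> modulo \<open>\<pi>\<^sup>N\<close>: one direction
  since relations and torsion evaluate to zero, the other by \<open>chart_eval_divisible\<close>.\<close>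

lemma chart_quot_divisible_iff:
  assumes b: "b \<in> carrier B"
  shows "chart_quot b \<in> PIdl\<^bsub>A'\<^esub> (chart_quot (cover_pi 1) [^]\<^bsub>A'\<^esub> N) \<longleftrightarrow>
    chart_eval b \<in> weighted (coords n) (\<lambda>m. N)"
proof
  have pow: "chart_quot (cover_pi 1) [^]\<^bsub>A'\<^esub> N = chart_quot (cover_pi N)"
    using ring_hom_ring.hom_nat_pow[OF ring_hom_ringI2[OF B.ring_axioms A'.ring_axioms chart_quot_hom]
        cover_pi_carrier[of 1], of N]
    unfolding cover_pi_pow by (rule sym)
  {
    assume "chart_quot b \<in> PIdl\<^bsub>A'\<^esub> (chart_quot (cover_pi 1) [^]\<^bsub>A'\<^esub> N)"
    then obtain x where x: "x \<in> carrier A'" "chart_quot b = x \<otimes>\<^bsub>A'\<^esub> chart_quot (cover_pi N)"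
      unfolding pow by (auto simp: cgenideal_def)
    obtain c where c: "c \<in> carrier B" "x = chart_quot c"
      using chart_quot_surj[OF x(1)] .
    have "chart_quot (b \<ominus>\<^bsub>B\<^esub> cover_pi N \<otimes>\<^bsub>B\<^esub> c) = \<zero>\<^bsub>A'\<^esub>"
      using b c x(2) A'.m_comm[of "chart_quot c" "chart_quot (cover_pi N)"]
      by (simp add: B.minus_eq A'.r_neg)
    from chart_eval_of_quot_zero[OF _ this]
    have "chart_eval b \<ominus>\<^bsub>A\<^esub> chart_eval (cover_pi N \<otimes>\<^bsub>B\<^esub> c) = \<zero>\<^bsub>A\<^esub>"
      using b c(1) by (simp add: chart_eval_minus)
    then have eq: "chart_eval b = chart_eval (cover_pi N \<otimes>\<^bsub>B\<^esub> c)"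
      using b c(1) by (simp add: chart_eval_carrier)
    have "chart_eval b m \<in> pi_ideal N" for m
      unfolding eq chart_eval_cover_pi[OF c(1)] pi_ideal_iff using chart_eval_closed[OF c(1)] by blast
    then show "chart_eval b \<in> weighted (coords n) (\<lambda>m. N)"
      using chart_eval_carrier[OF b] unfolding weighted_def by blast
  next
    assume "chart_eval b \<in> weighted (coords n) (\<lambda>m. N)"
    then obtain c where c: "c \<in> carrier B" and rel: "b \<ominus>\<^bsub>B\<^esub> cover_pi N \<otimes>\<^bsub>B\<^esub> c \<in> Rel"
      using chart_eval_divisible[OF b] by blast
    have "Rel +>\<^bsub>B\<^esub> b = Rel +>\<^bsub>B\<^esub> (cover_pi N \<otimes>\<^bsub>B\<^esub> c)"
      using rel b c by (simp add: Rel.coset_eq_iff)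
    then have "chart_quot b = chart_quot (cover_pi N \<otimes>\<^bsub>B\<^esub> c)"
      by (simp add: chart_quot_def)
    also have "\<dots> = chart_quot c \<otimes>\<^bsub>A'\<^esub> chart_quot (cover_pi N)"
      using c by (simp add: A'.m_comm)
    finally show "chart_quot b \<in> PIdl\<^bsub>A'\<^esub> (chart_quot (cover_pi 1) [^]\<^bsub>A'\<^esub> N)"
      unfolding pow cgenideal_def using c by auto
  }
qed

lemma Z_distinguished_Z_order:
  assumes "Z_distinguished R \<pi> f"
  shows "\<exists>d. Z_order f d"
proof -
  let ?k = "R Quot (PIdl \<pi>)"
  interpret maximalideal "PIdl \<pi>" R by (rule uniformizer_maximal)
  interpret k: cring ?k by (rule quotient_is_cring) (rule is_cring)
  have "(\<lambda>m. if set_mset m \<subseteq> {Z_coord} then PIdl \<pi> +> f m else \<zero>\<^bsub>?k\<^esub>) \<noteq> (\<lambda>m. \<zero>\<^bsub>?k\<^esub>)"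
    using assms by (simp add: Z_distinguished_def Let_def k.power_series_zero)
  then obtain m where m: "set_mset m \<subseteq> {Z_coord}" "PIdl \<pi> +> f m \<noteq> \<zero>\<^bsub>?k\<^esub>"
    by (metis (full_types))
  have "f m \<notin> PIdl \<pi>"
    using m(2) a_rcos_const by (auto simp: FactRing_def)
  moreover have "m = Zpow (count m Z_coord)"
    using m(1) by (intro multiset_eqI) (auto simp: count_eq_zero_iff)
  ultimately have ex: "f (Zpow (count m Z_coord)) \<notin> PIdl \<pi>"
    by metis
  show ?thesis
    unfolding Z_order_def
    using LeastI[of "\<lambda>j. f (Zpow j) \<notin> PIdl \<pi>", OF ex] not_less_Least[of _ "\<lambda>j. f (Zpow j) \<notin> PIdl \<pi>"]
    by blast
qed

end

section \<open>Extending functions to the envelope\<close>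

theorem theorem2p3p3p1:
  fixes R :: "('a, 'm) ring_scheme" and \<pi> :: 'a and n r :: nat and f :: "'a series"
  defines "A \<equiv> base_ring R n"
    and "p \<equiv> base_const R \<pi>"
    and "A' \<equiv> chart_ring R \<pi> n r"
    and "\<phi> \<equiv> chart_map R \<pi> n r"
  assumes "complete_dvr R \<pi>"
    and "f \<in> carrier A" and "Z_distinguished R \<pi> f"
    and "g \<in> carrier (envelope_functions A p f)"
    and "h \<in> carrier (envelope_functions A' (\<phi> p) \<one>\<^bsub>A'\<^esub>)"
    and "envelope_pullback A' (\<phi> p) (\<phi> f) \<phi> g = envelope_restrict A' (\<phi> p) (\<phi> f) h"
  shows "\<exists>!u. u \<in> carrier (envelope_functions A p \<one>\<^bsub>A\<^esub>)
            \<and> envelope_restrict A p f u = g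
            \<and> envelope_pullback A' (\<phi> p) \<one>\<^bsub>A'\<^esub> \<phi> u = h"
proof -
  interpret chart: blowup_chart R \<pi> n r
    unfolding blowup_chart_def by fact
  let ?B = "chart_cover R \<pi> n" and ?q = "chart.chart_quot" and ?c = "cover_const R n"
  let ?W = "\<lambda>N. chart.weighted (coords n) (\<lambda>m. N)"
  have p: "p = chart.const_pi 1"
    by (simp add: p_def chart.const_pi_def)
  have pA: "p \<in> carrier A"
    using chart.const_pi_carrier[of 1] by (simp add: p A_def)
  have PIdl_p: "PIdl\<^bsub>A\<^esub> (p [^]\<^bsub>A\<^esub> N) = ?W N" for N :: nat
    using chart.PIdl_base_const_pow by (simp add: A_def p_def)
  have \<phi>: "\<phi> a = ?q (?c a)" for a
    by (simp add: \<phi>_def chart.chart_map_eq)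
  have fA: "f \<in> carrier (base_ring R n)"
    using assms(6) by (simp add: A_def)
  obtain d where d: "chart.Z_order f d"
    using chart.Z_distinguished_Z_order[OF assms(7)] by blast
  have W_stable: "F x \<otimes>\<^bsub>R\<^esub> c \<in> chart.pi_ideal N"
    if "F \<in> carrier (base_ring R n)" "c \<in> chart.pi_ideal N" for F x c N
    using that by (intro ideal.I_l_closed[OF chart.pi_ideal_ideal] chart.power_series_closed)
  have divisible: "?q b \<in> PIdl\<^bsub>A'\<^esub> (\<phi> p [^]\<^bsub>A'\<^esub> N) \<longleftrightarrow> chart.chart_eval b \<in> ?W N"
    if "b \<in> carrier ?B" for b and N :: nat
    using chart.chart_quot_divisible_iff[OF that, of N] by (simp add: A'_def \<phi> p)
  show ?thesis
  proof (rule envelope_patching[OF _ _ _ pA assms(6) _ _ _ assms(8-10)])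
    show "cring A" "cring A'"
      using chart.A.is_cring chart.A'.is_cring by (simp_all add: A_def A'_def)
    show "\<phi> \<in> ring_hom A A'"
      using chart.chart_map_hom by (simp add: A_def A'_def \<phi>_def)
    show "cring.adic_regular A p f"
      unfolding cring.adic_regular_def[OF \<open>cring A\<close>] PIdl_p
    proof (intro allI ballI impI)
      fix N :: nat and x assume x: "x \<in> carrier A" and fx: "f \<otimes>\<^bsub>A\<^esub> x \<in> ?W N"
      show "x \<in> ?W N"
        by (rule chart.weighted_regular[OF fA x[unfolded A_def] d refl W_stable[OF fA] fx[unfolded A_def]])
    qed
    show "cring.adic_regular A' (\<phi> p) (\<phi> f)"
      unfolding cring.adic_regular_def[OF \<open>cring A'\<close>]
    proof (intro allI ballI impI)
      fix N :: nat and x assume x: "x \<in> carrier A'" and fx: "\<phi> f \<otimes>\<^bsub>A'\<^esub> x \<in> PIdl\<^bsub>A'\<^esub> (\<phi> p [^]\<^bsub>A'\<^esub> N)"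
      obtain b where b: "b \<in> carrier ?B" "x = ?q b"
        using chart.chart_quot_surj x unfolding A'_def by blast
      have fb: "?c f \<otimes>\<^bsub>?B\<^esub> b \<in> carrier ?B"
        using b(1) fA by (simp add: chart.cover_const_carrier)
      have eq: "\<phi> f \<otimes>\<^bsub>A'\<^esub> x = ?q (?c f \<otimes>\<^bsub>?B\<^esub> b)"
        using b fA by (simp add: \<phi> A'_def chart.cover_const_carrier)
      have "chart.chart_eval (?c f \<otimes>\<^bsub>?B\<^esub> b) \<in> ?W N"
        by (rule iffD1[OF divisible[OF fb]]) (rule fx[unfolded eq])
      then have fbW: "chart.scl f \<otimes>\<^bsub>base_ring R n\<^esub> chart.chart_eval b \<in> ?W N"
        using b fA by (simp add: chart.chart_eval_const_mult)
      have "chart.chart_eval b \<in> ?W N"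
        by (rule chart.weighted_regular[OF chart.scl.hom_closed[OF fA] chart.chart_eval_carrier[OF b(1)]
              iffD2[OF chart.rescale_Z_order[OF fA] d] refl W_stable[OF chart.scl.hom_closed[OF fA]] fbW])
      then show "x \<in> PIdl\<^bsub>A'\<^esub> (\<phi> p [^]\<^bsub>A'\<^esub> N)"
        using b by (simp add: divisible)
    qed
    fix a :: "nat \<Rightarrow> 'a series" and k :: "nat \<Rightarrow> nat" and M :: nat
    assume a: "\<And>N. a N \<in> carrier A"
      and compat: "\<And>M N. M \<le> N \<Longrightarrow> a N \<otimes>\<^bsub>A\<^esub> f [^]\<^bsub>A\<^esub> k M \<ominus>\<^bsub>A\<^esub> a M \<otimes>\<^bsub>A\<^esub> f [^]\<^bsub>A\<^esub> k N \<in> PIdl\<^bsub>A\<^esub> (p [^]\<^bsub>A\<^esub> M)"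
      and div: "\<And>N. \<exists>x\<in>carrier A'. \<phi> (a N) \<ominus>\<^bsub>A'\<^esub> x \<otimes>\<^bsub>A'\<^esub> \<phi> f [^]\<^bsub>A'\<^esub> k N \<in> PIdl\<^bsub>A'\<^esub> (\<phi> p [^]\<^bsub>A'\<^esub> N)"
    note aA = a[unfolded A_def]
    have div': "\<exists>w\<in>carrier (base_ring R n). chart.scl (a N) \<ominus>\<^bsub>base_ring R n\<^esub>
      w \<otimes>\<^bsub>base_ring R n\<^esub> chart.scl f [^]\<^bsub>base_ring R n\<^esub> k N \<in> ?W N" for N
    proof -
      let ?fk = "f [^]\<^bsub>base_ring R n\<^esub> k N"
      have fk: "?fk \<in> carrier (base_ring R n)"
        using fA by simp
      obtain x where x: "x \<in> carrier A'" "\<phi> (a N) \<ominus>\<^bsub>A'\<^esub> x \<otimes>\<^bsub>A'\<^esub> \<phi> f [^]\<^bsub>A'\<^esub> k N \<in> PIdl\<^bsub>A'\<^esub> (\<phi> p [^]\<^bsub>A'\<^esub> N)"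
        using div[of N] by blast
      obtain b where b: "b \<in> carrier ?B" "x = ?q b"
        using chart.chart_quot_surj x(1) unfolding A'_def by blast
      let ?b = "?c (a N) \<ominus>\<^bsub>?B\<^esub> ?c ?fk \<otimes>\<^bsub>?B\<^esub> b"
      have b': "?b \<in> carrier ?B"
        using b(1) fk aA by (simp add: chart.cover_const_carrier)
      have "\<phi> f [^]\<^bsub>A'\<^esub> k N = \<phi> ?fk"
        using ring_hom_ring.hom_nat_pow[OF ring_hom_ringI2[OF chart.A.ring_axioms chart.A'.ring_axioms chart.chart_map_hom] fA]
        by (simp add: A'_def \<phi>_def)
      then have eq: "\<phi> (a N) \<ominus>\<^bsub>A'\<^esub> x \<otimes>\<^bsub>A'\<^esub> \<phi> f [^]\<^bsub>A'\<^esub> k N = ?q ?b"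
        using b fk aA chart.A'.m_comm[of "?q b" "?q (?c ?fk)"]
        by (simp add: \<phi> A'_def chart.cover_const_carrier chart.A'.minus_eq chart.B.minus_eq)
      have "chart.chart_eval ?b \<in> ?W N"
        by (rule iffD1[OF divisible[OF b']]) (rule x(2)[unfolded eq])
      also have "chart.chart_eval ?b = chart.scl (a N) \<ominus>\<^bsub>base_ring R n\<^esub>
          chart.scl ?fk \<otimes>\<^bsub>base_ring R n\<^esub> chart.chart_eval b"
        using b fk aA
        by (simp add: chart.chart_eval_minus chart.chart_eval_const chart.chart_eval_const_mult chart.cover_const_carrier)
      also have "chart.scl ?fk \<otimes>\<^bsub>base_ring R n\<^esub> chart.chart_eval b =
          chart.chart_eval b \<otimes>\<^bsub>base_ring R n\<^esub> chart.scl f [^]\<^bsub>base_ring R n\<^esub> k N"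
        using ring_hom_ring.hom_nat_pow[OF ring_hom_ringI2[OF chart.A.ring_axioms chart.A.ring_axioms chart.rescale_hom] fA]
          chart.A.m_comm[OF chart.scl.hom_closed[OF fk] chart.chart_eval_carrier[OF b(1)]]
        by simp
      finally show ?thesis
        using chart.chart_eval_carrier[OF b(1)] by blast
    qed
    show "\<exists>c\<in>carrier A. a M \<ominus>\<^bsub>A\<^esub> c \<otimes>\<^bsub>A\<^esub> f [^]\<^bsub>A\<^esub> k M \<in> PIdl\<^bsub>A\<^esub> (p [^]\<^bsub>A\<^esub> M)"
      unfolding PIdl_p unfolding A_def
      by (rule chart.glue_over_rescaling[OF fA d aA compat[unfolded PIdl_p, unfolded A_def] div'])
  qed
qed

end
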